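(* There is an algorithm which, given any finite simple undirected graph $G=(V,E)$ with $n$ vertices and $m$ edges, exactly computes the vertex orbit count $\mathrm{DM}(v,\theta)$ for every vertex $v\in V$ and every one of the 73 vertex orbits $\theta$ (numbered $0$ to $72$) of the connected graphs on at least $2$ and at most $5$ vertices, and whose running time is $$O\big(W(G)+D(G)+DP(G^{\rightarrow})+DBP(G^{\rightarrow})+m+n\big).$$
   Context: Patterns and orbits. A pattern is a connected simple graph $H$ on at least 2 and at most 5 vertices, up to isomorphism (there are 30 of them). An automorphism of $H$ is a bijection $\sigma:V(H)\to V(H)$ with $(a,b)\in E(H)$ iff $(\sigma(a),\sigma(b))\in E(H)$. Two vertices of $H$ are equivalent if some automorphism of $H$ maps one to the other; the equivalence classes are the (vertex) orbits of $H$. An orbit is written $\theta=(H,S)$ with $S\subseteq V(H)$ an equivalence class. Over all 30 patterns there are 73 orbits in total, numbered $0,\dots,72$. Vertex orbit counts. A match of $H$ in $G$ is a bijection $\pi:T\to V(H)$, $T\subseteq V$, such that for all $t_1,t_2\in T$, $(\pi(t_1),\pi(t_2))\in E(H)$ implies $(t_1,t_2)\in E$ (a non-induced copy). A match of $\theta=(H,S)$ involving $v$ is a match $\pi:T\to V(H)$ with $v\in T$ and $\pi(v)\in S$. Two matches are equivalent if one is obtained from the other by composing with an automorphism of $H$. $\mathrm{DM}(v,\theta)$ is the number of distinct (inequivalent) matches of $\theta$ involving $v$. Degree orientation. Let $d(i)$ be the degree of $i$ and put $i\prec j$ if $d(i)<d(j)$, or $d(i)=d(j)$ and the id of $i$ is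 smaller than the id of $j$. $G^{\rightarrow}$ is the acyclic directed graph obtained by orienting each edge of $G$ from its $\prec$-smaller to its $\prec$-larger endpoint. Counts in the running time (all are numbers of non-induced copies). $W(G)$: number of wedges (paths with 2 edges) in $G$. $D(G)$: number of diamonds (4-cycle plus one chord, i.e. $K_4$ minus an edge) in $G$. $DP(G^{\rightarrow})$: number of directed 3-paths in $G^{\rightarrow}$, i.e. copies of the directed graph on distinct vertices $i,j,k,l$ with edges $k\to j$, $k\to l$, $j\to i$. $DBP(G^{\rightarrow})$: number of directed bipyramids in $G^{\rightarrow}$, i.e. copies of the directed graph on distinct vertices $1,2,3,4,5$ with edges $1\to2$, $1\to3$, $1\to4$, $1\to5$, $3\to2$, $2\to4$, $2\to5$, $3\to4$, $3\to5$ (an orientation of $K_5$ minus an edge). Running time is measured in the standard unit-cost RAM model, with arithmetic operations and hash-table lookups (e.g. testing whether a pair is an edge) at unit cost. *)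

theory Defs
  imports "Graph_Theory.Digraph_Component"
begin

section \<open>Graphs, matches and copies\<close>

text \<open>
  A finite simple undirected graph is a \<^locale>\<open>pair_graph\<close>: \<^const>\<open>parcs\<close> is finite, irreflexive and
  symmetric, so an undirected edge \<open>{u, v}\<close> contributes both \<open>(u, v)\<close> and \<open>(v, u)\<close>.
  Automorphisms, matches and copies are defined for arbitrary relations \<^const>\<open>parcs\<close> and therefore
  cover directed and undirected patterns alike.
\<close>

definition edge_set :: "'a pair_pre_digraph \<Rightarrow> 'a set set" where
  "edge_set G = {{u, v} | u v. (u, v) \<in> parcs G}"

definition isomorphism :: "'a pair_pre_digraph \<Rightarrow> 'b pair_pre_digraph \<Rightarrow> ('a \<Rightarrow> 'b) \<Rightarrow> bool" where
  "isomorphism H H' \<phi> \<longleftrightarrow> bij_betw \<phi> (pverts H) (pverts H') \<and>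
     (\<forall>a\<in>pverts H. \<forall>b\<in>pverts H. (a, b) \<in> parcs H \<longleftrightarrow> (\<phi> a, \<phi> b) \<in> parcs H')"

abbreviation automorphism :: "'a pair_pre_digraph \<Rightarrow> ('a \<Rightarrow> 'a) \<Rightarrow> bool" where
  "automorphism H \<equiv> isomorphism H H"

text \<open>A match \<open>\<pi> : T \<rightarrow> V(H)\<close> is a partial function with domain \<open>T\<close>. Only edges of \<open>H\<close> have to be
  present in \<open>G\<close>, i.e. copies are not necessarily induced.\<close>

definition matches :: "'b pair_pre_digraph \<Rightarrow> 'a pair_pre_digraph \<Rightarrow> ('a \<rightharpoonup> 'b) set" where
  "matches H G = {\<pi>. dom \<pi> \<subseteq> pverts G \<and> bij_betw (\<lambda>t. the (\<pi> t)) (dom \<pi>) (pverts H) \<and>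
     (\<forall>s\<in>dom \<pi>. \<forall>t\<in>dom \<pi>. (the (\<pi> s), the (\<pi> t)) \<in> parcs H \<longrightarrow> (s, t) \<in> parcs G)}"

definition match_equiv :: "'b pair_pre_digraph \<Rightarrow> ('a \<rightharpoonup> 'b) \<Rightarrow> ('a \<rightharpoonup> 'b) \<Rightarrow> bool" where
  "match_equiv H \<pi> \<pi>' \<longleftrightarrow> (\<exists>\<sigma>. automorphism H \<sigma> \<and> \<pi>' = map_option \<sigma> \<circ> \<pi>)"

definition num_distinct :: "'b pair_pre_digraph \<Rightarrow> ('a \<rightharpoonup> 'b) set \<Rightarrow> nat" where
  "num_distinct H M = card (M // {(\<pi>, \<pi>'). \<pi> \<in> M \<and> \<pi>' \<in> M \<and> match_equiv H \<pi> \<pi>'})"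

definition num_copies :: "'b pair_pre_digraph \<Rightarrow> 'a pair_pre_digraph \<Rightarrow> nat" where
  "num_copies H G = num_distinct H (matches H G)"


section \<open>Patterns and vertex orbits\<close>

text \<open>Every pattern has an isomorphic copy on natural numbers.\<close>

definition pattern :: "nat pair_pre_digraph \<Rightarrow> bool" where
  "pattern H \<longleftrightarrow> pair_graph H \<and> connected (with_proj H) \<and> 2 \<le> card (pverts H) \<and> card (pverts H) \<le> 5"

definition vertex_orbits :: "'a pair_pre_digraph \<Rightarrow> 'a set set" where
  "vertex_orbits H =
     pverts H // {(a, b). a \<in> pverts H \<and> b \<in> pverts H \<and> (\<exists>\<sigma>. automorphism H \<sigma> \<and> \<sigma> a = b)}"

type_synonym orbit = "nat pair_pre_digraph \<times> nat set"

definition is_orbit :: "orbit \<Rightarrow> bool" where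
  "is_orbit \<theta> \<longleftrightarrow> pattern (fst \<theta>) \<and> snd \<theta> \<in> vertex_orbits (fst \<theta>)"

definition same_orbit :: "orbit \<Rightarrow> orbit \<Rightarrow> bool" where
  "same_orbit \<theta> \<theta>' \<longleftrightarrow> (\<exists>\<phi>. isomorphism (fst \<theta>) (fst \<theta>') \<phi> \<and> \<phi> ` snd \<theta> = snd \<theta>')"

text \<open>\<open>\<theta> 0, \<dots>, \<theta> 72\<close> is a complete list, without repetitions, of the orbits of all patterns, where
  patterns are taken up to isomorphism.\<close>

definition orbit_numbering :: "(nat \<Rightarrow> orbit) \<Rightarrow> bool" where
  "orbit_numbering \<theta> \<longleftrightarrow>
     (\<forall>i<73. is_orbit (\<theta> i)) \<and>
     (\<forall>i<73. \<forall>j<73. same_orbit (\<theta> i) (\<theta> j) \<longrightarrow> i = j) \<and>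
     (\<forall>\<tau>. is_orbit \<tau> \<longrightarrow> (\<exists>i<73. same_orbit \<tau> (\<theta> i)))"

definition DM :: "'a pair_pre_digraph \<Rightarrow> 'a \<Rightarrow> orbit \<Rightarrow> nat" where
  "DM G v \<theta> = num_distinct (fst \<theta>)
     {\<pi> \<in> matches (fst \<theta>) G. v \<in> dom \<pi> \<and> the (\<pi> v) \<in> snd \<theta>}"


section \<open>Degree orientation and the counts in the running time\<close>

definition deg_less :: "nat pair_pre_digraph \<Rightarrow> nat \<Rightarrow> nat \<Rightarrow> bool" where
  "deg_less G i j \<longleftrightarrow>
     out_degree (with_proj G) i < out_degree (with_proj G) j \<or>
     out_degree (with_proj G) i = out_degree (with_proj G) j \<and> i < j"

definition orient :: "nat pair_pre_digraph \<Rightarrow> nat pair_pre_digraph" where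
  "orient G = \<lparr>pverts = pverts G, parcs = {(i, j) \<in> parcs G. deg_less G i j}\<rparr>"

definition wedge :: "nat pair_pre_digraph" where
  "wedge = mk_symmetric (with_proj \<lparr>pverts = {1, 2, 3}, parcs = {(1, 2), (2, 3)}\<rparr>)"

definition diamond :: "nat pair_pre_digraph" where
  "diamond = mk_symmetric (with_proj
     \<lparr>pverts = {1, 2, 3, 4}, parcs = {(1, 2), (2, 3), (3, 4), (4, 1), (1, 3)}\<rparr>)"

text \<open>The vertices \<open>i, j, k, l\<close> are \<open>1, 2, 3, 4\<close>; the arcs are \<open>k \<rightarrow> j\<close>, \<open>k \<rightarrow> l\<close> and \<open>j \<rightarrow> i\<close>.\<close>

definition directed_3path :: "nat pair_pre_digraph" where
  "directed_3path = \<lparr>pverts = {1, 2, 3, 4}, parcs = {(3, 2), (3, 4), (2, 1)}\<rparr>"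

definition directed_bipyramid :: "nat pair_pre_digraph" where
  "directed_bipyramid = \<lparr>pverts = {1, 2, 3, 4, 5},
     parcs = {(1, 2), (1, 3), (1, 4), (1, 5), (3, 2), (2, 4), (2, 5), (3, 4), (3, 5)}\<rparr>"


section \<open>Unit-cost RAM programs\<close>

text \<open>
  Programs work on integer registers and on hash tables, both indexed by the (finitely many)
  numbers that occur in the program text. The keys of a hash table are tuples of integers, whose
  lengths are fixed in the program text; absent keys have value \<open>0\<close>. One-element keys give ordinary
  indirectly addressed memory.

  Every node of an expression and every command executed costs one unit. To avoid the well-known
  power of unit-cost arithmetic on numbers of unbounded length, a bound \<open>B\<close> on the absolute value of
  a machine word is imposed: an execution in which some expression leaves this range is stuck, i.e.
  it has no final state.
\<close>

datatype binop = Plus | Minus | Times | Div | Mod | Less | Equal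

datatype expr =
    Const int
  | Reg nat
  | Lookup nat "expr list"
  | Op binop expr expr

datatype prog =
    Skip
  | Assign nat expr
  | Store nat "expr list" expr
  | Seq prog prog
  | Cond expr prog prog
  | While expr prog

record ram =
  regs :: "nat \<Rightarrow> int"
  tabs :: "nat \<Rightarrow> int list \<Rightarrow> int"

fun op_val :: "binop \<Rightarrow> int \<Rightarrow> int \<Rightarrow> int" where
  "op_val Plus x y = x + y"
| "op_val Minus x y = x - y"
| "op_val Times x y = x * y"
| "op_val Div x y = x div y"
| "op_val Mod x y = x mod y"
| "op_val Less x y = of_bool (x < y)"
| "op_val Equal x y = of_bool (x = y)"

fun val :: "ram \<Rightarrow> expr \<Rightarrow> int" where
  "val s (Const c) = c"
| "val s (Reg r) = regs s r"
| "val s (Lookup h ks) = tabs s h (map (val s) ks)"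
| "val s (Op f a b) = op_val f (val s a) (val s b)"

fun subexprs :: "expr \<Rightarrow> expr list" where
  "subexprs (Const c) = [Const c]"
| "subexprs (Reg r) = [Reg r]"
| "subexprs (Lookup h ks) = Lookup h ks # concat (map subexprs ks)"
| "subexprs (Op f a b) = Op f a b # subexprs a @ subexprs b"

abbreviation cost :: "expr \<Rightarrow> nat" where
  "cost e \<equiv> length (subexprs e)"

definition fits :: "int \<Rightarrow> ram \<Rightarrow> expr \<Rightarrow> bool" where
  "fits B s e \<longleftrightarrow> (\<forall>e'\<in>set (subexprs e). \<bar>val s e'\<bar> \<le> B)"

text \<open>\<open>exec B P s t s'\<close>: started in \<open>s\<close>, program \<open>P\<close> halts in \<open>s'\<close> after \<open>t\<close> units of time. Conditions
  are true iff they are nonzero.\<close>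

inductive exec :: "int \<Rightarrow> prog \<Rightarrow> ram \<Rightarrow> nat \<Rightarrow> ram \<Rightarrow> bool" for B :: int where
  Skip: "exec B Skip s 1 s"
| Assign: "fits B s e \<Longrightarrow>
    exec B (Assign r e) s (1 + cost e) (s\<lparr>regs := (regs s)(r := val s e)\<rparr>)"
| Store: "fits B s e \<Longrightarrow> (\<forall>k\<in>set ks. fits B s k) \<Longrightarrow>
    exec B (Store h ks e) s (1 + cost e + sum_list (map cost ks))
      (s\<lparr>tabs := (tabs s)(h := (tabs s h)(map (val s) ks := val s e))\<rparr>)"
| Seq: "exec B P s t s' \<Longrightarrow> exec B Q s' t' s'' \<Longrightarrow> exec B (Seq P Q) s (t + t') s''"
| CondTrue: "fits B s e \<Longrightarrow> val s e \<noteq> 0 \<Longrightarrow> exec B P s t s' \<Longrightarrow>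
    exec B (Cond e P Q) s (1 + cost e + t) s'"
| CondFalse: "fits B s e \<Longrightarrow> val s e = 0 \<Longrightarrow> exec B Q s t s' \<Longrightarrow>
    exec B (Cond e P Q) s (1 + cost e + t) s'"
| WhileFalse: "fits B s e \<Longrightarrow> val s e = 0 \<Longrightarrow> exec B (While e P) s (1 + cost e) s"
| WhileTrue: "fits B s e \<Longrightarrow> val s e \<noteq> 0 \<Longrightarrow> exec B P s t s' \<Longrightarrow>
    exec B (While e P) s' t' s'' \<Longrightarrow> exec B (While e P) s (1 + cost e + t + t') s''"

lemma exec_deterministic:
  "exec B P s t s' \<Longrightarrow> exec B P s u s'' \<Longrightarrow> u = t \<and> s'' = s'"
proof (induction arbitrary: u s'' rule: exec.induct)
  case Skip
  from Skip.prems show ?case by cases auto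
next
  case Assign
  from Assign.prems show ?case by cases auto
next
  case Store
  from Store.prems show ?case by cases auto
next
  case Seq
  from Seq.prems show ?case by cases (use Seq.IH in blast)
next
  case CondTrue
  from CondTrue.prems show ?case by cases (use CondTrue in blast)+
next
  case CondFalse
  from CondFalse.prems show ?case by cases (use CondFalse in blast)+
next
  case WhileFalse
  from WhileFalse.prems show ?case by cases (use WhileFalse in blast)+
next
  case WhileTrue
  from WhileTrue.prems show ?case by cases (use WhileTrue in blast)+
qed


section \<open>Input\<close>

text \<open>The input graph has the vertices (ids) \<open>0, \<dots>, n - 1\<close> and is given by a list of its edges, in any
  order, with every undirected edge occurring exactly once and in an arbitrary direction.\<close>

definition edge_listing :: "'a pair_pre_digraph \<Rightarrow> ('a \<times> 'a) list \<Rightarrow> bool" where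
  "edge_listing G es \<longleftrightarrow>
     distinct es \<and> set es \<union> (set es)\<inverse> = parcs G \<and> set es \<inter> (set es)\<inverse> = {}"

text \<open>Registers \<open>0\<close> and \<open>1\<close> hold \<open>n\<close> and \<open>m\<close>; table \<open>0\<close> holds the end points of the \<open>i\<close>-th edge under
  the keys \<open>(i, 0)\<close> and \<open>(i, 1)\<close>. All other memory is zero.\<close>

definition input_state :: "nat \<Rightarrow> (nat \<times> nat) list \<Rightarrow> ram" where
  "input_state n es = \<lparr>
     regs = (\<lambda>_. 0)(0 := int n, 1 := int (length es)),
     tabs = (\<lambda>_ _. 0)(0 := (\<lambda>key.
       if \<exists>i<length es. key = [int i, 0] then int (fst (es ! nat (hd key)))
       else if \<exists>i<length es. key = [int i, 1] then int (snd (es ! nat (hd key)))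
       else 0))\<rparr>"

end

theory Submission
  imports Defs "HOL-Library.List_Lexorder"
begin

text \<open>
  Up to the number of automorphisms of \<open>H\<close>, the count for the orbit \<open>(H, S)\<close> at \<open>v\<close> is the number of
  injective homomorphisms from \<open>H\<close> to \<open>G\<close> that map a vertex of \<open>S\<close> to \<open>v\<close>. Inclusion-exclusion, by
  contracting pairs of vertices of \<open>H\<close>, expresses it through numbers of arbitrary homomorphisms
  of connected graphs on at most five vertices with a prescribed image of a root. Such a number is a
  sum of products and is computed by eliminating the variables one by one and tabulating the partial
  sums. For every rooted pattern but the 5-cycle and the 5-clique there is an elimination order in which
  each partial sum ranges over edges, wedges or diamonds of \<open>G\<close>; this is a finite check on the 73
  rooted patterns. In the acyclic degree orientation, a closed walk of length 5 splits in exactly one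
  way into a directed 3-path and a wedge of a certain kind. Sorting the vertices of a 5-clique by the
  orientation exhibits it as a directed bipyramid plus one arc, and the directed bipyramids are
  enumerated as pairs of 4-cliques on a directed triangle.
\<close>

text \<open>Homomorphisms are counted instead of embeddings because every disequality would be a
  further factor: with all of them present, already the first bag is the whole pattern. A
  contraction keeps a pattern connected and does not enlarge it, so the same finite check covers
  every term of the inclusion-exclusion.

  The two exceptions are genuine for this notion of bag. For the 5-cycle every elimination order
  meets a bag that is connected only through an earlier table; its tuples come from undirected
  3-paths, whose number is not bounded by wedges and diamonds. In the 5-clique the first bag already
  has five vertices. Only these two cases need the orientation.

  No program is written out for the orbits. The predicate \<open>computable\<close> asserts that
  some program prepares tables within the time bound so that a fixed expression has the desired
  value; it is closed under arithmetic and under summing out variables. As machine words are bounded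
  by a power of \<open>n + 2\<close>, each closure step has to bound the values, and all partial
  sums, besides the time.\<close>

section \<open>Total correctness with time bounds\<close>

text \<open>Since \<open>exec\<close> is deterministic, one halting run within \<open>T\<close> is
  total correctness. \<open>T\<close> is only an upper bound, so that the rules compose with rough
  estimates.\<close>

definition wp :: "int \<Rightarrow> prog \<Rightarrow> nat \<Rightarrow> (ram \<Rightarrow> bool) \<Rightarrow> ram \<Rightarrow> bool" where
  "wp B P T Q s \<longleftrightarrow> (\<exists>t s'. exec B P s t s' \<and> t \<le> T \<and> Q s')"

lemma wp_mono: "wp B P T Q s \<Longrightarrow> T \<le> T' \<Longrightarrow> (\<And>s'. Q s' \<Longrightarrow> Q' s') \<Longrightarrow> wp B P T' Q' s"
  unfolding wp_def by (meson le_trans)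

lemma wp_Skip: "Q s \<Longrightarrow> 1 \<le> T \<Longrightarrow> wp B Skip T Q s"
  unfolding wp_def by (blast intro: exec.Skip)

lemma wp_Assign:
  "fits B s e \<Longrightarrow> Q (s\<lparr>regs := (regs s)(r := val s e)\<rparr>) \<Longrightarrow> 1 + cost e \<le> T \<Longrightarrow> wp B (Assign r e) T Q s"
  unfolding wp_def by (blast intro: exec.Assign)

lemma wp_Store:
  "fits B s e \<Longrightarrow> \<forall>k\<in>set ks. fits B s k \<Longrightarrow>
   Q (s\<lparr>tabs := (tabs s)(h := (tabs s h)(map (val s) ks := val s e))\<rparr>) \<Longrightarrow>
   1 + cost e + sum_list (map cost ks) \<le> T \<Longrightarrow> wp B (Store h ks e) T Q s"
  unfolding wp_def by (blast intro: exec.Store)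

lemma wp_Seq: "wp B P U (\<lambda>s'. wp B R V Q s') s \<Longrightarrow> U + V \<le> T \<Longrightarrow> wp B (Seq P R) T Q s"
  unfolding wp_def by (meson add_mono exec.Seq le_trans)

lemma wp_Cond:
  assumes "fits B s e" "val s e \<noteq> 0 \<Longrightarrow> wp B P T Q s" "val s e = 0 \<Longrightarrow> wp B R T Q s"
    "1 + cost e + T \<le> T'"
  shows "wp B (Cond e P R) T' Q s"
proof (cases "val s e = 0")
  case True
  with assms obtain t s' where "exec B R s t s'" "t \<le> T" "Q s'" unfolding wp_def by blast
  with True assms show ?thesis unfolding wp_def
    by (intro exI[of _ "1 + cost e + t"] exI[of _ s'] conjI exec.CondFalse) simp_all
next
  case False
  with assms obtain t s' where "exec B P s t s'" "t \<le> T" "Q s'" unfolding wp_def by blast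
  with False assms show ?thesis unfolding wp_def
    by (intro exI[of _ "1 + cost e + t"] exI[of _ s'] conjI exec.CondTrue) simp_all
qed

text \<open>Only counting loops occur: the number of finished iterations indexes the invariant, and
  termination is by \<open>len - i\<close>. The time \<tau> depends on the iteration because inner
  loops vary in length; the budget is met by the sum of these lengths, not by their maximum times
  \<open>len\<close>.\<close>

lemma wp_While:
  assumes body: "\<And>i s. i < len \<Longrightarrow> J i s \<Longrightarrow> wp B P (\<tau> i) (J (Suc i)) s"
    and test: "\<And>i s. i \<le> len \<Longrightarrow> J i s \<Longrightarrow> fits B s e \<and> (val s e \<noteq> 0 \<longleftrightarrow> i < len)"
    and "J i s" "i \<le> len"
  shows "wp B (While e P) ((\<Sum>k=i..<len. 1 + cost e + \<tau> k) + 1 + cost e) (J len) s"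
  using assms(3,4)
proof (induction "len - i" arbitrary: i s)
  case 0
  then have "i = len" by simp
  with test[of i s] 0 have "exec B (While e P) s (1 + cost e) s"
    by (intro exec.WhileFalse) auto
  with \<open>i = len\<close> 0 show ?case unfolding wp_def by auto
next
  case (Suc d)
  then have "i < len" by simp
  from body[OF this \<open>J i s\<close>] obtain t s' where 1: "exec B P s t s'" "t \<le> \<tau> i" "J (Suc i) s'"
    unfolding wp_def by blast
  have "d = len - Suc i" "Suc i \<le> len" using Suc.hyps(2) by auto
  from Suc.hyps(1)[OF this(1) 1(3) this(2)] obtain t' s'' where
    2: "exec B (While e P) s' t' s''" "t' \<le> (\<Sum>k=Suc i..<len. 1 + cost e + \<tau> k) + 1 + cost e" "J len s''"
    unfolding wp_def by blast
  have "exec B (While e P) s (1 + cost e + t + t') s''"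
    using test[of i s] Suc.prems \<open>i < len\<close> 1 2 by (intro exec.WhileTrue) auto
  moreover have "1 + cost e + t + t' \<le> (\<Sum>k=i..<len. 1 + cost e + \<tau> k) + 1 + cost e"
    using 1 2 \<open>i < len\<close> by (subst sum.atLeast_Suc_lessThan) auto
  ultimately show ?case using 2 unfolding wp_def by blast
qed

lemma fits_simps [simp]:
  "fits B s (Const c) \<longleftrightarrow> \<bar>c\<bar> \<le> B"
  "fits B s (Reg r) \<longleftrightarrow> \<bar>regs s r\<bar> \<le> B"
  "fits B s (Lookup h ks) \<longleftrightarrow> \<bar>tabs s h (map (val s) ks)\<bar> \<le> B \<and> (\<forall>k\<in>set ks. fits B s k)"
  "fits B s (Op f a b) \<longleftrightarrow> \<bar>op_val f (val s a) (val s b)\<bar> \<le> B \<and> fits B s a \<and> fits B s b"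
  by (auto simp: fits_def)

section \<open>Nested loops over tabulated lists\<close>

text \<open>Variable \<open>x\<close> of a loop nest lives in register \<open>2 * x + 2\<close>, the counter of its loop in
  register \<open>2 * x + 3\<close>.\<close>

abbreviation var :: "nat \<Rightarrow> nat" where "var x \<equiv> 2 * x + 2"
abbreviation ctr :: "nat \<Rightarrow> nat" where "ctr x \<equiv> 2 * x + 3"
abbreviation rvar :: "nat \<Rightarrow> expr" where "rvar x \<equiv> Reg (var x)"

text \<open>The range of one loop: \<open>Rng q\<close> stands for the numbers below the contents of
  register \<open>q\<close>, \<open>Fam h ks\<close> for the set that table \<open>h\<close> stores
  under the current values of the variables \<open>ks\<close>.\<close>

datatype level = Rng nat | Fam nat "nat list"

fun bnd :: "level \<Rightarrow> expr" where
  "bnd (Rng q) = Reg q"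
| "bnd (Fam h ks) = Lookup h (Const 1 # map rvar ks)"

fun elm :: "nat \<Rightarrow> level \<Rightarrow> expr" where
  "elm x (Rng q) = Reg (ctr x)"
| "elm x (Fam h ks) = Lookup h (Const 2 # Reg (ctr x) # map rvar ks)"

fun nest :: "(nat \<times> level) list \<Rightarrow> prog \<Rightarrow> prog" where
  "nest [] P = P"
| "nest ((x, l) # ls) P = Seq (Assign (ctr x) (Const 0))
     (While (Op Less (Reg (ctr x)) (bnd l))
       (Seq (Seq (Assign (var x) (elm x l)) (nest ls P)) (Assign (ctr x) (Op Plus (Reg (ctr x)) (Const 1)))))"

fun lvl :: "(nat \<Rightarrow> nat) \<Rightarrow> (nat \<Rightarrow> nat list \<Rightarrow> nat list) \<Rightarrow> level \<Rightarrow> (nat \<Rightarrow> nat) \<Rightarrow> nat list" where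
  "lvl r L (Rng q) \<phi> = [0..<r q]"
| "lvl r L (Fam h ks) \<phi> = L h (map \<phi> ks)"

text \<open>The assignments under which the loop body is executed, in order of execution. Invariants
  of a nest are indexed by initial segments of this list.\<close>

fun trace where
  "trace r L [] \<phi> = [\<phi>]"
| "trace r L ((x, l) # ls) \<phi> = concat (map (\<lambda>y. trace r L ls (\<phi>(x := y))) (lvl r L l \<phi>))"

text \<open>Entering a loop is charged too, so that iterations whose inner loops are empty are paid
  for.\<close>

fun steps :: "(nat \<Rightarrow> nat) \<Rightarrow> (nat \<Rightarrow> nat list \<Rightarrow> nat list) \<Rightarrow> (nat \<times> level) list \<Rightarrow> (nat \<Rightarrow> nat) \<Rightarrow> nat" where
  "steps r L [] \<phi> = 1"
| "steps r L ((x, l) # ls) \<phi> = 1 + (\<Sum>y\<leftarrow>lvl r L l \<phi>. steps r L ls (\<phi>(x := y)))"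

text \<open>A family is looked up afresh in each iteration, so its keys must be constant while its
  loop runs: they avoid the variable of that loop and those of all inner loops.\<close>

fun wf_levels :: "(nat \<times> level) list \<Rightarrow> bool" where
  "wf_levels [] \<longleftrightarrow> True"
| "wf_levels ((x, l) # ls) \<longleftrightarrow> x \<notin> fst ` set ls \<and> wf_levels ls \<and>
     (case l of Rng q \<Rightarrow> q < 2 | Fam h ks \<Rightarrow> set ks \<inter> insert x (fst ` set ls) = {})"

text \<open>The price of one unit of \<open>steps\<close>. The keys are evaluated twice per
  iteration, for the bound and for the element; 30 generously covers the remaining test, assignments
  and increment.\<close>

fun nest_cost :: "(nat \<times> level) list \<Rightarrow> nat \<Rightarrow> nat" where
  "nest_cost [] c = c"
| "nest_cost ((x, l) # ls) c =
     nest_cost ls c + 30 + 2 * (case l of Rng q \<Rightarrow> 0 | Fam h ks \<Rightarrow> length ks)"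

text \<open>A family of finite sets is stored as one table: membership flags under the keys
  \<open>0 # x # ks\<close>, cardinalities under \<open>1 # ks\<close>, and the elements in some order under \<open>2 # i # ks\<close>.\<close>

definition rep :: "(int list \<Rightarrow> int) \<Rightarrow> (nat list \<Rightarrow> nat list) \<Rightarrow> bool" where
  "rep T L \<longleftrightarrow> (\<forall>ks. distinct (L ks) \<and> T (1 # map int ks) = int (length (L ks)) \<and>
     (\<forall>i<length (L ks). T (2 # int i # map int ks) = int (L ks ! i)) \<and>
     (\<forall>x. T (0 # int x # map int ks) = of_bool (x \<in> set (L ks))))"

text \<open>Outside \<open>X\<close> the variable registers hold the assignment \<phi>; inside
  \<open>X\<close> they may hold anything up to \<open>M\<close>, as registers do that are left over
  from earlier loops. \<open>r\<close> gives the contents of the two input registers.\<close>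

definition st :: "(nat \<Rightarrow> nat) \<Rightarrow> nat \<Rightarrow> (nat \<Rightarrow> nat) \<Rightarrow> nat set \<Rightarrow> ram \<Rightarrow> bool" where
  "st r M \<phi> X s \<longleftrightarrow> (\<forall>q<2. regs s q = int (r q)) \<and> (\<forall>x. 0 \<le> regs s (var x) \<and> regs s (var x) \<le> int M) \<and>
     (\<forall>x. x \<notin> X \<longrightarrow> regs s (var x) = int (\<phi> x))"

definition loop_regs :: "(nat \<times> level) list \<Rightarrow> nat set" where
  "loop_regs ls = (\<Union>x\<in>fst ` set ls. {var x, ctr x})"

lemma sum_list_cost_rvar [simp]: "sum_list (map cost (map rvar ks)) = length ks"
  by (induction ks) auto

lemma length_concat_subexprs_rvar: "length (concat (map subexprs (map rvar ks))) = length ks"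
  by (induction ks) auto

lemma steps_pos: "1 \<le> steps r L ls \<phi>"
  by (cases "(r, L, ls, \<phi>)" rule: steps.cases) auto

lemma var_notin_loop_regs: "x \<notin> fst ` set ls \<Longrightarrow> var x \<notin> loop_regs ls"
  unfolding loop_regs_def by (auto; presburger)

lemma ctr_notin_loop_regs: "x \<notin> fst ` set ls \<Longrightarrow> ctr x \<notin> loop_regs ls"
  unfolding loop_regs_def by (auto; presburger)

lemma small_notin_loop_regs: "q < 2 \<Longrightarrow> q \<notin> loop_regs ls"
  unfolding loop_regs_def by auto

lemma loop_regs_Cons: "loop_regs ((x, l) # ls) = {var x, ctr x} \<union> loop_regs ls"
  unfolding loop_regs_def by auto

lemma lvl_exprs:
  assumes "st r M \<phi> X s" and "case l of Rng q \<Rightarrow> q < 2 | Fam h ks \<Rightarrow> set ks \<inter> X = {}"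
    and "int M < B" "2 \<le> B" "r 0 \<le> M" "r 1 \<le> M"
    and "\<And>h ks. l = Fam h ks \<Longrightarrow> rep (tabs s h) (L h) \<and> (\<forall>ks. length (L h ks) \<le> M \<and> (\<forall>y\<in>set (L h ks). y \<le> M))"
  shows "fits B s (bnd l) \<and> val s (bnd l) = int (length (lvl r L l \<phi>)) \<and> length (lvl r L l \<phi>) \<le> M \<and>
    (\<forall>i<length (lvl r L l \<phi>). regs s (ctr x) = int i \<longrightarrow> fits B s (elm x l) \<and>
       val s (elm x l) = int (lvl r L l \<phi> ! i) \<and> lvl r L l \<phi> ! i \<le> M)"
proof (cases l)
  case (Rng q)
  then have "q = 0 \<or> q = 1" using assms(2) by auto
  with assms Rng show ?thesis unfolding st_def by auto
next
  case (Fam h ks)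
  have key: "map (val s) (map rvar ks) = map int (map \<phi> ks)"
    using assms(1,2) Fam unfolding st_def by auto
  have vars: "\<forall>k\<in>set (map rvar ks). fits B s k"
    using assms(1,3) unfolding st_def by (auto simp: abs_if) (smt (verit))+
  have R: "rep (tabs s h) (L h)" and bd: "\<And>ks. length (L h ks) \<le> M" "\<And>y ks. y \<in> set (L h ks) \<Longrightarrow> y \<le> M"
    using assms(7) Fam by auto
  let ?ys = "L h (map \<phi> ks)"
  have T: "tabs s h (1 # map int (map \<phi> ks)) = int (length ?ys)"
    "\<And>i. i < length ?ys \<Longrightarrow> tabs s h (2 # int i # map int (map \<phi> ks)) = int (?ys ! i)"
    using R unfolding rep_def by blast+
  have le: "?ys ! i \<le> M" if "i < length ?ys" for i
    using bd(2) that nth_mem by blast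
  show ?thesis
  proof (intro conjI allI impI)
    show "fits B s (bnd l)"
      using Fam T(1) key vars bd(1)[of "map \<phi> ks"] assms(3,4) by (simp del: map_map)
    show "val s (bnd l) = int (length (lvl r L l \<phi>))"
      using Fam T(1) key by (simp del: map_map)
    show "length (lvl r L l \<phi>) \<le> M" using Fam bd by simp
    fix i assume i: "i < length (lvl r L l \<phi>)" "regs s (ctr x) = int i"
    then have i': "i < length ?ys" using Fam by simp
    show "val s (elm x l) = int (lvl r L l \<phi> ! i)"
      using Fam T(2)[OF i'] key i by (simp del: map_map)
    show "lvl r L l \<phi> ! i \<le> M" using le[OF i'] Fam by simp
    have "\<bar>int (?ys ! i)\<bar> \<le> B" "\<bar>int i\<bar> \<le> B" using le[OF i'] assms(3) i' bd(1)[of "map \<phi> ks"] by auto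
    then show "fits B s (elm x l)"
      using Fam T(2)[OF i'] key i vars assms(4) by (simp del: map_map)
  qed
qed

lemma cost_bnd: "cost (bnd l) \<le> 2 + (case l of Rng q \<Rightarrow> 0 | Fam h ks \<Rightarrow> length ks)"
  using length_concat_subexprs_rvar by (cases l) (auto simp del: map_map)

lemma cost_elm: "cost (elm x l) \<le> 3 + (case l of Rng q \<Rightarrow> 0 | Fam h ks \<Rightarrow> length ks)"
  using length_concat_subexprs_rvar by (cases l) (auto simp del: map_map)

text \<open>The complete list \<open>tr\<close> stays fixed while an inner nest handles only a
  segment of it. The body therefore always knows that what has been processed is an initial segment
  of \<open>tr\<close>, which later bounds every partial sum by a total over \<open>tr\<close>. The
  families are required to be intact under the invariant because the body may write to
  tables.\<close>

theorem wp_nest: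
  assumes MB: "int M < B" "2 \<le> B" "r 0 \<le> M" "r 1 \<le> M"
    and body: "\<And>pre \<phi> post s. tr = pre @ \<phi> # post \<Longrightarrow> I pre (tabs s) \<Longrightarrow> st r M \<phi> {} s \<Longrightarrow>
      wp B P c (\<lambda>s'. regs s' = regs s \<and> I (pre @ [\<phi>]) (tabs s')) s"
    and fam: "\<And>pre T x h ks. I pre T \<Longrightarrow> (x, Fam h ks) \<in> set ls \<Longrightarrow>
      rep (T h) (L h) \<and> (\<forall>ks. length (L h ks) \<le> M \<and> (\<forall>y\<in>set (L h ks). y \<le> M))"
    and "wf_levels ls" "tr = pre @ trace r L ls \<phi> @ post" "I pre (tabs s)" "st r M \<phi> (fst ` set ls) s"
  shows "wp B (nest ls P) (nest_cost ls c * steps r L ls \<phi>)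
    (\<lambda>s'. (\<forall>q. q \<notin> loop_regs ls \<longrightarrow> regs s' q = regs s q) \<and>
          (\<forall>x. 0 \<le> regs s' (var x) \<and> regs s' (var x) \<le> int M) \<and> I (pre @ trace r L ls \<phi>) (tabs s')) s"
  using fam assms(7-)
proof (induction ls arbitrary: pre \<phi> post s)
  case Nil
  have "wp B P c (\<lambda>s'. regs s' = regs s \<and> I (pre @ [\<phi>]) (tabs s')) s"
    using Nil by (intro body) auto
  then show ?case
    by (simp, elim wp_mono) (use Nil in \<open>auto simp: st_def\<close>)
next
  case (Cons xl ls)
  obtain x l where xl: "xl = (x, l)" by force
  let ?X = "insert x (fst ` set ls)"
  let ?ys = "lvl r L l \<phi>"
  let ?len = "length ?ys"
  have x: "x \<notin> fst ` set ls" and wf: "wf_levels ls"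
    and l: "case l of Rng q \<Rightarrow> q < 2 | Fam h ks \<Rightarrow> set ks \<inter> ?X = {}"
    using Cons.prems(2) xl by auto
  define k where "k = (case l of Rng q \<Rightarrow> 0 | Fam h ks \<Rightarrow> length ks)"
  \<comment> \<open>\<open>ps i\<close> lists the assignments handled before iteration
    \<open>i\<close>. \<open>J0\<close> leaves the counter out because it must also hold between the
    end of the inner nest and the increment.\<close>
  define ps where "ps i = pre @ concat (map (\<lambda>y. trace r L ls (\<phi>(x := y))) (take i ?ys))" for i
  define J0 where "J0 i s' \<longleftrightarrow> (\<forall>q. q \<notin> loop_regs (xl # ls) \<longrightarrow> regs s' q = regs s q) \<and>
    (\<forall>x. 0 \<le> regs s' (var x) \<and> regs s' (var x) \<le> int M) \<and> I (ps i) (tabs s')" for i and s' :: ram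
  define J where "J i s' \<longleftrightarrow> regs s' (ctr x) = int i \<and> J0 i s'" for i s'
  let ?e = "Op Less (Reg (ctr x)) (bnd l)"
  let ?inc = "Assign (ctr x) (Op Plus (Reg (ctr x)) (Const 1))"
  have stJ: "st r M \<phi> ?X s'" if "J0 i s'" for i s'
  proof -
    have "var z \<notin> loop_regs (xl # ls)" if "z \<notin> ?X" for z
      using that var_notin_loop_regs[of z "xl # ls"] xl by auto
    then show ?thesis
      using that Cons.prems(5) unfolding J0_def st_def xl
      by (auto simp: small_notin_loop_regs)
  qed
  have ex: "fits B s' (bnd l) \<and> val s' (bnd l) = int ?len \<and> ?len \<le> M \<and>
    (\<forall>i<?len. regs s' (ctr x) = int i \<longrightarrow> fits B s' (elm x l) \<and>
       val s' (elm x l) = int (?ys ! i) \<and> ?ys ! i \<le> M)" if "J0 i s'" for i s'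
  proof (rule lvl_exprs[OF stJ[OF that] l MB])
    fix h ks assume "l = Fam h ks"
    then show "rep (tabs s' h) (L h) \<and> (\<forall>ks. length (L h ks) \<le> M \<and> (\<forall>y\<in>set (L h ks). y \<le> M))"
      using Cons.prems(1)[of "ps i" "tabs s'" x h ks] that xl unfolding J0_def by auto
  qed
  have costs: "cost ?e \<le> 4 + k" "1 + cost (elm x l) \<le> 4 + k"
    using cost_bnd[of l] cost_elm[of x l] unfolding k_def by auto
  have step: "wp B (Seq (Seq (Assign (var x) (elm x l)) (nest ls P)) ?inc)
      (8 + k + nest_cost ls c * steps r L ls (\<phi>(x := ?ys ! i))) (J (Suc i)) s'"
    if i: "i < ?len" and "J i s'" for i s'
  proof -
    have J0: "J0 i s'" and ri: "regs s' (ctr x) = int i" using \<open>J i s'\<close> unfolding J_def by auto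
    note e = ex[OF J0, THEN conjunct2, THEN conjunct2, THEN conjunct2, rule_format, OF i ri]
    let ?s = "s'\<lparr>regs := (regs s')(var x := val s' (elm x l))\<rparr>"
    let ?\<phi> = "\<phi>(x := ?ys ! i)"
    have ps: "ps (Suc i) = ps i @ trace r L ls ?\<phi>"
      unfolding ps_def using i by (simp add: take_Suc_conv_app_nth)
    have tr: "tr = ps i @ trace r L ls ?\<phi> @ (concat (map (\<lambda>y. trace r L ls (\<phi>(x := y))) (drop (Suc i) ?ys)) @ post)"
    proof -
      have "?ys = take i ?ys @ ?ys ! i # drop (Suc i) ?ys" using i by (rule id_take_nth_drop)
      then have "concat (map (\<lambda>y. trace r L ls (\<phi>(x := y))) ?ys) =
        concat (map (\<lambda>y. trace r L ls (\<phi>(x := y))) (take i ?ys @ ?ys ! i # drop (Suc i) ?ys))" by simp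
      then show ?thesis using Cons.prems(3) xl unfolding ps_def by simp
    qed
    have vc: "2 * z + 2 = 2 * x + 2 \<longleftrightarrow> z = x" for z by auto
    have st': "st r M ?\<phi> (fst ` set ls) ?s"
      using stJ[OF J0] e unfolding st_def by auto
    have IHr: "wp B (nest ls P) (nest_cost ls c * steps r L ls ?\<phi>)
      (\<lambda>s''. (\<forall>q. q \<notin> loop_regs ls \<longrightarrow> regs s'' q = regs ?s q) \<and>
          (\<forall>x. 0 \<le> regs s'' (var x) \<and> regs s'' (var x) \<le> int M) \<and> I (ps i @ trace r L ls ?\<phi>) (tabs s'')) ?s"
    proof (rule Cons.IH[OF _ wf tr _ st'])
      show "I (ps i) (tabs ?s)" using J0 by (simp add: J0_def)
      fix pre T z h ks assume "I pre T" "(z, Fam h ks) \<in> set ls"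
      then show "rep (T h) (L h) \<and> (\<forall>ks. length (L h ks) \<le> M \<and> (\<forall>y\<in>set (L h ks). y \<le> M))"
        by (intro Cons.prems(1)[of pre T z h ks]) auto
    qed
    have "wp B (Seq (Assign (var x) (elm x l)) (nest ls P)) (4 + k + nest_cost ls c * steps r L ls ?\<phi>)
       (\<lambda>s''. regs s'' (ctr x) = int i \<and> J0 (Suc i) s'') s'"
    proof (rule wp_Seq[where U = "4 + k", OF wp_Assign])
      show "fits B s' (elm x l)" using e by simp
      show "1 + cost (elm x l) \<le> 4 + k" by (rule costs)
      show "wp B (nest ls P) (nest_cost ls c * steps r L ls ?\<phi>)
        (\<lambda>s''. regs s'' (ctr x) = int i \<and> J0 (Suc i) s'') ?s"
      proof (rule wp_mono[OF IHr order_refl], elim conjE, intro conjI)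
        fix s'' :: ram assume fr: "\<forall>q. q \<notin> loop_regs ls \<longrightarrow> regs s'' q = regs ?s q"
          and bd: "\<forall>x. 0 \<le> regs s'' (var x) \<and> regs s'' (var x) \<le> int M"
          and I: "I (ps i @ trace r L ls ?\<phi>) (tabs s'')"
        show "regs s'' (ctr x) = int i"
          using fr ctr_notin_loop_regs[OF x] ri by (auto; presburger)
        show "J0 (Suc i) s''"
          unfolding J0_def ps using bd I fr J0 xl
          by (auto simp: loop_regs_Cons J0_def)
      qed
    qed simp
    then show ?thesis
    proof (rule wp_Seq[OF wp_mono[OF _ order_refl]])
      fix s'' :: ram assume a: "regs s'' (ctr x) = int i \<and> J0 (Suc i) s''"
      have "Suc i \<le> M" using i ex[OF J0] by auto
      then show "wp B ?inc 4 (J (Suc i)) s''"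
        using a MB unfolding J_def J0_def
        by (intro wp_Assign) (auto simp: xl loop_regs_Cons; presburger)+
    qed simp
  qed
  have "wp B (While ?e (Seq (Seq (Assign (var x) (elm x l)) (nest ls P)) ?inc))
     ((\<Sum>i=0..<?len. 1 + cost ?e + (8 + k + nest_cost ls c * steps r L ls (\<phi>(x := ?ys ! i)))) + 1 + cost ?e) (J ?len)
     (s\<lparr>regs := (regs s)(ctr x := 0)\<rparr>)"
  proof (rule wp_While)
    fix i and s' :: ram assume "i < ?len" "J i s'"
    then show "wp B (Seq (Seq (Assign (var x) (elm x l)) (nest ls P)) ?inc)
      (8 + k + nest_cost ls c * steps r L ls (\<phi>(x := ?ys ! i))) (J (Suc i)) s'" by (rule step)
  next
    fix i and s' :: ram assume i: "i \<le> ?len" "J i s'"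
    then show "fits B s' ?e \<and> (val s' ?e \<noteq> 0 \<longleftrightarrow> i < ?len)"
      using ex[of i s'] MB unfolding J_def by auto
  next
    have pv: "2 * y + 2 \<noteq> 2 * x + 3" for y by presburger
    show "J 0 (s\<lparr>regs := (regs s)(ctr x := 0)\<rparr>)"
      using Cons.prems(4,5) pv unfolding J_def J0_def ps_def xl
      by (auto simp: loop_regs_Cons st_def)
  qed simp
  then have W: "wp B (nest (xl # ls) P)
     (2 + ((\<Sum>i=0..<?len. 1 + cost ?e + (8 + k + nest_cost ls c * steps r L ls (\<phi>(x := ?ys ! i)))) + 1 + cost ?e)) (J ?len) s"
    unfolding xl nest.simps using MB
    by (intro wp_Seq[where U = 2] wp_Assign) auto
  show ?case
  proof (rule wp_mono[OF W])
    let ?S = "\<Sum>i=0..<?len. steps r L ls (\<phi>(x := ?ys ! i))"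
    have S: "steps r L (xl # ls) \<phi> = 1 + ?S"
      unfolding xl by (simp add: sum_list_sum_nth)
    have nc: "nest_cost (xl # ls) c = nest_cost ls c + 30 + 2 * k" unfolding xl k_def by simp
    have "(\<Sum>i=0..<?len. 1 + cost ?e + (8 + k + nest_cost ls c * steps r L ls (\<phi>(x := ?ys ! i)))) \<le>
      (\<Sum>i=0..<?len. nest_cost (xl # ls) c * steps r L ls (\<phi>(x := ?ys ! i)))"
    proof (rule sum_mono)
      fix i
      have "1 + cost ?e + (8 + k) \<le> (30 + 2 * k) * 1" using costs by simp
      also have "\<dots> \<le> (30 + 2 * k) * steps r L ls (\<phi>(x := ?ys ! i))"
        by (intro mult_left_mono steps_pos) auto
      finally show "1 + cost ?e + (8 + k + nest_cost ls c * steps r L ls (\<phi>(x := ?ys ! i)))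
        \<le> nest_cost (xl # ls) c * steps r L ls (\<phi>(x := ?ys ! i))"
        unfolding nc by (simp add: algebra_simps)
    qed
    also have "\<dots> = nest_cost (xl # ls) c * ?S" by (simp add: sum_distrib_left)
    finally have "2 + ((\<Sum>i=0..<?len. 1 + cost ?e + (8 + k + nest_cost ls c * steps r L ls (\<phi>(x := ?ys ! i)))) + 1 + cost ?e)
      \<le> nest_cost (xl # ls) c * ?S + nest_cost (xl # ls) c" using costs nc by simp
    then show "2 + ((\<Sum>i=0..<?len. 1 + cost ?e + (8 + k + nest_cost ls c * steps r L ls (\<phi>(x := ?ys ! i)))) + 1 + cost ?e)
      \<le> nest_cost (xl # ls) c * steps r L (xl # ls) \<phi>" unfolding S by simp
  next
    fix s' :: ram assume "J ?len s'"
    then show "(\<forall>q. q \<notin> loop_regs (xl # ls) \<longrightarrow> regs s' q = regs s q) \<and>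
          (\<forall>x. 0 \<le> regs s' (var x) \<and> regs s' (var x) \<le> int M) \<and> I (pre @ trace r L (xl # ls) \<phi>) (tabs s')"
      unfolding J_def J0_def ps_def xl by simp
  qed
qed

section \<open>Loop nests as sums over sets of assignments\<close>

fun lset :: "(nat \<Rightarrow> nat) \<Rightarrow> (nat \<Rightarrow> nat list \<Rightarrow> nat set) \<Rightarrow> level \<Rightarrow> (nat \<Rightarrow> nat) \<Rightarrow> nat set" where
  "lset r F (Rng q) \<phi> = {..<r q}"
| "lset r F (Fam h ks) \<phi> = F h (map \<phi> ks)"

text \<open>The order in which a table lists a set depends on the input; sums and running times do
  not. From here on the sets replace the lists.\<close>

fun nsum :: "(nat \<Rightarrow> nat) \<Rightarrow> (nat \<Rightarrow> nat list \<Rightarrow> nat set) \<Rightarrow> (nat \<times> level) list \<Rightarrow>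
    ((nat \<Rightarrow> nat) \<Rightarrow> int) \<Rightarrow> (nat \<Rightarrow> nat) \<Rightarrow> int" where
  "nsum r F [] f \<phi> = f \<phi>"
| "nsum r F ((x, l) # ls) f \<phi> = (\<Sum>y\<in>lset r F l \<phi>. nsum r F ls f (\<phi>(x := y)))"

fun nsteps :: "(nat \<Rightarrow> nat) \<Rightarrow> (nat \<Rightarrow> nat list \<Rightarrow> nat set) \<Rightarrow> (nat \<times> level) list \<Rightarrow> (nat \<Rightarrow> nat) \<Rightarrow> nat" where
  "nsteps r F [] \<phi> = 1"
| "nsteps r F ((x, l) # ls) \<phi> = 1 + (\<Sum>y\<in>lset r F l \<phi>. nsteps r F ls (\<phi>(x := y)))"

abbreviation levels_in :: "nat set \<Rightarrow> (nat \<times> level) list \<Rightarrow> bool" where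
  "levels_in H ls \<equiv> \<forall>(x, l)\<in>set ls. case l of Rng q \<Rightarrow> True | Fam h ks \<Rightarrow> h \<in> H"

definition stored :: "(nat \<Rightarrow> int list \<Rightarrow> int) \<Rightarrow> (nat \<Rightarrow> nat list \<Rightarrow> nat set) \<Rightarrow> nat set \<Rightarrow> (nat \<Rightarrow> nat list \<Rightarrow> nat list) \<Rightarrow> bool" where
  "stored T F H L \<longleftrightarrow> (\<forall>h\<in>H. rep (T h) (L h) \<and> (\<forall>ks. set (L h ks) = F h ks))"

lemma stored_distinct: "stored T F H L \<Longrightarrow> h \<in> H \<Longrightarrow> distinct (L h ks)"
  by (auto simp: stored_def rep_def)

lemma lvl_lset:
  assumes "stored T F H L" "case l of Rng q \<Rightarrow> True | Fam h ks \<Rightarrow> h \<in> H"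
  shows "distinct (lvl r L l \<phi>)" "set (lvl r L l \<phi>) = lset r F l \<phi>"
  using assms by (cases l; auto simp: stored_def rep_def)+

lemma sum_list_map_concat: "sum_list (map f (concat xss)) = sum_list (map (\<lambda>xs. sum_list (map f xs)) xss)"
  by (induction xss) auto

lemma trace_nsum:
  assumes "stored T F H L" "levels_in H ls"
  shows "sum_list (map f (trace r L ls \<phi>)) = nsum r F ls f \<phi>"
  using assms(2)
proof (induction ls arbitrary: \<phi>)
  case (Cons xl ls)
  obtain x l where xl: "xl = (x, l)" by force
  note ll = lvl_lset[OF assms(1), of l r \<phi>]
  have "sum_list (map f (trace r L (xl # ls) \<phi>)) =
    (\<Sum>y\<leftarrow>lvl r L l \<phi>. sum_list (map f (trace r L ls (\<phi>(x := y)))))"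
    unfolding xl by (simp add: sum_list_map_concat comp_def)
  also have "\<dots> = (\<Sum>y\<in>lset r F l \<phi>. sum_list (map f (trace r L ls (\<phi>(x := y)))))"
    using ll Cons.prems xl by (simp add: sum_list_distinct_conv_sum_set)
  also have "\<dots> = nsum r F (xl # ls) f \<phi>" using Cons xl by simp
  finally show ?case .
qed simp

lemma steps_nsteps:
  assumes "stored T F H L" "levels_in H ls"
  shows "steps r L ls \<phi> = nsteps r F ls \<phi>"
  using assms(2)
proof (induction ls arbitrary: \<phi>)
  case (Cons xl ls)
  obtain x l where xl: "xl = (x, l)" by force
  note ll = lvl_lset[OF assms(1), of l r \<phi>]
  show ?case using Cons ll xl by (simp add: sum_list_distinct_conv_sum_set)
qed simp

definition vars :: "(nat \<times> level) list \<Rightarrow> nat set" where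
  "vars ls = fst ` set ls"

lemma vars_simps [simp]: "vars [] = {}" "vars ((x, l) # ls) = insert x (vars ls)"
  by (auto simp: vars_def)

lemma lset_cong: "(\<And>k. k \<in> (case l of Rng q \<Rightarrow> {} | Fam h ks \<Rightarrow> set ks) \<Longrightarrow> \<phi> k = \<psi> k) \<Longrightarrow> lset r F l \<phi> = lset r F l \<psi>"
  by (cases l) (auto cong: map_cong)

definition asgs :: "(nat \<Rightarrow> nat) \<Rightarrow> (nat \<Rightarrow> nat list \<Rightarrow> nat set) \<Rightarrow> (nat \<times> level) list \<Rightarrow> (nat \<Rightarrow> nat) \<Rightarrow> (nat \<Rightarrow> nat) set" where
  "asgs r F ls \<phi> = {\<psi>. (\<forall>x. x \<notin> vars ls \<longrightarrow> \<psi> x = \<phi> x) \<and> (\<forall>(x, l)\<in>set ls. \<psi> x \<in> lset r F l \<psi>)}"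

lemma asgs_Nil: "asgs r F [] \<phi> = {\<phi>}"
  by (auto simp: asgs_def)

text \<open>By well-formedness the keys of the outermost level are no loop variables at all, so its
  set is the same in the initial and in the final assignment.\<close>

lemma asgs_Cons:
  assumes "wf_levels ((x, l) # ls)"
  shows "asgs r F ((x, l) # ls) \<phi> = (\<Union>y\<in>lset r F l \<phi>. asgs r F ls (\<phi>(x := y)))"
proof -
  have x: "x \<notin> vars ls" using assms by (simp add: vars_def)
  have eq: "lset r F l \<psi> = lset r F l \<phi>" if "\<forall>z. z \<notin> insert x (vars ls) \<longrightarrow> \<psi> z = \<phi> z" for \<psi>
    using that assms by (intro lset_cong) (auto simp: vars_def split: level.splits)
  have "(\<Union>y\<in>lset r F l \<phi>. asgs r F ls (\<phi>(x := y))) = {\<psi>. (\<forall>z. z \<notin> insert x (vars ls) \<longrightarrow> \<psi> z = \<phi> z) \<and> \<psi> x \<in> lset r F l \<phi> \<and> (\<forall>(x, l)\<in>set ls. \<psi> x \<in> lset r F l \<psi>)}"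
    (is "?L = ?R")
    unfolding asgs_def
  proof (intro equalityI subsetI)
    fix \<psi> assume "\<psi> \<in> (\<Union>y\<in>lset r F l \<phi>. {\<psi>. (\<forall>z. z \<notin> vars ls \<longrightarrow> \<psi> z = (\<phi>(x := y)) z) \<and> (\<forall>(x, l)\<in>set ls. \<psi> x \<in> lset r F l \<psi>)})"
    then show "\<psi> \<in> ?R" using x by (auto split: if_splits)
  next
    fix \<psi> assume R: "\<psi> \<in> ?R"
    note R' = CollectD[OF R]
    have "\<forall>z. z \<notin> vars ls \<longrightarrow> \<psi> z = (\<phi>(x := \<psi> x)) z"
      using R'[THEN conjunct1] by (metis fun_upd_apply insert_iff)
    then show "\<psi> \<in> (\<Union>y\<in>lset r F l \<phi>. {\<psi>. (\<forall>z. z \<notin> vars ls \<longrightarrow> \<psi> z = (\<phi>(x := y)) z) \<and> (\<forall>(x, l)\<in>set ls. \<psi> x \<in> lset r F l \<psi>)})"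
      by (intro UN_I[OF R'[THEN conjunct2, THEN conjunct1]] CollectI conjI R'[THEN conjunct2, THEN conjunct2])
  qed
  also have "\<dots> = asgs r F ((x, l) # ls) \<phi>"
  proof -
    have c: "(\<psi> x \<in> lset r F l \<phi>) = (\<psi> x \<in> lset r F l \<psi>)"
      if "\<forall>z. z \<notin> insert x (vars ls) \<longrightarrow> \<psi> z = \<phi> z" for \<psi>
      by (simp only: eq[OF that])
    show ?thesis
      unfolding asgs_def list.set vars_simps ball_simps(7) prod.case
      by (intro Collect_cong conj_cong refl c)
  qed
  finally show ?thesis by (rule sym)
qed

lemma set_trace:
  assumes "stored T F H L" "levels_in H ls" "wf_levels ls"
  shows "set (trace r L ls \<phi>) = asgs r F ls \<phi>"
  using assms(2,3)
proof (induction ls arbitrary: \<phi>)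
  case Nil
  show ?case by (simp add: asgs_Nil)
next
  case (Cons xl ls)
  obtain x l where xl: "xl = (x, l)" by force
  show ?case using Cons asgs_Cons[of x l ls] lvl_lset(2)[OF assms(1), of l r \<phi>] xl by simp
qed

lemma
  assumes "wf_levels ls" and fin: "\<And>l \<phi>. finite (lset r F l \<phi>)"
  shows finite_asgs: "finite (asgs r F ls \<phi>)"
    and nsum_asgs: "nsum r F ls f \<phi> = sum f (asgs r F ls \<phi>)"
proof -
  have "finite (asgs r F ls \<phi>) \<and> nsum r F ls f \<phi> = sum f (asgs r F ls \<phi>)"
    using assms(1)
  proof (induction ls arbitrary: \<phi>)
    case Nil
    then show ?case by (simp add: asgs_Nil)
  next
    case (Cons xl ls)
    obtain x l where xl: "xl = (x, l)" by force
    have wf: "wf_levels ls" "x \<notin> vars ls" using Cons.prems xl by (auto simp: vars_def)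
    have disj: "asgs r F ls (\<phi>(x := y)) \<inter> asgs r F ls (\<phi>(x := y')) = {}" if "y \<noteq> y'" for y y'
      using wf that unfolding asgs_def by force
    show ?case
      unfolding xl asgs_Cons[OF Cons.prems[unfolded xl]] nsum.simps using fin Cons.IH[OF wf(1)] disj
      by (subst sum.UNION_disjoint) (simp_all del: fun_upd_apply)
  qed
  then show "finite (asgs r F ls \<phi>)" "nsum r F ls f \<phi> = sum f (asgs r F ls \<phi>)" by auto
qed

lemma wp_nest_stored:
  assumes MB: "int M < B" "2 \<le> B" "r 0 \<le> M" "r 1 \<le> M"
    and body: "\<And>pre \<phi> post s'. trace r L ls \<phi>0 = pre @ \<phi> # post \<Longrightarrow> I pre (tabs s') \<Longrightarrow> st r M \<phi> {} s' \<Longrightarrow>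
      wp B P c (\<lambda>s''. regs s'' = regs s' \<and> I (pre @ [\<phi>]) (tabs s'')) s'"
    and unch: "\<And>pre T h. I pre T \<Longrightarrow> h \<in> H \<Longrightarrow> T h = tabs s h"
    and str: "stored (tabs s) F H L" "levels_in H ls"
    and F: "\<And>h ks. h \<in> H \<Longrightarrow> F h ks \<subseteq> {..<r 0}"
    and wf: "wf_levels ls" and I: "I [] (tabs s)" and st: "st r M \<phi>0 (vars ls) s"
  shows "wp B (nest ls P) (nest_cost ls c * nsteps r F ls \<phi>0)
    (\<lambda>s'. st r M \<phi> UNIV s' \<and> I (trace r L ls \<phi>0) (tabs s')) s"
proof (rule wp_mono[OF wp_nest[where tr = "trace r L ls \<phi>0" and pre = "[]" and post = "[]"
        and L = L and I = I and P = P and c = c, OF MB]])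
  fix pre T x h ks assume a: "I pre T" "(x, Fam h ks) \<in> set ls"
  then have h: "h \<in> H" using str(2) by auto
  have "rep (T h) (L h)" "\<And>ks. set (L h ks) = F h ks" using str(1) h unch[OF a(1) h] by (auto simp: stored_def)
  moreover have "length (L h ks) \<le> M" for ks
  proof -
    have "length (L h ks) = card (F h ks)"
      using stored_distinct[OF str(1) h, of ks] \<open>set (L h ks) = F h ks\<close> distinct_card by metis
    also have "\<dots> \<le> r 0" using card_mono[OF _ F[OF h, of ks]] by simp
    finally show ?thesis using MB by simp
  qed
  ultimately show "rep (T h) (L h) \<and> (\<forall>ks. length (L h ks) \<le> M \<and> (\<forall>y\<in>set (L h ks). y \<le> M))"
    using F[OF h] MB by fastforce
next
  show "nest_cost ls c * steps r L ls \<phi>0 \<le> nest_cost ls c * nsteps r F ls \<phi>0"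
    using steps_nsteps[OF str] by simp
next
  fix s' :: ram
  assume "(\<forall>q. q \<notin> loop_regs ls \<longrightarrow> regs s' q = regs s q) \<and> (\<forall>x. 0 \<le> regs s' (var x) \<and> regs s' (var x) \<le> int M) \<and>
    I ([] @ trace r L ls \<phi>0) (tabs s')"
  then show "st r M \<phi> UNIV s' \<and> I (trace r L ls \<phi>0) (tabs s')"
    using st by (auto simp: st_def small_notin_loop_regs)
qed (use wf body I st in \<open>auto simp: vars_def\<close>)

section \<open>Loop bodies that add to a table or insert into a family\<close>

definition acc :: "nat \<Rightarrow> nat list \<Rightarrow> expr \<Rightarrow> prog" where
  "acc h ks e = Store h (map rvar ks) (Op Plus (Lookup h (map rvar ks)) e)"

lemma map_val_rvar: "st r M \<phi> {} s \<Longrightarrow> map (val s) (map rvar ks) = map int (map \<phi> ks)"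
  by (simp add: st_def)

lemma fits_rvar: "st r M \<phi> {} s \<Longrightarrow> int M < B \<Longrightarrow> fits B s (rvar x)"
  by (simp add: st_def abs_if) (smt (verit))

text \<open>Each partial sum has to fit into a machine word, not only the final one. Hence the bound
  on the sum of absolute values, which dominates every partial sum under every key.\<close>

lemma wp_acc:
  assumes MB: "int M < B" "2 \<le> B" "r 0 \<le> M" "r 1 \<le> M"
    and str: "stored (tabs s) F H L" "levels_in H ls" and F: "\<And>h ks. h \<in> H \<Longrightarrow> F h ks \<subseteq> {..<r 0}"
    and wf: "wf_levels ls" and st: "st r M \<phi>0 (vars ls) s"
    and h: "h \<notin> H" "tabs s h = (\<lambda>_. 0)"
    and e: "\<And>s' \<phi>. (\<forall>h'. h' \<noteq> h \<longrightarrow> tabs s' h' = tabs s h') \<Longrightarrow> st r M \<phi> {} s' \<Longrightarrow> fits B s' e \<and> val s' e = w \<phi>"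
    and bound: "nsum r F ls (\<lambda>\<phi>. \<bar>w \<phi>\<bar>) \<phi>0 \<le> B"
  shows "wp B (nest ls (acc h ks e)) (nest_cost ls (3 + cost e + 2 * length ks) * nsteps r F ls \<phi>0)
    (\<lambda>s'. st r M \<phi>0 UNIV s' \<and> (\<forall>h'. h' \<noteq> h \<longrightarrow> tabs s' h' = tabs s h') \<and>
      (\<forall>key. tabs s' h (map int key) = nsum r F ls (\<lambda>\<phi>. if map \<phi> ks = key then w \<phi> else 0) \<phi>0)) s"
proof -
  let ?tr = "trace r L ls \<phi>0"
  let ?f = "\<lambda>key \<phi>. if map \<phi> ks = key then w \<phi> else 0"
  define I where "I pre T \<longleftrightarrow> (\<forall>h'. h' \<noteq> h \<longrightarrow> T h' = tabs s h') \<and>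
    (\<forall>key. T h (map int key) = sum_list (map (?f key) pre))" for pre T
  have part: "\<bar>sum_list (map (?f key) pre)\<bar> \<le> B" if "?tr = pre @ post" for key pre post
  proof -
    have "\<bar>sum_list (map (?f key) pre)\<bar> \<le> sum_list (map (\<lambda>\<phi>. \<bar>w \<phi>\<bar>) pre)" by (induction pre) auto
    also have "\<dots> \<le> sum_list (map (\<lambda>\<phi>. \<bar>w \<phi>\<bar>) ?tr)" unfolding that by (auto intro!: sum_list_nonneg)
    also have "\<dots> \<le> B" using trace_nsum[OF str, of "\<lambda>\<phi>. \<bar>w \<phi>\<bar>" r \<phi>0] bound by simp
    finally show ?thesis .
  qed
  have "wp B (nest ls (acc h ks e)) (nest_cost ls (3 + cost e + 2 * length ks) * nsteps r F ls \<phi>0)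
    (\<lambda>s'. st r M \<phi>0 UNIV s' \<and> I ?tr (tabs s')) s"
  proof (rule wp_nest_stored[OF MB _ _ str F wf _ st])
    fix pre \<phi> post and s' :: ram
    assume tr: "?tr = pre @ \<phi> # post" and I: "I pre (tabs s')" and s': "st r M \<phi> {} s'"
    have e': "fits B s' e" "val s' e = w \<phi>" using e[OF _ s'] I by (auto simp: I_def)
    note key = map_val_rvar[OF s', of ks]
    have T: "tabs s' h (map int (map \<phi> ks)) = sum_list (map (?f (map \<phi> ks)) pre)"
      using I by (simp add: I_def del: map_map)
    have b: "\<bar>sum_list (map (?f (map \<phi> ks)) pre)\<bar> \<le> B" "\<bar>sum_list (map (?f (map \<phi> ks)) (pre @ [\<phi>]))\<bar> \<le> B"
      using part[of pre "\<phi> # post" "map \<phi> ks"] part[of "pre @ [\<phi>]" post "map \<phi> ks"] tr by (simp_all del: map_eq_conv)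
    have inj: "map int key = map int key' \<longleftrightarrow> key = key'" for key key'
      by (simp add: inj_map_eq_map)
    have v: "val s' (Op Plus (Lookup h (map rvar ks)) e) = sum_list (map (?f (map \<phi> ks)) pre) + w \<phi>"
      by (simp only: val.simps op_val.simps key T e'(2))
    show "wp B (acc h ks e) (3 + cost e + 2 * length ks) (\<lambda>s''. regs s'' = regs s' \<and> I (pre @ [\<phi>]) (tabs s'')) s'"
      unfolding acc_def
    proof (rule wp_Store)
      show "fits B s' (Op Plus (Lookup h (map rvar ks)) e)"
        using T key b e' fits_rvar[OF s' MB(1)] by (simp del: map_map fits_simps(2))
      show "\<forall>k\<in>set (map rvar ks). fits B s' k" using fits_rvar[OF s' MB(1)] by auto
      let ?T = "(tabs s' h)(map int (map \<phi> ks) := sum_list (map (?f (map \<phi> ks)) pre) + w \<phi>)"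
      have TT: "?T (map int key) = sum_list (map (?f key) (pre @ [\<phi>]))" for key
      proof (cases "map \<phi> ks = key")
        case True
        show ?thesis unfolding True[symmetric] by (simp only: fun_upd_same map_append sum_list.append) simp
      next
        case False
        then have "map int key \<noteq> map int (map \<phi> ks)" using inj by metis
        then show ?thesis using False I by (simp add: I_def del: map_map)
      qed
      have "I (pre @ [\<phi>]) ((tabs s')(h := ?T))"
        using I unfolding I_def fun_upd_same TT by simp
      then show "regs (s'\<lparr>tabs := (tabs s')(h := (tabs s' h)(map (val s') (map rvar ks) := val s' (Op Plus (Lookup h (map rvar ks)) e)))\<rparr>) = regs s' \<and>
        I (pre @ [\<phi>]) (tabs (s'\<lparr>tabs := (tabs s')(h := (tabs s' h)(map (val s') (map rvar ks) := val s' (Op Plus (Lookup h (map rvar ks)) e)))\<rparr>))"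
        unfolding key v by simp
      show "1 + cost (Op Plus (Lookup h (map rvar ks)) e) + sum_list (map cost (map rvar ks)) \<le> 3 + cost e + 2 * length ks"
        using length_concat_subexprs_rvar[of ks] sum_list_cost_rvar[of ks] by (simp del: map_map)
    qed
  qed (use h in \<open>auto simp: I_def\<close>)
  then show ?thesis
  proof (rule wp_mono[OF _ order_refl])
    fix s' :: ram assume a: "st r M \<phi>0 UNIV s' \<and> I ?tr (tabs s')"
    show "st r M \<phi>0 UNIV s' \<and> (\<forall>h'. h' \<noteq> h \<longrightarrow> tabs s' h' = tabs s h') \<and>
      (\<forall>key. tabs s' h (map int key) = nsum r F ls (?f key) \<phi>0)"
      using a trace_nsum[OF str] unfolding I_def by simp
  qed
qed

text \<open>Testing the membership flag first makes repeated insertions harmless, so that the listed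
  elements remain distinct without any injectivity of the enumeration.\<close>

definition ins :: "nat \<Rightarrow> expr list \<Rightarrow> expr \<Rightarrow> expr \<Rightarrow> prog" where
  "ins h ks x c = Cond (Op Times c (Op Equal (Lookup h (Const 0 # x # ks)) (Const 0)))
     (Seq (Seq (Store h (Const 0 # x # ks) (Const 1)) (Store h (Const 2 # Lookup h (Const 1 # ks) # ks) x))
          (Store h (Const 1 # ks) (Op Plus (Lookup h (Const 1 # ks)) (Const 1)))) Skip"

definition ins_cost :: "expr list \<Rightarrow> expr \<Rightarrow> expr \<Rightarrow> nat" where
  "ins_cost ks x c = 40 + 8 * sum_list (map cost ks) + 4 * cost x + cost c"

text \<open>The three stores evaluate \<open>x\<close> and \<open>ks\<close> again in changed
  states. The assumption \<open>ev\<close> therefore asks for their values in every state that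
  differs from \<open>s\<close> in table \<open>h\<close> only.\<close>

lemma wp_ins_body:
  assumes B: "2 \<le> B" "int (length (L ks')) + 1 \<le> B" and R: "rep (tabs s h) L"
    and ev: "\<And>s'. regs s' = regs s \<Longrightarrow> \<forall>h'. h' \<noteq> h \<longrightarrow> tabs s' h' = tabs s h' \<Longrightarrow>
      (\<forall>k\<in>set (x # c # ks). fits B s' k) \<and> map (val s') ks = map int ks' \<and> val s' x = int x' \<and> val s' c = of_bool c'"
  shows "wp B (ins h ks x c) (ins_cost ks x c)
    (\<lambda>s'. regs s' = regs s \<and> (\<forall>h'. h' \<noteq> h \<longrightarrow> tabs s' h' = tabs s h') \<and>
       rep (tabs s' h) (if c' \<and> x' \<notin> set (L ks') then L(ks' := L ks' @ [x']) else L)) s"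
proof -
  let ?lk = "Lookup h (Const 1 # ks)"
  have T: "tabs s h (1 # map int ks') = int (length (L ks'))" "tabs s h (0 # int x' # map int ks') = of_bool (x' \<in> set (L ks'))"
    using R unfolding rep_def by blast+
  note s = ev[of s, OF refl, simplified]
  have lc: "length (concat (map subexprs ks)) = sum_list (map cost ks)"
    by (simp add: length_concat comp_def)
  let ?s1 = "s\<lparr>tabs := (tabs s)(h := (tabs s h)(0 # int x' # map int ks' := 1))\<rparr>"
  let ?s2 = "?s1\<lparr>tabs := (tabs ?s1)(h := (tabs ?s1 h)(2 # int (length (L ks')) # map int ks' := int x'))\<rparr>"
  let ?s3 = "?s2\<lparr>tabs := (tabs ?s2)(h := (tabs ?s2 h)(1 # map int ks' := int (length (L ks')) + 1))\<rparr>"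
  note s1 = ev[of ?s1, simplified]
  note s2 = ev[of ?s2, simplified]
  have inj: "map int key = map int key' \<longleftrightarrow> key = key'" for key key'
    by (simp add: inj_map_eq_map)
  show ?thesis unfolding ins_def
  proof (rule wp_Cond[where T = "20 + 6 * sum_list (map cost ks) + 2 * cost x"])
    show "fits B s (Op Times c (Op Equal (Lookup h (Const 0 # x # ks)) (Const 0)))"
      using s T B by auto
    show "1 + cost (Op Times c (Op Equal (Lookup h (Const 0 # x # ks)) (Const 0))) +
      (20 + 6 * sum_list (map cost ks) + 2 * cost x) \<le> ins_cost ks x c"
      using lc unfolding ins_cost_def by simp
    assume "val s (Op Times c (Op Equal (Lookup h (Const 0 # x # ks)) (Const 0))) = 0"
    then have "\<not> (c' \<and> x' \<notin> set (L ks'))" using s T by auto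
    then show "wp B Skip (20 + 6 * sum_list (map cost ks) + 2 * cost x) (\<lambda>s'. regs s' = regs s \<and> (\<forall>h'. h' \<noteq> h \<longrightarrow> tabs s' h' = tabs s h') \<and>
       rep (tabs s' h) (if c' \<and> x' \<notin> set (L ks') then L(ks' := L ks' @ [x']) else L)) s"
      using R by (intro wp_Skip) auto
  next
    assume "val s (Op Times c (Op Equal (Lookup h (Const 0 # x # ks)) (Const 0))) \<noteq> 0"
    then have c: "c'" "x' \<notin> set (L ks')" using s T by (auto split: if_splits)
    have R3: "rep (tabs ?s3 h) (L(ks' := L ks' @ [x']))"
      unfolding rep_def
    proof (intro allI conjI impI)
      fix ks z i
      show "distinct ((L(ks' := L ks' @ [x'])) ks)" using c R by (auto simp: rep_def)
      show "tabs ?s3 h (1 # map int ks) = int (length ((L(ks' := L ks' @ [x'])) ks))"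
        using R by (auto simp: rep_def inj)
      show "tabs ?s3 h (0 # int z # map int ks) = of_bool (z \<in> set ((L(ks' := L ks' @ [x'])) ks))"
        using R c by (auto simp: rep_def inj)
      assume "i < length ((L(ks' := L ks' @ [x'])) ks)"
      then show "tabs ?s3 h (2 # int i # map int ks) = int ((L(ks' := L ks' @ [x'])) ks ! i)"
        using R by (cases "ks = ks'") (auto simp: rep_def inj nth_append less_Suc_eq)
    qed
    show "wp B (Seq (Seq (Store h (Const 0 # x # ks) (Const 1)) (Store h (Const 2 # ?lk # ks) x))
          (Store h (Const 1 # ks) (Op Plus ?lk (Const 1)))) (20 + 6 * sum_list (map cost ks) + 2 * cost x)
       (\<lambda>s'. regs s' = regs s \<and> (\<forall>h'. h' \<noteq> h \<longrightarrow> tabs s' h' = tabs s h') \<and>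
       rep (tabs s' h) (if c' \<and> x' \<notin> set (L ks') then L(ks' := L ks' @ [x']) else L)) s"
    proof (rule wp_Seq[where U = "10 + 3 * sum_list (map cost ks) + 2 * cost x" and V = "10 + 3 * sum_list (map cost ks)"],
        rule wp_Seq[where U = "5 + sum_list (map cost ks) + cost x" and V = "5 + 2 * sum_list (map cost ks) + cost x"])
      let ?Q = "\<lambda>s'. regs s' = regs s \<and> (\<forall>h'. h' \<noteq> h \<longrightarrow> tabs s' h' = tabs s h') \<and>
             rep (tabs s' h) (if c' \<and> x' \<notin> set (L ks') then L(ks' := L ks' @ [x']) else L)"
      have e1: "map (val s) (Const 0 # x # ks) = 0 # int x' # map int ks'" using s by simp
      have e2: "map (val ?s1) (Const 2 # ?lk # ks) = 2 # int (length (L ks')) # map int ks'"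
        using s1 T by simp
      have e3: "map (val ?s2) (Const 1 # ks) = 1 # map int ks'" "val ?s2 (Op Plus ?lk (Const 1)) = int (length (L ks')) + 1"
        using s2 T by simp_all
      have w3: "wp B (Store h (Const 1 # ks) (Op Plus ?lk (Const 1))) (10 + 3 * sum_list (map cost ks)) ?Q ?s2"
      proof (rule wp_Store, unfold e3)
        show "fits B ?s2 (Op Plus ?lk (Const 1))" "\<forall>k\<in>set (Const 1 # ks). fits B ?s2 k" using B s2 T by auto
        show "1 + cost (Op Plus ?lk (Const 1)) + sum_list (map cost (Const 1 # ks)) \<le> 10 + 3 * sum_list (map cost ks)"
          using lc by simp
        show "?Q ?s3" using c R3 by simp
      qed
      have w2: "wp B (Store h (Const 2 # ?lk # ks) x) (5 + 2 * sum_list (map cost ks) + cost x)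
        (wp B (Store h (Const 1 # ks) (Op Plus ?lk (Const 1))) (10 + 3 * sum_list (map cost ks)) ?Q) ?s1"
      proof (rule wp_Store, unfold e2)
        show "fits B ?s1 x" "\<forall>k\<in>set (Const 2 # ?lk # ks). fits B ?s1 k" using B s1 T by auto
        show "1 + cost x + sum_list (map cost (Const 2 # ?lk # ks)) \<le> 5 + 2 * sum_list (map cost ks) + cost x"
          using lc by simp
      qed (use w3 s1 in simp)
      show "wp B (Store h (Const 0 # x # ks) (Const 1)) (5 + sum_list (map cost ks) + cost x)
        (wp B (Store h (Const 2 # ?lk # ks) x) (5 + 2 * sum_list (map cost ks) + cost x)
          (wp B (Store h (Const 1 # ks) (Op Plus ?lk (Const 1))) (10 + 3 * sum_list (map cost ks)) ?Q)) s"
      proof (rule wp_Store, unfold e1)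
        show "fits B s (Const 1)" "\<forall>k\<in>set (Const 0 # x # ks). fits B s k" using B s by auto
        show "1 + cost (Const 1) + sum_list (map cost (Const 0 # x # ks)) \<le> 5 + sum_list (map cost ks) + cost x"
          by simp
      qed (use w2 in simp)
    qed auto
  qed
qed

text \<open>The initial contents \<open>S0\<close> let two enumerations fill the same table; this
  serves the adjacency table, which is filled by one pass over the edge list for each
  direction.\<close>

lemma wp_ins:
  assumes MB: "int M < B" "2 \<le> B" "r 0 \<le> M" "r 1 \<le> M"
    and str: "stored (tabs s) F H L" "levels_in H ls" and F: "\<And>h ks. h \<in> H \<Longrightarrow> F h ks \<subseteq> {..<r 0}"
    and wf: "wf_levels ls" and st: "st r M \<phi>0 (vars ls) s"
    and h: "h \<notin> H" "rep (tabs s h) L0"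
    and S0: "\<And>key. set (L0 key) = S0 key" "\<And>key. S0 key \<subseteq> {..<r 0}"
    and ev: "\<And>s' \<phi>. \<phi> \<in> A \<Longrightarrow> \<forall>h'. h' \<noteq> h \<longrightarrow> tabs s' h' = tabs s h' \<Longrightarrow> st r M \<phi> {} s' \<Longrightarrow>
      (\<forall>k\<in>set (x # c # ks). fits B s' k) \<and> map (val s') ks = map int (ks' \<phi>) \<and> val s' x = int (x' \<phi>) \<and>
      val s' c = of_bool (c' \<phi>) \<and> (c' \<phi> \<longrightarrow> x' \<phi> < r 0)"
    and A: "A = asgs r F ls \<phi>0"
  shows "wp B (nest ls (ins h ks x c)) (nest_cost ls (ins_cost ks x c) * nsteps r F ls \<phi>0)
    (\<lambda>s'. st r M \<phi>0 UNIV s' \<and> (\<forall>h'. h' \<noteq> h \<longrightarrow> tabs s' h' = tabs s h') \<and>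
      (\<exists>L1. rep (tabs s' h) L1 \<and> (\<forall>key. set (L1 key) = S0 key \<union> {x' \<phi> |\<phi>. \<phi> \<in> A \<and> c' \<phi> \<and> ks' \<phi> = key}))) s"
proof -
  let ?tr = "trace r L ls \<phi>0"
  have A: "set ?tr = A" using set_trace[OF str wf] A by simp
  define U where "U pre key = S0 key \<union> {x' \<phi> |\<phi>. \<phi> \<in> set pre \<and> c' \<phi> \<and> ks' \<phi> = key}" for pre key
  define I where "I pre T \<longleftrightarrow> (\<forall>h'. h' \<noteq> h \<longrightarrow> T h' = tabs s h') \<and>
    (\<exists>L1. rep (T h) L1 \<and> (\<forall>key. set (L1 key) = U pre key \<and> U pre key \<subseteq> {..<r 0}))" for pre T
  have "wp B (nest ls (ins h ks x c)) (nest_cost ls (ins_cost ks x c) * nsteps r F ls \<phi>0)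
    (\<lambda>s'. st r M \<phi>0 UNIV s' \<and> I ?tr (tabs s')) s"
  proof (rule wp_nest_stored[OF MB _ _ str F wf _ st])
    fix pre \<phi> post and s' :: ram
    assume tr: "?tr = pre @ \<phi> # post" and I: "I pre (tabs s')" and s': "st r M \<phi> {} s'"
    have \<phi>: "\<phi> \<in> A" using tr A by auto
    obtain L1 where L1: "rep (tabs s' h) L1" "\<And>key. set (L1 key) = U pre key" "\<And>key. U pre key \<subseteq> {..<r 0}"
      using I unfolding I_def by blast
    have "length (L1 (ks' \<phi>)) = card (U pre (ks' \<phi>))" using L1 distinct_card unfolding rep_def by metis
    also have "\<dots> \<le> r 0" using card_mono[OF _ L1(3)[of "ks' \<phi>"]] by simp
    finally have len: "int (length (L1 (ks' \<phi>))) + 1 \<le> B" using MB by simp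
    have s's: "\<forall>h'. h' \<noteq> h \<longrightarrow> tabs s' h' = tabs s h'" using I by (simp add: I_def)
    have ev': "(\<forall>k\<in>set (x # c # ks). fits B s'' k) \<and> map (val s'') ks = map int (ks' \<phi>) \<and> val s'' x = int (x' \<phi>) \<and>
      val s'' c = of_bool (c' \<phi>)" if "regs s'' = regs s'" "\<forall>h'. h' \<noteq> h \<longrightarrow> tabs s'' h' = tabs s' h'" for s'' :: ram
      using ev[OF \<phi>, of s''] that s' s's unfolding st_def by auto
    have xr: "c' \<phi> \<Longrightarrow> x' \<phi> < r 0" using ev[OF \<phi> s's s'] by auto
    show "wp B (ins h ks x c) (ins_cost ks x c) (\<lambda>s''. regs s'' = regs s' \<and> I (pre @ [\<phi>]) (tabs s'')) s'"
    proof (rule wp_mono[OF wp_ins_body[OF MB(2) len L1(1) ev'] order_refl], assumption, assumption, elim conjE, intro conjI)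
      fix s'' :: ram
      let ?L = "if c' \<phi> \<and> x' \<phi> \<notin> set (L1 (ks' \<phi>)) then L1(ks' \<phi> := L1 (ks' \<phi>) @ [x' \<phi>]) else L1"
      assume a: "regs s'' = regs s'" "\<forall>h'. h' \<noteq> h \<longrightarrow> tabs s'' h' = tabs s' h'" "rep (tabs s'' h) ?L"
      have "set (?L key) = U (pre @ [\<phi>]) key \<and> U (pre @ [\<phi>]) key \<subseteq> {..<r 0}" for key
      proof -
        have "U (pre @ [\<phi>]) key = U pre key \<union> (if c' \<phi> \<and> ks' \<phi> = key then {x' \<phi>} else {})"
          unfolding U_def by auto
        then show ?thesis using L1(2)[of key] L1(3)[of key] xr by auto
      qed
      then have "\<exists>L1. rep (tabs s'' h) L1 \<and> (\<forall>key. set (L1 key) = U (pre @ [\<phi>]) key \<and> U (pre @ [\<phi>]) key \<subseteq> {..<r 0})"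
        using a(3) by (intro exI[of _ ?L]) simp
      moreover have "\<forall>h'. h' \<noteq> h \<longrightarrow> tabs s'' h' = tabs s h'" using a(2) s's by simp
      ultimately show "I (pre @ [\<phi>]) (tabs s'')" unfolding I_def by (rule conjI[rotated])
    qed
  next
    show "I [] (tabs s)" unfolding I_def U_def using h S0 by auto
  qed (use h in \<open>auto simp: I_def\<close>)
  then show ?thesis
  proof (rule wp_mono[OF _ order_refl])
    fix s' :: ram assume a: "st r M \<phi>0 UNIV s' \<and> I ?tr (tabs s')"
    then obtain L1 where L1: "rep (tabs s' h) L1" "\<And>key. set (L1 key) = U ?tr key" unfolding I_def by blast
    show "st r M \<phi>0 UNIV s' \<and> (\<forall>h'. h' \<noteq> h \<longrightarrow> tabs s' h' = tabs s h') \<and>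
      (\<exists>L1. rep (tabs s' h) L1 \<and> (\<forall>key. set (L1 key) = S0 key \<union> {x' \<phi> |\<phi>. \<phi> \<in> A \<and> c' \<phi> \<and> ks' \<phi> = key}))"
    proof (intro conjI exI[of _ L1] allI)
      show "set (L1 key) = S0 key \<union> {x' \<phi> |\<phi>. \<phi> \<in> A \<and> c' \<phi> \<and> ks' \<phi> = key}" for key
        unfolding L1(2) U_def A by (rule refl)
    qed (use a L1 in \<open>auto simp: I_def\<close>)
  qed
qed

section \<open>Functions computable within the time bound\<close>

definition nV :: "nat pair_pre_digraph \<Rightarrow> nat" where "nV G = card (pverts G)"
definition mE :: "nat pair_pre_digraph \<Rightarrow> nat" where "mE G = card (edge_set G)"

definition good :: "nat pair_pre_digraph \<Rightarrow> bool" where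
  "good G \<longleftrightarrow> pair_graph G \<and> pverts G = {..<nV G}"

definition rs :: "nat pair_pre_digraph \<Rightarrow> nat \<Rightarrow> nat" where
  "rs G q = (if q = 0 then nV G else mE G)"

text \<open>A common bound for all loop variables: edge numbers when the input is read, vertices
  otherwise.\<close>

definition Mx :: "nat pair_pre_digraph \<Rightarrow> nat" where "Mx G = nV G + mE G"

abbreviation nbr :: "nat pair_pre_digraph \<Rightarrow> nat \<Rightarrow> nat \<Rightarrow> bool" where
  "nbr G u v \<equiv> (u, v) \<in> parcs G"
abbreviation onbr :: "nat pair_pre_digraph \<Rightarrow> nat \<Rightarrow> nat \<Rightarrow> bool" where
  "onbr G u v \<equiv> (u, v) \<in> parcs (orient G)"

text \<open>Tables 2 to 5 hold: neighbours, out-neighbours in the orientation, third vertices of the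
  triangles on an edge, and common out-neighbours of the three vertices of a directed triangle.\<close>

fun fam :: "nat pair_pre_digraph \<Rightarrow> nat \<Rightarrow> nat list \<Rightarrow> nat set" where
  "fam G h [u] = (if h = 2 then {v. nbr G u v} else if h = 3 then {v. onbr G u v} else {})"
| "fam G h [x, y] = (if h = 4 then {z. nbr G x y \<and> nbr G x z \<and> nbr G y z} else {})"
| "fam G h [a, b, c] = (if h = 5 then {d. onbr G a b \<and> onbr G b c \<and> onbr G a c \<and>
     onbr G a d \<and> onbr G b d \<and> onbr G c d} else {})"
| "fam G h _ = {}"

text \<open>The summand 1 pays for the constant work on the empty graph.\<close>

definition budget :: "nat pair_pre_digraph \<Rightarrow> nat" where
  "budget G = num_copies wedge G + num_copies diamond G + num_copies directed_3path (orient G)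
     + num_copies directed_bipyramid (orient G) + card (edge_set G) + nV G + 1"

lemma oarc_arc: "onbr G u v \<Longrightarrow> nbr G u v"
  by (auto simp: orient_def)

lemma good_arc:
  assumes "good G" "nbr G u v" shows "u < nV G" "v < nV G" "nbr G v u" "u \<noteq> v"
proof -
  interpret pair_graph G using assms by (simp add: good_def)
  show "u < nV G" "v < nV G" using assms in_arcsD1 in_arcsD2 by (auto simp: good_def)
  show "nbr G v u" using assms arcs_symmetric by auto
  show "u \<noteq> v" using assms pair_no_loops by fastforce
qed

lemma fam_sub: "good G \<Longrightarrow> fam G h ks \<subseteq> {..<nV G}"
  by (cases "(G, h, ks)" rule: fam.cases) (auto dest: good_arc oarc_arc)

lemma mE_le: assumes "good G" shows "mE G \<le> nV G ^ 2"
proof -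
  have "edge_set G \<subseteq> (\<lambda>(u, v). {u, v}) ` ({..<nV G} \<times> {..<nV G})"
    using good_arc[OF assms] by (auto simp: edge_set_def)
  then have "card (edge_set G) \<le> card ((\<lambda>(u, v). {u, v}) ` ({..<nV G} \<times> {..<nV G}))"
    by (intro card_mono) auto
  also have "\<dots> \<le> card ({..<nV G} \<times> {..<nV G})" by (intro card_image_le) auto
  finally show ?thesis by (simp add: mE_def power2_eq_square card_cartesian_product)
qed

lemma Mx_less: assumes "good G" shows "int (Mx G) < (int (nV G) + 2) ^ 2" "Mx G \<le> (nV G + 2) ^ 2"
proof -
  have "nV G + nV G ^ 2 < (nV G + 2) ^ 2" by (simp add: power2_eq_square)
  then have "Mx G < (nV G + 2) ^ 2" using mE_le[OF assms] by (simp add: Mx_def)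
  then show "Mx G \<le> (nV G + 2) ^ 2" by simp
  have "int (Mx G) < int ((nV G + 2) ^ 2)" using \<open>Mx G < (nV G + 2) ^ 2\<close> by (simp only: of_nat_less_iff)
  then show "int (Mx G) < (int (nV G) + 2) ^ 2" by (simp add: add.commute)
qed

section \<open>Programs that prepare the evaluation of a function\<close>

definition ready :: "nat pair_pre_digraph \<Rightarrow> (nat \<Rightarrow> int list \<Rightarrow> int) \<Rightarrow> bool" where
  "ready G T \<longleftrightarrow> (\<exists>L. stored T (fam G) {2..5} L)"

text \<open>Expressions are evaluated in pinned states, where all variables have known values;
  programs start and end in loose states, where none has.\<close>

abbreviation pinned :: "nat pair_pre_digraph \<Rightarrow> (nat \<Rightarrow> nat) \<Rightarrow> ram \<Rightarrow> bool" where
  "pinned G \<phi> \<equiv> st (rs G) (Mx G) \<phi> {}"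

abbreviation loose :: "nat pair_pre_digraph \<Rightarrow> ram \<Rightarrow> bool" where
  "loose G \<equiv> st (rs G) (Mx G) (\<lambda>_. 0) UNIV"

lemma ready_cong: "ready G T \<Longrightarrow> (\<And>h. 2 \<le> h \<Longrightarrow> h \<le> 5 \<Longrightarrow> T' h = T h) \<Longrightarrow> ready G T'"
  by (simp add: ready_def stored_def)

lemma pinned_le: "pinned G \<phi> s \<Longrightarrow> \<phi> x \<le> Mx G"
  by (auto simp: st_def)

text \<open>The base is at least 2 also for the empty graph, so raising the exponent absorbs
  constants and sums. The values of \<phi> are bounded by \<open>Mx G\<close> and not by the number
  of vertices, as that is all one knows about registers.\<close>

definition bounded_fn :: "(nat pair_pre_digraph \<Rightarrow> (nat \<Rightarrow> nat) \<Rightarrow> int) \<Rightarrow> nat \<Rightarrow> bool" where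
  "bounded_fn w k \<longleftrightarrow> (\<forall>G (\<phi> :: nat \<Rightarrow> nat). good G \<and> (\<forall>x. \<phi> x \<le> Mx G) \<longrightarrow> \<bar>w G \<phi>\<bar> \<le> (int (nV G) + 2) ^ k)"

definition evaluates :: "nat pair_pre_digraph \<Rightarrow> int \<Rightarrow> (nat \<Rightarrow> int list \<Rightarrow> int) \<Rightarrow> nat \<Rightarrow> expr \<Rightarrow>
    (nat pair_pre_digraph \<Rightarrow> (nat \<Rightarrow> nat) \<Rightarrow> int) \<Rightarrow> bool" where
  "evaluates G B T N e w \<longleftrightarrow> (\<forall>s \<phi>. (\<forall>h. 2 \<le> h \<and> h < N \<longrightarrow> tabs s h = T h) \<and> pinned G \<phi> s \<longrightarrow>
     fits B s e \<and> val s e = w G \<phi>)"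

text \<open>Program \<open>P\<close>, using the fresh tables \<open>N, \<dots>, N' - 1\<close>, makes the expression \<open>e\<close> evaluate to \<open>w\<close>.\<close>

definition computes where
  "computes N P N' e c k w \<longleftrightarrow> N \<le> N' \<and> bounded_fn w k \<and>
     (\<forall>G B s. good G \<and> (int (nV G) + 2) ^ k \<le> B \<and> loose G s \<and> ready G (tabs s) \<and> (\<forall>h\<ge>N. tabs s h = (\<lambda>_. 0)) \<longrightarrow>
       wp B P (c * budget G) (\<lambda>s'. loose G s' \<and> (\<forall>h<N. tabs s' h = tabs s h) \<and>
         (\<forall>h\<ge>N'. tabs s' h = (\<lambda>_. 0)) \<and> evaluates G B (tabs s') N' e w) s)"

definition computable :: "(nat pair_pre_digraph \<Rightarrow> (nat \<Rightarrow> nat) \<Rightarrow> int) \<Rightarrow> bool" where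
  "computable w \<longleftrightarrow> (\<forall>N\<ge>6. \<exists>P N' e c k. computes N P N' e c k w)"

lemma bounded_fnD: "bounded_fn w k \<Longrightarrow> good G \<Longrightarrow> (\<And>x::nat. \<phi> x \<le> Mx G) \<Longrightarrow> \<bar>w G \<phi>\<bar> \<le> (int (nV G) + 2) ^ k"
  by (simp add: bounded_fn_def)

lemma bounded_fn_mono: assumes "bounded_fn w k" "k \<le> k'" shows "bounded_fn w k'"
  unfolding bounded_fn_def
proof (intro allI impI, elim conjE)
  fix G and \<phi> :: "nat \<Rightarrow> nat" assume "good G" "\<forall>x. \<phi> x \<le> Mx G"
  then have "\<bar>w G \<phi>\<bar> \<le> (int (nV G) + 2) ^ k" using assms bounded_fnD by blast
  also have "\<dots> \<le> (int (nV G) + 2) ^ k'" using assms by (intro power_increasing) auto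
  finally show "\<bar>w G \<phi>\<bar> \<le> (int (nV G) + 2) ^ k'" .
qed

lemma computes_mono:
  assumes "computes N P N' e c k w" "k \<le> k'" shows "computes N P N' e c k' w"
proof -
  have "(int (nV G) + 2) ^ k \<le> B" if "(int (nV G) + 2) ^ k' \<le> B" for G B
    using power_increasing[OF assms(2), of "int (nV G) + 2"] that by linarith
  then show ?thesis using assms bounded_fn_mono unfolding computes_def by blast
qed

lemma computesD:
  assumes "computes N P N' e c k w" "good G" "(int (nV G) + 2) ^ k \<le> B" "loose G s" "ready G (tabs s)"
    "\<forall>h\<ge>N. tabs s h = (\<lambda>_. 0)"
  shows "wp B P (c * budget G) (\<lambda>s'. loose G s' \<and> (\<forall>h<N. tabs s' h = tabs s h) \<and>
         (\<forall>h\<ge>N'. tabs s' h = (\<lambda>_. 0)) \<and> evaluates G B (tabs s') N' e w) s"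
  using assms unfolding computes_def by blast

lemma budget_pos: "1 \<le> budget G" by (simp add: budget_def)

lemma computable_atom:
  assumes b: "bounded_fn w k"
    and ev: "\<And>G B s \<phi>. good G \<Longrightarrow> (int (nV G) + 2) ^ (k + 2) \<le> B \<Longrightarrow> ready G (tabs s) \<Longrightarrow> pinned G \<phi> s \<Longrightarrow>
      fits B s e \<and> val s e = w G \<phi>"
  shows "computable w"
  unfolding computable_def
proof (intro allI impI)
  fix N :: nat assume "6 \<le> N"
  have "computes N Skip N e 1 (k + 2) w"
    unfolding computes_def
  proof (intro conjI allI impI, simp, rule bounded_fn_mono[OF b], simp, elim conjE)
    fix G B s assume a: "good G" "(int (nV G) + 2) ^ (k + 2) \<le> B" "loose G s" "ready G (tabs s)" "\<forall>h\<ge>N. tabs s h = (\<lambda>_. 0)"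
    have "evaluates G B (tabs s) N e w"
      unfolding evaluates_def
    proof (intro allI impI, elim conjE)
      fix s' \<phi> assume "\<forall>h. 2 \<le> h \<and> h < N \<longrightarrow> tabs s' h = tabs s h" "pinned G \<phi> s'"
      moreover then have "ready G (tabs s')" using \<open>6 \<le> N\<close> by (intro ready_cong[OF a(4)]) auto
      ultimately show "fits B s' e \<and> val s' e = w G \<phi>" using ev a by blast
    qed
    then show "wp B Skip (1 * budget G) (\<lambda>s'. loose G s' \<and> (\<forall>h<N. tabs s' h = tabs s h) \<and>
         (\<forall>h\<ge>N. tabs s' h = (\<lambda>_. 0)) \<and> evaluates G B (tabs s') N e w) s"
      using a budget_pos by (intro wp_Skip) auto
  qed
  then show "\<exists>P N' e c k. computes N P N' e c k w" by blast
qed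

text \<open>Two spare factors \<open>n + 2\<close> in the word bound make room for
  \<open>n + m\<close>; this is the reason for the recurring exponents \<open>k + 2\<close>.\<close>

lemma B_ge:
  assumes "good G" "(int (nV G) + 2) ^ (k + 2) \<le> B"
  shows "int (Mx G) < B" "2 \<le> B" "rs G 0 \<le> Mx G" "rs G 1 \<le> Mx G" "(int (nV G) + 2) ^ k \<le> B"
proof -
  let ?a = "int (nV G) + 2"
  have "1 \<le> ?a ^ k" by simp
  then have "1 * ?a ^ 2 \<le> ?a ^ k * ?a ^ 2" by (intro mult_right_mono) auto
  then have "?a ^ 2 \<le> ?a ^ (k + 2)" unfolding power_add by (simp only: mult_1)
  then have a2: "?a ^ 2 \<le> B" using assms(2) by linarith
  show "int (Mx G) < B" using Mx_less[OF assms(1)] a2 by linarith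
  have "2 * 1 \<le> ?a * ?a" by (intro mult_mono) auto
  then show "2 \<le> B" using a2 by (simp add: power2_eq_square)
  show "rs G 0 \<le> Mx G" "rs G 1 \<le> Mx G" by (auto simp: rs_def Mx_def)
  have "?a ^ k \<le> ?a ^ (k + 2)" by (intro power_increasing) auto
  then show "(int (nV G) + 2) ^ k \<le> B" using assms(2) by linarith
qed

section \<open>Closure under arithmetic\<close>

lemma computable_const: "computable (\<lambda>_ _. c)"
\<comment> \<open>The exponent has to depend on the constant: \<bar>c\<bar> is below the
  corresponding power of 2, and \<open>n + 2\<close> is at least 2.\<close>
proof (rule computable_atom[where e = "Const c" and k = "nat \<bar>c\<bar>"])
  have b: "\<bar>c\<bar> \<le> (int (nV G) + 2) ^ nat \<bar>c\<bar>" for G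
  proof -
    have "int (nat \<bar>c\<bar>) \<le> int (2 ^ nat \<bar>c\<bar>)" using less_exp[of "nat \<bar>c\<bar>"] by (simp only: of_nat_le_iff)
    also have "\<dots> \<le> (int (nV G) + 2) ^ nat \<bar>c\<bar>" by (simp add: power_mono)
    finally show ?thesis by simp
  qed
  then show "bounded_fn (\<lambda>_ _. c) (nat \<bar>c\<bar>)" by (simp add: bounded_fn_def)
  fix G B and s :: ram and \<phi> assume "good G" "(int (nV G) + 2) ^ (nat \<bar>c\<bar> + 2) \<le> B"
  then show "fits B s (Const c) \<and> val s (Const c) = c" using b[of G] B_ge(5) by fastforce
qed

lemma bounded_fn_of_bool: "bounded_fn (\<lambda>G \<phi>. of_bool (R G \<phi>)) 0"
  by (simp add: bounded_fn_def)

lemma stored_val: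
  assumes "stored T (fam G) H L" "h \<in> H" "\<And>h. h \<in> H \<Longrightarrow> tabs s h = T h" "pinned G \<phi> s"
  shows "val s (Lookup h (Const 0 # rvar y # map rvar ks)) = of_bool (\<phi> y \<in> fam G h (map \<phi> ks))"
    and "val s (Lookup h (Const 1 # map rvar ks)) = int (card (fam G h (map \<phi> ks)))"
proof -
  have L: "rep (tabs s h) (L h)" "\<And>ks. set (L h ks) = fam G h ks" using assms(1-3) by (auto simp: stored_def)
  have T: "tabs s h (0 # int (\<phi> y) # map int (map \<phi> ks)) = of_bool (\<phi> y \<in> set (L h (map \<phi> ks)))"
    "tabs s h (1 # map int (map \<phi> ks)) = int (length (L h (map \<phi> ks)))" "distinct (L h (map \<phi> ks))"
    using L(1) unfolding rep_def by blast+
  have "length (L h (map \<phi> ks)) = card (fam G h (map \<phi> ks))" using distinct_card[OF T(3)] L(2) by simp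
  moreover have "regs s (var y) = int (\<phi> y)" using assms(4) by (simp add: st_def)
  ultimately show "val s (Lookup h (Const 0 # rvar y # map rvar ks)) = of_bool (\<phi> y \<in> fam G h (map \<phi> ks))"
    "val s (Lookup h (Const 1 # map rvar ks)) = int (card (fam G h (map \<phi> ks)))"
    using T(1,2) L(2) map_val_rvar[OF assms(4), of ks] by (simp_all del: map_map)
qed

lemma lookup_flag:
  assumes "good G" "(int (nV G) + 2) ^ (0 + 2) \<le> B" "ready G (tabs s)" "pinned G \<phi> s" "h \<in> {2..5}"
  shows "fits B s (Lookup h [Const 0, rvar y, rvar x]) \<and>
    val s (Lookup h [Const 0, rvar y, rvar x]) = of_bool (\<phi> y \<in> fam G h [\<phi> x])"
proof -
  from assms(3) obtain L where L: "stored (tabs s) (fam G) {2..5} L" by (auto simp: ready_def)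
  have v: "val s (Lookup h [Const 0, rvar y, rvar x]) = of_bool (\<phi> y \<in> fam G h [\<phi> x])"
    using stored_val(1)[OF L assms(5) refl assms(4), of y "[x]"] by simp
  note b = B_ge[OF assms(1,2)]
  have "fits B s (rvar x)" "fits B s (rvar y)" by (rule fits_rvar[OF assms(4) b(1)])+
  with v b(2) show ?thesis by (simp del: fits_simps(2))
qed

lemma computable_arc: "computable (\<lambda>G \<phi>. of_bool (nbr G (\<phi> x) (\<phi> y)))"
proof (rule computable_atom[where e = "Lookup 2 [Const 0, rvar y, rvar x]", OF bounded_fn_of_bool])
  fix G B s \<phi> assume a: "good G" "(int (nV G) + 2) ^ (0 + 2) \<le> B" "ready G (tabs s)" "pinned G \<phi> s"
  show "fits B s (Lookup 2 [Const 0, rvar y, rvar x]) \<and>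
    val s (Lookup 2 [Const 0, rvar y, rvar x]) = of_bool (nbr G (\<phi> x) (\<phi> y))"
  proof -
    have "nbr G (\<phi> x) (\<phi> y) \<longleftrightarrow> \<phi> y \<in> fam G 2 [\<phi> x]" by simp
    then show ?thesis by (simp only:) (rule lookup_flag[OF a], simp)
  qed
qed

lemma computable_oarc: "computable (\<lambda>G \<phi>. of_bool (onbr G (\<phi> x) (\<phi> y)))"
proof (rule computable_atom[where e = "Lookup 3 [Const 0, rvar y, rvar x]", OF bounded_fn_of_bool])
  fix G B s \<phi> assume a: "good G" "(int (nV G) + 2) ^ (0 + 2) \<le> B" "ready G (tabs s)" "pinned G \<phi> s"
  show "fits B s (Lookup 3 [Const 0, rvar y, rvar x]) \<and>
    val s (Lookup 3 [Const 0, rvar y, rvar x]) = of_bool (onbr G (\<phi> x) (\<phi> y))"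
  proof -
    have "onbr G (\<phi> x) (\<phi> y) \<longleftrightarrow> \<phi> y \<in> fam G 3 [\<phi> x]" by simp
    then show ?thesis by (simp only:) (rule lookup_flag[OF a], simp)
  qed
qed

lemma computable_lt: "computable (\<lambda>G \<phi>. of_bool (\<phi> x < nV G))"
proof (rule computable_atom[where e = "Op Less (rvar x) (Reg 0)", OF bounded_fn_of_bool])
  fix G B s \<phi> assume a: "good G" "(int (nV G) + 2) ^ (0 + 2) \<le> B" "ready G (tabs s)" "pinned G \<phi> s"
  note b = B_ge[OF a(1,2)]
  have "regs s (var x) = int (\<phi> x)" "regs s 0 = int (nV G)" using a(4) by (simp_all add: st_def rs_def)
  moreover have "fits B s (rvar x)" using fits_rvar[OF a(4) b(1)] .
  ultimately show "fits B s (Op Less (rvar x) (Reg 0)) \<and> val s (Op Less (rvar x) (Reg 0)) = of_bool (\<phi> x < nV G)"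
    using b by (auto simp: rs_def)
qed

lemma computable_op:
  assumes 1: "computable w1" and 2: "computable w2"
    and b: "\<And>k1 k2. bounded_fn w1 k1 \<Longrightarrow> bounded_fn w2 k2 \<Longrightarrow> \<exists>k. bounded_fn (\<lambda>G \<phi>. op_val f (w1 G \<phi>) (w2 G \<phi>)) k"
  shows "computable (\<lambda>G \<phi>. op_val f (w1 G \<phi>) (w2 G \<phi>))"
  unfolding computable_def
proof (intro allI impI)
  fix N :: nat assume N: "6 \<le> N"
  obtain P1 N1 e1 c1 k1 where c1: "computes N P1 N1 e1 c1 k1 w1"
    using 1 N unfolding computable_def by blast
  then have N1: "N \<le> N1" by (simp add: computes_def)
  with N have "6 \<le> N1" by simp
  then obtain P2 N2 e2 c2 k2 where c2: "computes N1 P2 N2 e2 c2 k2 w2"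
    using 2 unfolding computable_def by blast
  then have N2: "N1 \<le> N2" by (simp add: computes_def)
  let ?w = "\<lambda>G \<phi>. op_val f (w1 G \<phi>) (w2 G \<phi>)"
  obtain k0 where k0: "bounded_fn ?w k0" using b c1 c2 unfolding computes_def by blast
  let ?k = "k0 + k1 + k2"
  have c1: "computes N P1 N1 e1 c1 ?k w1" by (rule computes_mono[OF c1]) simp
  have c2: "computes N1 P2 N2 e2 c2 ?k w2" by (rule computes_mono[OF c2]) simp
  have k: "bounded_fn ?w ?k" by (rule bounded_fn_mono[OF k0]) simp
  have "computes N (Seq P1 P2) N2 (Op f e1 e2) (c1 + c2) ?k ?w"
    unfolding computes_def
  proof (intro conjI allI impI, use N1 N2 in simp, rule k, elim conjE)
    fix G B s assume a: "good G" "(int (nV G) + 2) ^ ?k \<le> B" "loose G s" "ready G (tabs s)" "\<forall>h\<ge>N. tabs s h = (\<lambda>_. 0)"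
    let ?Q = "\<lambda>s'. loose G s' \<and> (\<forall>h<N. tabs s' h = tabs s h) \<and>
         (\<forall>h\<ge>N2. tabs s' h = (\<lambda>_. 0)) \<and> evaluates G B (tabs s') N2 (Op f e1 e2) ?w"
    show "wp B (Seq P1 P2) ((c1 + c2) * budget G) ?Q s"
    proof (rule wp_Seq[OF wp_mono[OF computesD[OF c1 a] order_refl]])
      fix s1 assume s1: "loose G s1 \<and> (\<forall>h<N. tabs s1 h = tabs s h) \<and>
         (\<forall>h\<ge>N1. tabs s1 h = (\<lambda>_. 0)) \<and> evaluates G B (tabs s1) N1 e1 w1"
      then have "ready G (tabs s1)" using N by (intro ready_cong[OF a(4)]) auto
      then have "wp B P2 (c2 * budget G) (\<lambda>s'. loose G s' \<and> (\<forall>h<N1. tabs s' h = tabs s1 h) \<and>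
         (\<forall>h\<ge>N2. tabs s' h = (\<lambda>_. 0)) \<and> evaluates G B (tabs s') N2 e2 w2) s1"
        using s1 a by (intro computesD[OF c2]) auto
      then show "wp B P2 (c2 * budget G) ?Q s1"
      proof (rule wp_mono[OF _ order_refl])
        fix s2 assume s2: "loose G s2 \<and> (\<forall>h<N1. tabs s2 h = tabs s1 h) \<and>
         (\<forall>h\<ge>N2. tabs s2 h = (\<lambda>_. 0)) \<and> evaluates G B (tabs s2) N2 e2 w2"
        have "evaluates G B (tabs s2) N2 (Op f e1 e2) ?w"
          unfolding evaluates_def
        proof (intro allI impI, elim conjE)
          fix s' \<phi> assume s': "\<forall>h. 2 \<le> h \<and> h < N2 \<longrightarrow> tabs s' h = tabs s2 h" and pin: "pinned G \<phi> s'"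
          have t1: "\<forall>h. 2 \<le> h \<and> h < N1 \<longrightarrow> tabs s' h = tabs s1 h" using s' s2 N2 by simp
          have 1: "fits B s' e1 \<and> val s' e1 = w1 G \<phi>"
            using s1 t1 pin unfolding evaluates_def by blast
          have 2: "fits B s' e2 \<and> val s' e2 = w2 G \<phi>"
            using s2 s' pin unfolding evaluates_def by blast
          have "\<bar>op_val f (w1 G \<phi>) (w2 G \<phi>)\<bar> \<le> B"
            using bounded_fnD[OF k a(1), of \<phi>] pinned_le[OF pin] a(2) by fastforce
          then show "fits B s' (Op f e1 e2) \<and> val s' (Op f e1 e2) = op_val f (w1 G \<phi>) (w2 G \<phi>)"
            using 1 2 by simp
        qed
        then show "?Q s2" using s1 s2 N1 by auto
      qed
    qed (simp add: add_mult_distrib)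
  qed
  then show "\<exists>P N' e c k. computes N P N' e c k ?w" by blast
qed

lemma bounded_fn_add:
  assumes "bounded_fn w1 k1" "bounded_fn w2 k2"
  shows "bounded_fn (\<lambda>G \<phi>. w1 G \<phi> + w2 G \<phi>) (k1 + k2 + 1)" "bounded_fn (\<lambda>G \<phi>. w1 G \<phi> - w2 G \<phi>) (k1 + k2 + 1)"
proof -
  have *: "\<bar>w1 G \<phi>\<bar> + \<bar>w2 G \<phi>\<bar> \<le> (int (nV G) + 2) ^ (k1 + k2 + 1)"
    if "good G" "\<forall>x. \<phi> x \<le> Mx G" for G \<phi>
  proof -
    let ?a = "int (nV G) + 2"
    have "\<bar>w1 G \<phi>\<bar> + \<bar>w2 G \<phi>\<bar> \<le> ?a ^ k1 + ?a ^ k2"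
      using that assms bounded_fnD by (intro add_mono) auto
    also have "\<dots> \<le> ?a ^ (k1 + k2) + ?a ^ (k1 + k2)" by (intro add_mono power_increasing) auto
    also have "\<dots> = 2 * ?a ^ (k1 + k2)" by simp
    also have "\<dots> \<le> ?a * ?a ^ (k1 + k2)" by (intro mult_right_mono) auto
    finally show ?thesis by simp
  qed
  show "bounded_fn (\<lambda>G \<phi>. w1 G \<phi> + w2 G \<phi>) (k1 + k2 + 1)" "bounded_fn (\<lambda>G \<phi>. w1 G \<phi> - w2 G \<phi>) (k1 + k2 + 1)"
    unfolding bounded_fn_def using * by (smt (verit))+
qed

lemma computable_add: assumes "computable w1" "computable w2" shows "computable (\<lambda>G \<phi>. w1 G \<phi> + w2 G \<phi>)"
  using computable_op[OF assms, of Plus] bounded_fn_add by (simp, blast)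

lemma computable_diff: assumes "computable w1" "computable w2" shows "computable (\<lambda>G \<phi>. w1 G \<phi> - w2 G \<phi>)"
  using computable_op[OF assms, of Minus] bounded_fn_add by (simp, blast)

lemma computable_mult: assumes "computable w1" "computable w2" shows "computable (\<lambda>G \<phi>. w1 G \<phi> * w2 G \<phi>)"
proof -
  have "bounded_fn (\<lambda>G \<phi>. w1 G \<phi> * w2 G \<phi>) (k1 + k2)" if "bounded_fn w1 k1" "bounded_fn w2 k2" for k1 k2
    unfolding bounded_fn_def abs_mult power_add using that bounded_fnD by (auto intro!: mult_mono)
  then show ?thesis using computable_op[OF assms, of Times] by (simp, blast)
qed

text \<open>Needed for the final division by the number of automorphisms. Rounding down does not
  increase the absolute value, also for negative dividends: these satisfy x \<le> x div c \<le>
  0.\<close>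

lemma computable_div: assumes "computable w" "0 < c" shows "computable (\<lambda>G \<phi>. w G \<phi> div c)"
proof -
  have "\<bar>x div c\<bar> \<le> \<bar>x\<bar>" for x
  proof (cases "0 \<le> x")
    case True
    then show ?thesis using assms(2) div_le_dividend[of "nat x" "nat c"]
      by (simp add: pos_imp_zdiv_nonneg_iff) (metis div_by_1 zdiv_mono2 zero_less_one int_one_le_iff_zero_less)
  next
    case False
    have "x \<le> x div c"
    proof -
      have "- x = (- x) * 1" by simp
      also have "\<dots> \<le> (- x) * c" using False assms(2) by (intro mult_left_mono) auto
      finally have "x * c \<le> x" by simp
      then have "x * c div c \<le> x div c" using assms(2) by (intro zdiv_mono1) auto
      then show ?thesis using assms(2) by simp
    qed
    moreover have "x div c \<le> 0" using False assms(2) by (simp add: div_nonpos_pos_le0)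
    ultimately show ?thesis by simp
  qed
  then have "bounded_fn (\<lambda>G \<phi>. w G \<phi> div c) k1" if "bounded_fn w k1" for k1
    using that unfolding bounded_fn_def by (meson order_trans)
  then show ?thesis using computable_op[OF assms(1) computable_const[of c], of Div] by (simp, blast)
qed

lemma computable_sum_list: "(\<And>x. x \<in> set xs \<Longrightarrow> computable (w x)) \<Longrightarrow> computable (\<lambda>G \<phi>. \<Sum>x\<leftarrow>xs. w x G \<phi>)"
  by (induction xs) (auto intro!: computable_const computable_add)

lemma computable_prod_list: "(\<And>x. x \<in> set xs \<Longrightarrow> computable (w x)) \<Longrightarrow> computable (\<lambda>G \<phi>. \<Prod>x\<leftarrow>xs. w x G \<phi>)"
  by (induction xs) (auto intro!: computable_const computable_mult)

section \<open>Tabulated sums over loop nests\<close>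

fun closed_levels :: "nat set \<Rightarrow> (nat \<times> level) list \<Rightarrow> bool" where
  "closed_levels X [] \<longleftrightarrow> True"
| "closed_levels X ((x, l) # ls) \<longleftrightarrow> (case l of Rng q \<Rightarrow> True | Fam h ks \<Rightarrow> set ks \<subseteq> X) \<and> closed_levels (insert x X) ls"

text \<open>With \<open>X\<close> empty: a closed nest reads only variables that it has set itself,
  so its sum does not depend on what the registers contained before.\<close>

lemma nsum_cong:
  assumes "closed_levels X ls" "\<forall>x\<in>X. \<phi> x = \<psi> x"
    and "\<And>\<phi>' \<psi>'. \<forall>x\<in>X \<union> vars ls. \<phi>' x = \<psi>' x \<Longrightarrow> f \<phi>' = g \<psi>'"
  shows "nsum r F ls f \<phi> = nsum r F ls g \<psi>"
  using assms
proof (induction ls arbitrary: X \<phi> \<psi>)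
  case (Cons xl ls)
  obtain x l where xl: "xl = (x, l)" by force
  have "lset r F l \<phi> = lset r F l \<psi>"
    using Cons.prems xl by (intro lset_cong) (auto split: level.splits)
  moreover have "nsum r F ls f (\<phi>(x := y)) = nsum r F ls g (\<psi>(x := y))" for y
    using Cons.prems xl by (intro Cons.IH[of "insert x X"]) auto
  ultimately show ?case using xl by simp
qed simp

lemma nsum_abs: "\<bar>nsum r F ls f \<phi>\<bar> \<le> nsum r F ls (\<lambda>\<phi>. \<bar>f \<phi>\<bar>) \<phi>"
proof (induction ls arbitrary: \<phi>)
  case (Cons xl ls)
  obtain x l where xl: "xl = (x, l)" by force
  show ?case unfolding xl nsum.simps using Cons by (intro order_trans[OF sum_abs] sum_mono)
qed simp

lemma nsum_mono: "(\<And>\<phi>. f \<phi> \<le> g \<phi>) \<Longrightarrow> nsum r F ls f \<phi> \<le> nsum r F ls g \<phi>"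
  by (induction ls arbitrary: \<phi>) (auto intro!: sum_mono)

lemma nsum_bound:
  assumes "\<And>l \<phi>. lset r F l \<phi> \<subseteq> {..<M}" "0 \<le> K" "\<And>\<phi>. (\<And>x. \<phi> x \<le> M) \<Longrightarrow> f \<phi> \<le> K" "\<And>x. \<phi> x \<le> M"
  shows "nsum r F ls f \<phi> \<le> int M ^ length ls * K"
  using assms(4)
proof (induction ls arbitrary: \<phi>)
  case Nil
  then show ?case using assms(3) by simp
next
  case (Cons xl ls)
  obtain x l where xl: "xl = (x, l)" by force
  have "nsum r F (xl # ls) f \<phi> \<le> (\<Sum>y\<in>lset r F l \<phi>. int M ^ length ls * K)"
    unfolding xl nsum.simps
  proof (intro sum_mono Cons.IH)
    fix y z assume "y \<in> lset r F l \<phi>"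
    then have "y \<le> M" using assms(1)[of l \<phi>] by auto
    then show "(\<phi>(x := y)) z \<le> M" using Cons.prems by simp
  qed
  also have "\<dots> = int (card (lset r F l \<phi>)) * (int M ^ length ls * K)" by simp
  also have "\<dots> \<le> int M * (int M ^ length ls * K)"
    using card_mono[OF _ assms(1)[of l \<phi>]] assms(2) by (intro mult_right_mono) auto
  finally show ?case by (simp add: mult.assoc)
qed

text \<open>Excluding \<open>Rng 1\<close> makes every variable of the nest range over vertices;
  only reading the input runs over edge numbers.\<close>

definition cheap :: "(nat \<times> level) list \<Rightarrow> bool" where
  "cheap ls \<longleftrightarrow> wf_levels ls \<and> levels_in {2..5} ls \<and> (\<forall>(x, l)\<in>set ls. l \<noteq> Rng 1) \<and> closed_levels {} ls \<and>
     (\<exists>c. \<forall>G \<phi>. good G \<longrightarrow> nsteps (rs G) (fam G) ls \<phi> \<le> c * budget G)"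

lemma lset_Mx: "good G \<Longrightarrow> lset (rs G) (fam G) l \<phi> \<subseteq> {..<Mx G}"
proof (cases l)
  case (Rng q)
  then show ?thesis by (auto simp: rs_def Mx_def)
next
  case (Fam h ks)
  assume "good G"
  then show ?thesis using Fam fam_sub[of G h "map \<phi> ks"] by (auto simp: Mx_def)
qed

lemma nsum_bounded_fn:
  assumes "bounded_fn w k" "good G" "\<And>x. \<phi> x \<le> Mx G"
  shows "nsum (rs G) (fam G) ls (\<lambda>\<phi>. \<bar>w G \<phi>\<bar>) \<phi> \<le> (int (nV G) + 2) ^ (2 * length ls + k)"
proof -
  have "nsum (rs G) (fam G) ls (\<lambda>\<phi>. \<bar>w G \<phi>\<bar>) \<phi> \<le> int (Mx G) ^ length ls * (int (nV G) + 2) ^ k"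
    using lset_Mx[OF assms(2)] bounded_fnD[OF assms(1,2)] assms(3) by (intro nsum_bound) auto
  also have "\<dots> \<le> ((int (nV G) + 2) ^ 2) ^ length ls * (int (nV G) + 2) ^ k"
    using Mx_less(1)[OF assms(2)] by (intro mult_right_mono power_mono) auto
  finally show ?thesis by (simp add: power_mult power_add)
qed

text \<open>A single run of the nest fills the table for all keys at once: each assignment adds its
  value of \<open>w\<close> to the entry given by the values of \<open>ks\<close>. Afterwards one
  lookup under \<open>ks'\<close> replaces a sum.\<close>

theorem computable_nsum:
  assumes w: "computable w" and dep: "\<And>G \<phi> \<psi>. \<forall>x\<in>vars ls. \<phi> x = \<psi> x \<Longrightarrow> w G \<phi> = w G \<psi>"
    and ls: "cheap ls" and ks: "set ks \<subseteq> vars ls"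
  shows "computable (\<lambda>G \<phi>. nsum (rs G) (fam G) ls (\<lambda>\<psi>. if map \<psi> ks = map \<phi> ks' then w G \<psi> else 0) (\<lambda>_. 0))"
    (is "computable ?W")
  unfolding computable_def
proof (intro allI impI)
  fix N :: nat assume N: "6 \<le> N"
  obtain P1 N1 e1 c1 k1 where c1: "computes N P1 N1 e1 c1 k1 w"
    using w N unfolding computable_def by blast
  then have N1: "N \<le> N1" and k1: "bounded_fn w k1" by (simp_all add: computes_def)
  obtain c where c: "\<And>G \<phi>. good G \<Longrightarrow> nsteps (rs G) (fam G) ls \<phi> \<le> c * budget G"
    and wf: "wf_levels ls" "levels_in {2..5} ls" "closed_levels {} ls"
    using ls unfolding cheap_def by blast
  let ?k = "2 * length ls + k1 + 2"
  have c1: "computes N P1 N1 e1 c1 ?k w" by (rule computes_mono[OF c1]) simp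
  let ?r = "\<lambda>G. nsum (rs G) (fam G) ls"
  let ?nc = "nest_cost ls (3 + cost e1 + 2 * length ks)"
  let ?e = "Lookup N1 (map rvar ks')"
  have absW: "\<bar>?r G (\<lambda>\<psi>. if map \<psi> ks = key then w G \<psi> else 0) \<phi>\<bar> \<le> (int (nV G) + 2) ^ (2 * length ls + k1)"
    if "good G" "\<And>x. \<phi> x \<le> Mx G" for G \<phi> key
  proof -
    have "\<bar>?r G (\<lambda>\<psi>. if map \<psi> ks = key then w G \<psi> else 0) \<phi>\<bar> \<le> ?r G (\<lambda>\<phi>. \<bar>w G \<phi>\<bar>) \<phi>"
      by (intro order_trans[OF nsum_abs] nsum_mono) auto
    then show ?thesis using nsum_bounded_fn[where \<phi> = \<phi>, OF k1 that, of ls] by linarith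
  qed
  have "computes N (Seq P1 (nest ls (acc N1 ks e1))) (Suc N1) ?e (c1 + ?nc * c) ?k ?W"
    unfolding computes_def
  proof (intro conjI allI impI, use N1 in simp, unfold bounded_fn_def, intro allI impI, elim conjE)
    fix G and \<phi> :: "nat \<Rightarrow> nat" assume "good G"
    then have "\<bar>?W G \<phi>\<bar> \<le> (int (nV G) + 2) ^ (2 * length ls + k1)" by (intro absW) auto
    also have "\<dots> \<le> (int (nV G) + 2) ^ ?k" by (intro power_increasing) auto
    finally show "\<bar>?W G \<phi>\<bar> \<le> (int (nV G) + 2) ^ ?k" .
  next
    fix G B s assume "good G \<and> (int (nV G) + 2) ^ ?k \<le> B \<and> loose G s \<and> ready G (tabs s) \<and> (\<forall>h\<ge>N. tabs s h = (\<lambda>_. 0))"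
    then have a: "good G" "(int (nV G) + 2) ^ ?k \<le> B" "loose G s" "ready G (tabs s)" "\<forall>h\<ge>N. tabs s h = (\<lambda>_. 0)"
      by blast+
    note B = B_ge[OF a(1,2)]
    let ?Q = "\<lambda>s'. loose G s' \<and> (\<forall>h<N. tabs s' h = tabs s h) \<and>
         (\<forall>h\<ge>Suc N1. tabs s' h = (\<lambda>_. 0)) \<and> evaluates G B (tabs s') (Suc N1) ?e ?W"
    show "wp B (Seq P1 (nest ls (acc N1 ks e1))) ((c1 + ?nc * c) * budget G) ?Q s"
    proof (rule wp_Seq[OF wp_mono[OF computesD[OF c1 a] order_refl]])
      fix s1 assume s1: "loose G s1 \<and> (\<forall>h<N. tabs s1 h = tabs s h) \<and>
         (\<forall>h\<ge>N1. tabs s1 h = (\<lambda>_. 0)) \<and> evaluates G B (tabs s1) N1 e1 w"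
      have "ready G (tabs s1)" using N s1 by (intro ready_cong[OF a(4)]) auto
      then obtain L where L: "stored (tabs s1) (fam G) {2..5} L" by (auto simp: ready_def)
      \<comment> \<open>The run starts from whatever the registers contain. Since the nest is
        closed, this can be replaced by the constant 0 in the end.\<close>
      define \<phi>0 where "\<phi>0 x = nat (regs s1 (var x))" for x
      have st1: "st (rs G) (Mx G) \<phi>0 (vars ls) s1"
        using s1 unfolding st_def \<phi>0_def by auto
      have \<phi>0: "\<phi>0 x \<le> Mx G" for x using s1 unfolding st_def \<phi>0_def by (simp add: nat_le_iff)
      have "wp B (nest ls (acc N1 ks e1)) (?nc * nsteps (rs G) (fam G) ls \<phi>0)
        (\<lambda>s'. st (rs G) (Mx G) \<phi>0 UNIV s' \<and> (\<forall>h'. h' \<noteq> N1 \<longrightarrow> tabs s' h' = tabs s1 h') \<and>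
          (\<forall>key. tabs s' N1 (map int key) = ?r G (\<lambda>\<phi>. if map \<phi> ks = key then w G \<phi> else 0) \<phi>0)) s1"
      proof (rule wp_acc[OF B(1-4) L wf(2) _ wf(1) st1])
        show "fam G h ks \<subseteq> {..<rs G 0}" for h ks using fam_sub[OF a(1)] by (simp add: rs_def)
        show "N1 \<notin> {2..5}" using N N1 by simp
        show "tabs s1 N1 = (\<lambda>_. 0)" using s1 by simp
        show "?r G (\<lambda>\<phi>. \<bar>w G \<phi>\<bar>) \<phi>0 \<le> B"
          using nsum_bounded_fn[where \<phi> = \<phi>0, OF k1 a(1) \<phi>0, of ls] B(5) by linarith
        fix s' \<phi> assume "\<forall>h'. h' \<noteq> N1 \<longrightarrow> tabs s' h' = tabs s1 h'" "pinned G \<phi> s'"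
        then show "fits B s' e1 \<and> val s' e1 = w G \<phi>"
          using s1 unfolding evaluates_def by simp
      qed
      then show "wp B (nest ls (acc N1 ks e1)) (?nc * c * budget G) ?Q s1"
      proof (rule wp_mono)
        show "?nc * nsteps (rs G) (fam G) ls \<phi>0 \<le> ?nc * c * budget G"
          using c[OF a(1), of \<phi>0] by (simp add: mult.assoc)
        fix s2 assume s2: "st (rs G) (Mx G) \<phi>0 UNIV s2 \<and> (\<forall>h'. h' \<noteq> N1 \<longrightarrow> tabs s2 h' = tabs s1 h') \<and>
          (\<forall>key. tabs s2 N1 (map int key) = ?r G (\<lambda>\<phi>. if map \<phi> ks = key then w G \<phi> else 0) \<phi>0)"
        have "evaluates G B (tabs s2) (Suc N1) ?e ?W"
          unfolding evaluates_def
        proof (intro allI impI, elim conjE)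
          fix s' \<phi> assume s': "\<forall>h. 2 \<le> h \<and> h < Suc N1 \<longrightarrow> tabs s' h = tabs s2 h" and pin: "pinned G \<phi> s'"
          have "tabs s' N1 = tabs s2 N1" using s' N N1 by simp
          then have "val s' ?e = ?r G (\<lambda>\<psi>. if map \<psi> ks = map \<phi> ks' then w G \<psi> else 0) \<phi>0"
            unfolding val.simps map_val_rvar[OF pin] using s2 by (simp del: map_map)
          also have "\<dots> = ?W G \<phi>"
          proof (rule nsum_cong[OF wf(3)])
            fix \<phi>' \<psi>' :: "nat \<Rightarrow> nat" assume "\<forall>x\<in>{} \<union> vars ls. \<phi>' x = \<psi>' x"
            then have "map \<phi>' ks = map \<psi>' ks" "w G \<phi>' = w G \<psi>'" using ks dep[of \<phi>' \<psi>' G] by (auto simp: subset_iff)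
            then show "(if map \<phi>' ks = map \<phi> ks' then w G \<phi>' else 0) = (if map \<psi>' ks = map \<phi> ks' then w G \<psi>' else 0)" by (simp del: map_eq_conv)
          qed simp
          finally have v: "val s' ?e = ?W G \<phi>" .
          have "\<bar>?W G \<phi>\<bar> \<le> (int (nV G) + 2) ^ (2 * length ls + k1)" by (rule absW) (use a in auto)
          then have "\<bar>val s' ?e\<bar> \<le> B" unfolding v using B(5) by linarith
          then have "fits B s' ?e" using fits_rvar[OF pin B(1)] by (simp del: fits_simps(2))
          with v show "fits B s' ?e \<and> val s' ?e = ?W G \<phi>" by blast
        qed
        moreover have "loose G s2" using s2 by (simp add: st_def)
        ultimately show "?Q s2" using s1 s2 N1 by auto
      qed
    qed (simp add: add_mult_distrib)
  qed
  then show "\<exists>P N' e c k. computes N P N' e c k ?W" by blast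
qed

section \<open>Matches and embeddings\<close>

definition embeddings :: "'b pair_pre_digraph \<Rightarrow> 'a pair_pre_digraph \<Rightarrow> ('b \<Rightarrow> 'a) set" where
  "embeddings H G = {f \<in> pverts H \<rightarrow>\<^sub>E pverts G. inj_on f (pverts H) \<and>
     (\<forall>a\<in>pverts H. \<forall>b\<in>pverts H. (a, b) \<in> parcs H \<longrightarrow> (f a, f b) \<in> parcs G)}"

text \<open>Matches point from the graph to the pattern and embeddings from the pattern to the
  graph; they are inverse to each other.\<close>

definition match_of :: "'b pair_pre_digraph \<Rightarrow> ('b \<Rightarrow> 'a) \<Rightarrow> ('a \<rightharpoonup> 'b)" where
  "match_of H f t = (if t \<in> f ` pverts H then Some (inv_into (pverts H) f t) else None)"

lemma match_of_eq: "inj_on f (pverts H) \<Longrightarrow> a \<in> pverts H \<Longrightarrow> match_of H f (f a) = Some a"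
  by (simp add: match_of_def)

lemma dom_match_of: "dom (match_of H f) = f ` pverts H"
  by (auto simp: match_of_def dom_def)

lemma match_of_iff:
  assumes "f \<in> embeddings H G" "a \<in> pverts H"
  shows "v \<in> dom (match_of H f) \<and> the (match_of H f v) = a \<longleftrightarrow> f a = v"
proof -
  have inj: "inj_on f (pverts H)" using assms by (simp add: embeddings_def)
  show ?thesis
  proof
    assume "v \<in> dom (match_of H f) \<and> the (match_of H f v) = a"
    then obtain b where "b \<in> pverts H" "v = f b" "the (match_of H f v) = a" by (auto simp: dom_match_of)
    then show "f a = v" using match_of_eq[OF inj] by simp
  next
    assume "f a = v"
    then show "v \<in> dom (match_of H f) \<and> the (match_of H f v) = a"
      using match_of_eq[OF inj assms(2)] by (auto simp: dom_def)
  qed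
qed

lemma bij_match_of: "bij_betw (match_of H) (embeddings H G) (matches H G)"
  unfolding bij_betw_def
proof (intro conjI equalityI subsetI)
  show "inj_on (match_of H) (embeddings H G)"
  proof (rule inj_onI)
    fix f g assume fg: "f \<in> embeddings H G" "g \<in> embeddings H G" "match_of H f = match_of H g"
    then have inj: "inj_on f (pverts H)" "inj_on g (pverts H)"
      and ext: "f \<in> extensional (pverts H)" "g \<in> extensional (pverts H)"
      by (auto simp: embeddings_def PiE_def)
    show "f = g"
    proof (rule extensionalityI[OF ext])
      fix a assume a: "a \<in> pverts H"
      then have "match_of H g (f a) = Some a" using match_of_eq[OF inj(1) a] fg(3) by simp
      then show "f a = g a" using match_of_iff[OF fg(2) a, of "f a"] by (auto simp: dom_def)
    qed
  qed
next
  fix \<pi> assume "\<pi> \<in> match_of H ` embeddings H G"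
  then obtain f where f: "f \<in> embeddings H G" "\<pi> = match_of H f" by blast
  then have inj: "inj_on f (pverts H)" by (simp add: embeddings_def)
  have the: "the (match_of H f (f a)) = a" if "a \<in> pverts H" for a
    using match_of_eq[OF inj that] by simp
  have "bij_betw (\<lambda>t. the (match_of H f t)) (f ` pverts H) (pverts H)"
    by (rule bij_betwI[where g = f]) (auto simp: the)
  moreover have "f ` pverts H \<subseteq> pverts G" using f by (auto simp: embeddings_def)
  ultimately show "\<pi> \<in> matches H G"
    using f the by (auto simp: matches_def dom_match_of embeddings_def)
next
  fix \<pi> assume \<pi>: "\<pi> \<in> matches H G"
  let ?p = "\<lambda>t. the (\<pi> t)"
  have bij: "bij_betw ?p (dom \<pi>) (pverts H)" and sub: "dom \<pi> \<subseteq> pverts G"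
    and hom: "\<And>s t. s \<in> dom \<pi> \<Longrightarrow> t \<in> dom \<pi> \<Longrightarrow> (?p s, ?p t) \<in> parcs H \<Longrightarrow> (s, t) \<in> parcs G"
    using \<pi> by (auto simp: matches_def)
  define f where "f = restrict (inv_into (dom \<pi>) ?p) (pverts H)"
  have f: "f a \<in> dom \<pi>" "?p (f a) = a" if "a \<in> pverts H" for a
  proof -
    have "a \<in> ?p ` dom \<pi>" using that bij by (simp add: bij_betw_def)
    then show "f a \<in> dom \<pi>" "?p (f a) = a" using that
      by (simp_all add: f_def inv_into_into f_inv_into_f[where f = ?p])
  qed
  have inj: "inj_on f (pverts H)" by (metis f(2) inj_onI)
  have "f \<in> embeddings H G"
    unfolding embeddings_def using f sub inj hom by (auto simp: f_def)
  moreover have "match_of H f = \<pi>"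
  proof
    fix t
    show "match_of H f t = \<pi> t"
    proof (cases "t \<in> dom \<pi>")
      case True
      then have "?p t \<in> pverts H" using bij by (auto simp: bij_betw_def)
      moreover from this have "f (?p t) = t" using f[of "?p t"] True bij
        by (meson bij_betw_def inj_onD)
      ultimately have "match_of H f t = Some (?p t)" using match_of_eq[OF inj, of "?p t"] by simp
      then show ?thesis using True by auto
    next
      case False
      then have "t \<notin> f ` pverts H" using f by blast
      then show ?thesis using False by (auto simp: match_of_def dom_def)
    qed
  qed
  ultimately show "\<pi> \<in> match_of H ` embeddings H G" by blast
qed

definition auts :: "'b pair_pre_digraph \<Rightarrow> ('b \<Rightarrow> 'b) set" where
  "auts H = {\<sigma> \<in> extensional (pverts H). automorphism H \<sigma>}"

lemma isomorphism_cong: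
  "(\<And>a. a \<in> pverts H \<Longrightarrow> \<sigma> a = \<tau> a) \<Longrightarrow> isomorphism H H' \<sigma> = isomorphism H H' \<tau>"
  unfolding isomorphism_def by (simp cong: bij_betw_cong)

lemma isomorphism_id: "isomorphism H H id"
  by (simp add: isomorphism_def)

lemma isomorphism_comp:
  assumes "isomorphism H H' \<sigma>" "isomorphism H' H'' \<tau>" shows "isomorphism H H'' (\<tau> \<circ> \<sigma>)"
proof -
  have "\<sigma> a \<in> pverts H'" if "a \<in> pverts H" for a using assms(1) that by (auto simp: isomorphism_def bij_betw_def)
  then show ?thesis using assms bij_betw_trans unfolding isomorphism_def by auto
qed

lemma isomorphism_inv:
  assumes "isomorphism H H' \<sigma>" shows "isomorphism H' H (inv_into (pverts H) \<sigma>)"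
proof -
  let ?i = "inv_into (pverts H) \<sigma>"
  have "bij_betw \<sigma> (pverts H) (pverts H')" using assms by (simp add: isomorphism_def)
  then have "bij_betw ?i (pverts H') (pverts H)" "\<And>a. a \<in> pverts H' \<Longrightarrow> ?i a \<in> pverts H \<and> \<sigma> (?i a) = a"
    using bij_betw_inv_into by (blast, auto simp: bij_betw_def inv_into_into f_inv_into_f)
  then show ?thesis using assms unfolding isomorphism_def by auto
qed

lemma finite_auts: "finite (pverts H) \<Longrightarrow> finite (auts H)"
  by (rule finite_subset[OF _ finite_PiE[of "pverts H" "\<lambda>_. pverts H"]])
    (auto simp: auts_def isomorphism_def bij_betw_def PiE_def)

lemma card_auts_pos: "finite (pverts H) \<Longrightarrow> 0 < card (auts H)"
proof -
  assume fin: "finite (pverts H)"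
  have "automorphism H (restrict id (pverts H))"
    using isomorphism_id[of H] isomorphism_cong[of H "restrict id (pverts H)" id H] by simp
  then have "restrict id (pverts H) \<in> auts H" by (simp add: auts_def)
  then show ?thesis using finite_auts[OF fin] card_gt_0_iff by blast
qed

text \<open>Automorphisms act freely on matches.\<close>

lemma card_eq_num_distinct:
  assumes M: "M \<subseteq> matches H G" "finite M" and fin: "finite (pverts H)"
    and closed: "\<And>\<pi> \<sigma>. \<pi> \<in> M \<Longrightarrow> automorphism H \<sigma> \<Longrightarrow> map_option \<sigma> \<circ> \<pi> \<in> M"
  shows "card M = card (auts H) * num_distinct H M"
proof -
  let ?R = "{(\<pi>, \<pi>'). \<pi> \<in> M \<and> \<pi>' \<in> M \<and> match_equiv H \<pi> \<pi>'}"
  have ran: "the (\<pi> t) \<in> pverts H" if "\<pi> \<in> M" "t \<in> dom \<pi>" for \<pi> t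
    using that M by (auto simp: matches_def bij_betw_def)
  have onto: "\<exists>t\<in>dom \<pi>. the (\<pi> t) = a" if "\<pi> \<in> M" "a \<in> pverts H" for \<pi> a
  proof -
    have "(\<lambda>t. the (\<pi> t)) ` dom \<pi> = pverts H" using that(1) M by (auto simp: matches_def bij_betw_def)
    then show ?thesis using that(2) by (metis imageE)
  qed
  have comp_cong: "map_option \<sigma> \<circ> \<pi> = map_option \<tau> \<circ> \<pi>"
    if "\<pi> \<in> M" "\<And>a. a \<in> pverts H \<Longrightarrow> \<sigma> a = \<tau> a" for \<sigma> \<tau> :: "'b \<Rightarrow> 'b" and \<pi>
  proof
    fix t show "(map_option \<sigma> \<circ> \<pi>) t = (map_option \<tau> \<circ> \<pi>) t"
      using ran[OF that(1), of t] that(2) by (cases "\<pi> t") (auto simp: dom_def)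
  qed
  have "equiv M ?R"
  proof (rule equivI)
    show "?R \<subseteq> M \<times> M" by auto
    show "refl_on M ?R"
    proof (rule refl_onI)
      fix \<pi> assume "\<pi> \<in> M"
      moreover have "\<pi> = map_option id \<circ> \<pi>" by (simp add: fun_eq_iff option.map_id)
      ultimately show "(\<pi>, \<pi>) \<in> ?R" using isomorphism_id unfolding match_equiv_def by blast
    qed
    show "sym ?R"
    proof (rule symI)
      fix \<pi> \<pi>' assume "(\<pi>, \<pi>') \<in> ?R"
      then obtain \<sigma> where \<sigma>: "\<pi> \<in> M" "\<pi>' \<in> M" "automorphism H \<sigma>" "\<pi>' = map_option \<sigma> \<circ> \<pi>"
        by (auto simp: match_equiv_def)
      let ?i = "inv_into (pverts H) \<sigma>"
      have "map_option ?i \<circ> \<pi>' = map_option (?i \<circ> \<sigma>) \<circ> \<pi>" unfolding \<sigma>(4)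
        by (simp add: fun_eq_iff option.map_comp)
      also have "\<dots> = map_option id \<circ> \<pi>"
        by (rule comp_cong[OF \<sigma>(1)]) (use \<sigma>(3) in \<open>auto simp: isomorphism_def bij_betw_def\<close>)
      also have "\<dots> = \<pi>" by (simp add: fun_eq_iff option.map_id)
      finally have "\<pi> = map_option ?i \<circ> \<pi>'" by (rule sym)
      then show "(\<pi>', \<pi>) \<in> ?R" using \<sigma> isomorphism_inv[OF \<sigma>(3)] unfolding match_equiv_def by blast
    qed
    show "trans ?R"
    proof (rule transI)
      fix \<pi> \<pi>' \<pi>'' assume "(\<pi>, \<pi>') \<in> ?R" "(\<pi>', \<pi>'') \<in> ?R"
      then obtain \<sigma> \<tau> where \<sigma>: "\<pi> \<in> M" "\<pi>'' \<in> M" "automorphism H \<sigma>" "\<pi>' = map_option \<sigma> \<circ> \<pi>"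
        "automorphism H \<tau>" "\<pi>'' = map_option \<tau> \<circ> \<pi>'"
        by (auto simp: match_equiv_def)
      then have "\<pi>'' = map_option (\<tau> \<circ> \<sigma>) \<circ> \<pi>" by (simp add: fun_eq_iff option.map_comp)
      then show "(\<pi>, \<pi>'') \<in> ?R" using \<sigma> isomorphism_comp[OF \<sigma>(3,5)] unfolding match_equiv_def by blast
    qed
  qed
  note eq = this
  have cls: "card C = card (auts H)" if C: "C \<in> M // ?R" for C
  proof -
    obtain \<pi> where \<pi>: "\<pi> \<in> M" "C = ?R `` {\<pi>}" using C by (rule quotientE)
    have "C = (\<lambda>\<sigma>. map_option \<sigma> \<circ> \<pi>) ` auts H"
    proof (intro equalityI subsetI)
      fix \<pi>' assume "\<pi>' \<in> C"
      then obtain \<sigma> where \<sigma>: "automorphism H \<sigma>" "\<pi>' = map_option \<sigma> \<circ> \<pi>" using \<pi> by (auto simp: match_equiv_def)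
      have "restrict \<sigma> (pverts H) \<in> auts H"
        using \<sigma>(1) isomorphism_cong[of H "restrict \<sigma> (pverts H)" \<sigma> H] by (simp add: auts_def)
      moreover have "\<pi>' = map_option (restrict \<sigma> (pverts H)) \<circ> \<pi>"
        unfolding \<sigma>(2) by (rule comp_cong[OF \<pi>(1)]) simp
      ultimately show "\<pi>' \<in> (\<lambda>\<sigma>. map_option \<sigma> \<circ> \<pi>) ` auts H" by blast
    next
      fix \<pi>' assume "\<pi>' \<in> (\<lambda>\<sigma>. map_option \<sigma> \<circ> \<pi>) ` auts H"
      then show "\<pi>' \<in> C" using \<pi> closed[OF \<pi>(1)] by (auto simp: auts_def match_equiv_def)
    qed
    moreover have "inj_on (\<lambda>\<sigma>. map_option \<sigma> \<circ> \<pi>) (auts H)"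
    proof (rule inj_onI)
      fix \<sigma> \<tau> assume a: "\<sigma> \<in> auts H" "\<tau> \<in> auts H" "map_option \<sigma> \<circ> \<pi> = map_option \<tau> \<circ> \<pi>"
      show "\<sigma> = \<tau>"
      proof (rule extensionalityI[of _ "pverts H"])
        fix b assume "b \<in> pverts H"
        then obtain t where "t \<in> dom \<pi>" "the (\<pi> t) = b" using onto[OF \<pi>(1)] by blast
        then show "\<sigma> b = \<tau> b" using fun_cong[OF a(3), of t] by auto
      qed (use a in \<open>auto simp: auts_def\<close>)
    qed
    ultimately show ?thesis by (simp add: card_image)
  qed
  have "card (auts H) * card (M // ?R) = card (\<Union>(M // ?R))"
  proof (rule card_partition)
    show "finite (M // ?R)" using M(2) by (intro finite_quotient) auto
    show "finite (\<Union>(M // ?R))" using M(2) Union_quotient[OF eq] by simp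
    show "\<And>C D. C \<in> M // ?R \<Longrightarrow> D \<in> M // ?R \<Longrightarrow> C \<noteq> D \<Longrightarrow> C \<inter> D = {}"
      using quotient_disj[OF eq] by blast
  qed (rule cls)
  then show ?thesis using Union_quotient[OF eq] by (simp add: num_distinct_def)
qed

lemma finite_embeddings: "finite (pverts H) \<Longrightarrow> finite (pverts G) \<Longrightarrow> finite (embeddings H G)"
  unfolding embeddings_def by (intro finite_Collect_conjI disjI1) (simp add: finite_PiE)

lemma matches_automorphism:
  assumes "\<pi> \<in> matches H G" "automorphism H \<sigma>"
  shows "map_option \<sigma> \<circ> \<pi> \<in> matches H G"
proof -
  have ran: "the (\<pi> t) \<in> pverts H" if "t \<in> dom \<pi>" for t
    using that assms(1) by (auto simp: matches_def bij_betw_def)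
  have dom: "dom (map_option \<sigma> \<circ> \<pi>) = dom \<pi>" by (auto simp: dom_def)
  have the: "the ((map_option \<sigma> \<circ> \<pi>) t) = \<sigma> (the (\<pi> t))" if "t \<in> dom \<pi>" for t using that by auto
  have "bij_betw (\<sigma> \<circ> (\<lambda>t. the (\<pi> t))) (dom \<pi>) (pverts H)"
    using assms by (intro bij_betw_trans[of _ _ "pverts H"]) (auto simp: matches_def isomorphism_def)
  then have "bij_betw (\<lambda>t. the ((map_option \<sigma> \<circ> \<pi>) t)) (dom \<pi>) (pverts H)"
    by (subst bij_betw_cong[where g = "\<sigma> \<circ> (\<lambda>t. the (\<pi> t))"]) (auto simp: the)
  moreover have "(s, t) \<in> parcs G"
    if "s \<in> dom \<pi>" "t \<in> dom \<pi>" "(the ((map_option \<sigma> \<circ> \<pi>) s), the ((map_option \<sigma> \<circ> \<pi>) t)) \<in> parcs H" for s t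
  proof -
    have "(the (\<pi> s), the (\<pi> t)) \<in> parcs H"
      using that(3) assms(2) ran[OF that(1)] ran[OF that(2)] unfolding the[OF that(1)] the[OF that(2)] isomorphism_def by blast
    then show ?thesis using assms(1) that by (auto simp: matches_def)
  qed
  moreover have "dom \<pi> \<subseteq> pverts G" using assms(1) by (simp add: matches_def)
  ultimately show ?thesis unfolding matches_def
    by (intro CollectI conjI ballI impI) (simp_all only: dom)
qed

lemma finite_matches: "finite (pverts H) \<Longrightarrow> finite (pverts G) \<Longrightarrow> finite (matches H G)"
  using bij_betw_finite[OF bij_match_of, of H G] finite_embeddings by blast

theorem card_embeddings:
  assumes "finite (pverts H)" "finite (pverts G)"
  shows "card (embeddings H G) = card (auts H) * num_copies H G"
  using card_eq_num_distinct[OF subset_refl finite_matches[OF assms] assms(1) matches_automorphism]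
    bij_betw_same_card[OF bij_match_of, of H G] by (simp add: num_copies_def)

section \<open>Vertex orbits and the count \<open>DM\<close>\<close>

definition aut_rel :: "'a pair_pre_digraph \<Rightarrow> ('a \<times> 'a) set" where
  "aut_rel H = {(a, b). a \<in> pverts H \<and> b \<in> pverts H \<and> (\<exists>\<sigma>. automorphism H \<sigma> \<and> \<sigma> a = b)}"

lemma vertex_orbits_aut_rel: "vertex_orbits H = pverts H // aut_rel H"
  by (simp add: vertex_orbits_def aut_rel_def)

lemma equiv_aut_rel: "equiv (pverts H) (aut_rel H)"
proof (rule equivI)
  show "aut_rel H \<subseteq> pverts H \<times> pverts H" by (auto simp: aut_rel_def)
  show "refl_on (pverts H) (aut_rel H)"
    by (rule refl_onI) (auto simp: aut_rel_def intro!: exI[of _ id] isomorphism_id)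
  show "sym (aut_rel H)"
  proof (rule symI)
    fix a b assume "(a, b) \<in> aut_rel H"
    then obtain \<sigma> where \<sigma>: "automorphism H \<sigma>" "\<sigma> a = b" "a \<in> pverts H" "b \<in> pverts H" by (auto simp: aut_rel_def)
    then have "inv_into (pverts H) \<sigma> b = a" by (auto simp: isomorphism_def bij_betw_def)
    then show "(b, a) \<in> aut_rel H" using \<sigma> isomorphism_inv[OF \<sigma>(1)] unfolding aut_rel_def by blast
  qed
  show "trans (aut_rel H)"
  proof (rule transI)
    fix a b c assume "(a, b) \<in> aut_rel H" "(b, c) \<in> aut_rel H"
    then obtain \<sigma> \<tau> where "automorphism H \<sigma>" "\<sigma> a = b" "automorphism H \<tau>" "\<tau> b = c" "a \<in> pverts H" "c \<in> pverts H"
      by (auto simp: aut_rel_def)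
    then show "(a, c) \<in> aut_rel H" using isomorphism_comp[of H H \<sigma> H \<tau>] unfolding aut_rel_def by force
  qed
qed

text \<open>Automorphisms preserve the orbit \<open>S\<close>, so they act freely on the matches
  that send \<open>v\<close> into \<open>S\<close> as well. These matches are split by the image
  \<open>a\<close> of \<open>v\<close> and then inverted.\<close>

theorem DM_embeddings:
  assumes H: "finite (pverts H)" and G: "finite (pverts G)" and S: "S \<in> vertex_orbits H"
  shows "card (auts H) * DM G v (H, S) = (\<Sum>a\<in>S. card {f \<in> embeddings H G. f a = v})"
proof -
  have SV: "S \<subseteq> pverts H"
    using S equiv_aut_rel[of H] unfolding vertex_orbits_aut_rel by (meson in_quotient_imp_subset)
  have closedS: "\<sigma> a \<in> S" if "automorphism H \<sigma>" "a \<in> S" for a \<sigma>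
  proof -
    have "\<sigma> a \<in> pverts H" using that SV by (auto simp: isomorphism_def bij_betw_def)
    then have "(a, \<sigma> a) \<in> aut_rel H" using that SV unfolding aut_rel_def by blast
    then show ?thesis using S that(2) equiv_aut_rel[of H] unfolding vertex_orbits_aut_rel
      by (meson in_quotient_imp_closed)
  qed
  let ?M = "{\<pi> \<in> matches H G. v \<in> dom \<pi> \<and> the (\<pi> v) \<in> S}"
  let ?N = "\<lambda>a. {\<pi> \<in> matches H G. v \<in> dom \<pi> \<and> the (\<pi> v) = a}"
  have fin: "finite (matches H G)" by (rule finite_matches[OF H G])
  have "card ?M = card (auts H) * num_distinct H ?M"
  proof (rule card_eq_num_distinct[where G = G])
    fix \<pi> \<sigma> assume a: "\<pi> \<in> ?M" "automorphism H \<sigma>"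
    then have "map_option \<sigma> \<circ> \<pi> \<in> matches H G" using matches_automorphism by blast
    moreover have "v \<in> dom (map_option \<sigma> \<circ> \<pi>)" using a by auto
    moreover have "the ((map_option \<sigma> \<circ> \<pi>) v) \<in> S" using a closedS by auto
    ultimately show "map_option \<sigma> \<circ> \<pi> \<in> ?M" by blast
  qed (use fin H in auto)
  then have "card (auts H) * DM G v (H, S) = card ?M" by (simp add: DM_def)
  also have "?M = (\<Union>a\<in>S. ?N a)" by blast
  also have "card (\<Union>a\<in>S. ?N a) = (\<Sum>a\<in>S. card (?N a))"
    using SV H finite_subset fin by (intro card_UN_disjoint) auto
  also have "\<dots> = (\<Sum>a\<in>S. card {f \<in> embeddings H G. f a = v})"
  proof (rule sum.cong[OF refl])
    fix a assume "a \<in> S"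
    then have a: "a \<in> pverts H" using SV by blast
    have "bij_betw (match_of H) {f \<in> embeddings H G. f a = v} (?N a)"
    proof (rule bij_betw_subset[OF bij_match_of])
      show "match_of H ` {f \<in> embeddings H G. f a = v} = ?N a"
      proof (intro equalityI subsetI)
        fix \<pi> assume "\<pi> \<in> match_of H ` {f \<in> embeddings H G. f a = v}"
        then obtain f where "f \<in> embeddings H G" "f a = v" "\<pi> = match_of H f" by blast
        then show "\<pi> \<in> ?N a" using match_of_iff[OF _ a, of f G v] bij_match_of[of H G] by (auto simp: bij_betw_def)
      next
        fix \<pi> assume \<pi>: "\<pi> \<in> ?N a"
        then obtain f where f: "f \<in> embeddings H G" "\<pi> = match_of H f" using bij_match_of[of H G] by (auto simp: bij_betw_def)
        then have "f a = v" using match_of_iff[OF f(1) a, of v] \<pi> by blast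
        then show "\<pi> \<in> match_of H ` {f \<in> embeddings H G. f a = v}" using f by blast
      qed
    qed blast
    then show "card (?N a) = card {f \<in> embeddings H G. f a = v}" by (rule bij_betw_same_card[symmetric])
  qed
  finally show ?thesis .
qed

section \<open>Rooted homomorphism counts with disequalities\<close>

text \<open>\<open>E\<close> lists the adjacencies to be preserved and \<open>Q\<close> the pairs
  whose images must differ: \<open>Q\<close> empty gives homomorphisms, \<open>Q\<close> consisting
  of all pairs of distinct vertices gives embeddings.\<close>

definition rooted_maps :: "'a pair_pre_digraph \<Rightarrow> 'b set \<Rightarrow> ('b \<times> 'b) set \<Rightarrow> ('b \<times> 'b) set \<Rightarrow> 'b \<Rightarrow> 'a \<Rightarrow> ('b \<Rightarrow> 'a) set" where
  "rooted_maps G V E Q a v = {f \<in> V \<rightarrow>\<^sub>E pverts G. f a = v \<and>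
     (\<forall>(x, y)\<in>E. (f x, f y) \<in> parcs G) \<and> (\<forall>(x, y)\<in>Q. f x \<noteq> f y)}"

definition rooted_count :: "'a pair_pre_digraph \<Rightarrow> 'b set \<Rightarrow> ('b \<times> 'b) set \<Rightarrow> ('b \<times> 'b) set \<Rightarrow> 'b \<Rightarrow> 'a \<Rightarrow> nat" where
  "rooted_count G V E Q a v = card (rooted_maps G V E Q a v)"

lemma finite_rooted_maps: "finite V \<Longrightarrow> finite (pverts G) \<Longrightarrow> finite (rooted_maps G V E Q a v)"
  unfolding rooted_maps_def by (intro finite_Collect_conjI disjI1) (simp add: finite_PiE)

lemma rooted_count_iso:
  assumes h: "bij_betw h V V'" and a: "a \<in> V" and E: "E \<subseteq> V \<times> V" and Q: "Q \<subseteq> V \<times> V"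
  shows "rooted_count G V E Q a v = rooted_count G V' (map_prod h h ` E) (map_prod h h ` Q) (h a) v"
proof -
  let ?i = "inv_into V h"
  have i: "\<And>x. x \<in> V \<Longrightarrow> ?i (h x) = x" "\<And>x. x \<in> V' \<Longrightarrow> ?i x \<in> V \<and> h (?i x) = x" "\<And>x. x \<in> V \<Longrightarrow> h x \<in> V'"
    using h by (auto simp: bij_betw_def inv_into_into f_inv_into_f)
  have "bij_betw (\<lambda>f. restrict (f \<circ> h) V) (rooted_maps G V' (map_prod h h ` E) (map_prod h h ` Q) (h a) v) (rooted_maps G V E Q a v)"
  proof (rule bij_betwI[where g = "\<lambda>g. restrict (g \<circ> ?i) V'"])
    show "(\<lambda>f. restrict (f \<circ> h) V) \<in> rooted_maps G V' (map_prod h h ` E) (map_prod h h ` Q) (h a) v \<rightarrow> rooted_maps G V E Q a v"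
    proof
      fix f assume f: "f \<in> rooted_maps G V' (map_prod h h ` E) (map_prod h h ` Q) (h a) v"
      have 1: "restrict (f \<circ> h) V \<in> V \<rightarrow>\<^sub>E pverts G" using f i(3) by (auto simp: rooted_maps_def)
      have 2: "restrict (f \<circ> h) V x = f (h x)" if "x \<in> V" for x using that by simp
      show "restrict (f \<circ> h) V \<in> rooted_maps G V E Q a v"
        unfolding rooted_maps_def
      proof (intro CollectI conjI 1)
        show "restrict (f \<circ> h) V a = v" using f a 2 by (simp add: rooted_maps_def)
        have "(restrict (f \<circ> h) V p, restrict (f \<circ> h) V q) \<in> parcs G" if "(p, q) \<in> E" for p q
        proof -
          have "(h p, h q) \<in> map_prod h h ` E" using that by force
          then have "(f (h p), f (h q)) \<in> parcs G" using f by (auto simp: rooted_maps_def)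
          then show ?thesis using 2[of p] 2[of q] that E by (auto simp del: restrict_apply)
        qed
        then show "\<forall>(x, y)\<in>E. (restrict (f \<circ> h) V x, restrict (f \<circ> h) V y) \<in> parcs G" by blast
        show "\<forall>(x, y)\<in>Q. restrict (f \<circ> h) V x \<noteq> restrict (f \<circ> h) V y"
        proof (clarify)
          fix p q assume pq: "(p, q) \<in> Q" "restrict (f \<circ> h) V p = restrict (f \<circ> h) V q"
          then have "(h p, h q) \<in> map_prod h h ` Q" by force
          then have "f (h p) \<noteq> f (h q)" using f by (auto simp: rooted_maps_def)
          then show False using pq Q 2 by auto
        qed
      qed
    qed
    show "(\<lambda>g. restrict (g \<circ> ?i) V') \<in> rooted_maps G V E Q a v \<rightarrow> rooted_maps G V' (map_prod h h ` E) (map_prod h h ` Q) (h a) v"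
    proof
      fix g assume g: "g \<in> rooted_maps G V E Q a v"
      have 1: "restrict (g \<circ> ?i) V' \<in> V' \<rightarrow>\<^sub>E pverts G" using g i(2) by (auto simp: rooted_maps_def)
      have 2: "restrict (g \<circ> ?i) V' (h x) = g x" if "x \<in> V" for x using that i by simp
      show "restrict (g \<circ> ?i) V' \<in> rooted_maps G V' (map_prod h h ` E) (map_prod h h ` Q) (h a) v"
        unfolding rooted_maps_def
      proof (intro CollectI conjI 1)
        show "restrict (g \<circ> ?i) V' (h a) = v" using g a 2 by (simp add: rooted_maps_def)
        have "(restrict (g \<circ> ?i) V' (h p), restrict (g \<circ> ?i) V' (h q)) \<in> parcs G" if "(p, q) \<in> E" for p q
        proof -
          have "p \<in> V" "q \<in> V" using that E by auto
          then show ?thesis using g that 2[of p] 2[of q] by (auto simp: rooted_maps_def simp del: restrict_apply)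
        qed
        then show "\<forall>(x, y)\<in>map_prod h h ` E. (restrict (g \<circ> ?i) V' x, restrict (g \<circ> ?i) V' y) \<in> parcs G" by (auto simp del: restrict_apply)
        have "restrict (g \<circ> ?i) V' (h p) \<noteq> restrict (g \<circ> ?i) V' (h q)" if "(p, q) \<in> Q" for p q
        proof -
          have "p \<in> V" "q \<in> V" using that Q by auto
          then show ?thesis using g that 2[of p] 2[of q] by (auto simp: rooted_maps_def simp del: restrict_apply)
        qed
        then show "\<forall>(x, y)\<in>map_prod h h ` Q. restrict (g \<circ> ?i) V' x \<noteq> restrict (g \<circ> ?i) V' y" by (auto simp del: restrict_apply)
      qed
    qed
  next
    fix f assume f: "f \<in> rooted_maps G V' (map_prod h h ` E) (map_prod h h ` Q) (h a) v"
    then have "f \<in> extensional V'" by (auto simp: rooted_maps_def PiE_def)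
    then show "restrict (restrict (f \<circ> h) V \<circ> ?i) V' = f"
      by (intro extensionalityI[of _ V']) (auto simp: i(2))
  next
    fix g assume g: "g \<in> rooted_maps G V E Q a v"
    then have "g \<in> extensional V" by (auto simp: rooted_maps_def PiE_def)
    then show "restrict (restrict (g \<circ> ?i) V' \<circ> h) V = g"
      by (intro extensionalityI[of _ V]) (auto simp: i)
  qed
  then show ?thesis unfolding rooted_count_def by (rule bij_betw_same_card[symmetric])
qed

text \<open>Deletion-contraction for disequalities: a map either separates \<open>x\<close> and
  \<open>y\<close> or factors through the quotient that merges \<open>y\<close> into
  \<open>x\<close>. The vertex merged away is not the root.\<close>

lemma rooted_count_contract:
  assumes fin: "finite V" "finite (pverts G)" and xy: "x \<in> V" "y \<in> V" "x \<noteq> y" and a: "a \<in> V" "y \<noteq> a"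
    and E: "E \<subseteq> V \<times> V" and Q: "Q \<subseteq> V \<times> V"
  defines "\<rho> \<equiv> id(y := x)"
  shows "rooted_count G V E Q a v = rooted_count G V E (insert (x, y) Q) a v +
     rooted_count G (V - {y}) (map_prod \<rho> \<rho> ` E) (map_prod \<rho> \<rho> ` Q) a v"
proof -
  let ?A = "{f \<in> rooted_maps G V E Q a v. f x = f y}"
  let ?V = "V - {y}"
  have \<rho>: "\<rho> z \<in> ?V" if "z \<in> V" for z using that xy by (simp add: \<rho>_def)
  have \<rho>id: "\<rho> z = z" if "z \<in> ?V" for z using that by (simp add: \<rho>_def)
  have eq: "rooted_maps G V E Q a v = rooted_maps G V E (insert (x, y) Q) a v \<union> ?A"
    by (auto simp: rooted_maps_def)
  have disj: "rooted_maps G V E (insert (x, y) Q) a v \<inter> ?A = {}" by (auto simp: rooted_maps_def)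
  have f: "finite ?A" "finite (rooted_maps G V E (insert (x, y) Q) a v)" using finite_rooted_maps[OF fin] by auto
  have "card (rooted_maps G V E Q a v) = card (rooted_maps G V E (insert (x, y) Q) a v) + card ?A"
    by (rule trans[OF arg_cong[OF eq, of card] card_Un_disjoint[OF f(2,1) disj]])
  moreover have "bij_betw (\<lambda>f. restrict f ?V) ?A (rooted_maps G ?V (map_prod \<rho> \<rho> ` E) (map_prod \<rho> \<rho> ` Q) a v)"
  proof (rule bij_betwI[where g = "\<lambda>g. restrict (g \<circ> \<rho>) V"])
    show "(\<lambda>f. restrict f ?V) \<in> ?A \<rightarrow> rooted_maps G ?V (map_prod \<rho> \<rho> ` E) (map_prod \<rho> \<rho> ` Q) a v"
    proof
      fix f assume f: "f \<in> ?A"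
      have 1: "restrict f ?V \<in> ?V \<rightarrow>\<^sub>E pverts G" using f by (auto simp: rooted_maps_def)
      have 2: "restrict f ?V (\<rho> z) = f z" if "z \<in> V" for z
      proof (cases "z = y")
        case True
        then show ?thesis using f xy by (simp add: \<rho>_def)
      next
        case False
        then show ?thesis using that by (simp add: \<rho>_def)
      qed
      show "restrict f ?V \<in> rooted_maps G ?V (map_prod \<rho> \<rho> ` E) (map_prod \<rho> \<rho> ` Q) a v"
        unfolding rooted_maps_def
      proof (intro CollectI conjI 1)
        show "restrict f ?V a = v" using f a by (simp add: rooted_maps_def)
        have "(restrict f ?V (\<rho> p), restrict f ?V (\<rho> q)) \<in> parcs G" if "(p, q) \<in> E" for p q
        proof -
          have "p \<in> V" "q \<in> V" using that E by auto
          then show ?thesis using f that 2[of p] 2[of q] by (auto simp: rooted_maps_def simp del: restrict_apply)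
        qed
        then show "\<forall>(x, y)\<in>map_prod \<rho> \<rho> ` E. (restrict f ?V x, restrict f ?V y) \<in> parcs G" by (auto simp del: restrict_apply)
        have "restrict f ?V (\<rho> p) \<noteq> restrict f ?V (\<rho> q)" if "(p, q) \<in> Q" for p q
        proof -
          have "p \<in> V" "q \<in> V" using that Q by auto
          then show ?thesis using f that 2[of p] 2[of q] by (auto simp: rooted_maps_def simp del: restrict_apply)
        qed
        then show "\<forall>(x, y)\<in>map_prod \<rho> \<rho> ` Q. restrict f ?V x \<noteq> restrict f ?V y" by (auto simp del: restrict_apply)
      qed
    qed
    show "(\<lambda>g. restrict (g \<circ> \<rho>) V) \<in> rooted_maps G ?V (map_prod \<rho> \<rho> ` E) (map_prod \<rho> \<rho> ` Q) a v \<rightarrow> ?A"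
    proof
      fix g assume g: "g \<in> rooted_maps G ?V (map_prod \<rho> \<rho> ` E) (map_prod \<rho> \<rho> ` Q) a v"
      have "g (\<rho> z) \<in> pverts G" if "z \<in> V" for z
        using g PiE_mem[OF _ \<rho>[OF that]] by (auto simp: rooted_maps_def)
      then have 1: "restrict (g \<circ> \<rho>) V \<in> V \<rightarrow>\<^sub>E pverts G" by auto
      have 2: "restrict (g \<circ> \<rho>) V z = g (\<rho> z)" if "z \<in> V" for z using that by simp
      have "restrict (g \<circ> \<rho>) V \<in> rooted_maps G V E Q a v"
        unfolding rooted_maps_def
      proof (intro CollectI conjI 1)
        show "restrict (g \<circ> \<rho>) V a = v" using g a \<rho>id[of a] by (simp add: rooted_maps_def)
        have "(restrict (g \<circ> \<rho>) V p, restrict (g \<circ> \<rho>) V q) \<in> parcs G" if "(p, q) \<in> E" for p q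
        proof -
          have "(\<rho> p, \<rho> q) \<in> map_prod \<rho> \<rho> ` E" using that by force
          then have "(g (\<rho> p), g (\<rho> q)) \<in> parcs G" using g by (auto simp: rooted_maps_def)
          then show ?thesis using 2[of p] 2[of q] that E by (auto simp del: restrict_apply)
        qed
        then show "\<forall>(x, y)\<in>E. (restrict (g \<circ> \<rho>) V x, restrict (g \<circ> \<rho>) V y) \<in> parcs G" by blast
        show "\<forall>(x, y)\<in>Q. restrict (g \<circ> \<rho>) V x \<noteq> restrict (g \<circ> \<rho>) V y"
        proof (clarify)
          fix p q assume pq: "(p, q) \<in> Q" "restrict (g \<circ> \<rho>) V p = restrict (g \<circ> \<rho>) V q"
          then have "(\<rho> p, \<rho> q) \<in> map_prod \<rho> \<rho> ` Q" by force
          then have "g (\<rho> p) \<noteq> g (\<rho> q)" using g by (auto simp: rooted_maps_def)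
          then show False using pq Q 2 by auto
        qed
      qed
      moreover have "restrict (g \<circ> \<rho>) V x = restrict (g \<circ> \<rho>) V y" using xy by (simp add: \<rho>_def)
      ultimately show "restrict (g \<circ> \<rho>) V \<in> ?A" by blast
    qed
  next
    fix f assume f: "f \<in> ?A"
    then have "f \<in> extensional V" by (auto simp: rooted_maps_def PiE_def)
    then show "restrict (restrict f ?V \<circ> \<rho>) V = f"
      using f xy by (intro extensionalityI[of _ V]) (auto simp: \<rho>_def)
  next
    fix g assume g: "g \<in> rooted_maps G ?V (map_prod \<rho> \<rho> ` E) (map_prod \<rho> \<rho> ` Q) a v"
    then have "g \<in> extensional ?V" by (auto simp: rooted_maps_def PiE_def)
    then show "restrict (restrict (g \<circ> \<rho>) V) ?V = g"
      by (intro extensionalityI[of _ ?V]) (auto simp: \<rho>_def)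
  qed
  then have "card ?A = card (rooted_maps G ?V (map_prod \<rho> \<rho> ` E) (map_prod \<rho> \<rho> ` Q) a v)"
    by (rule bij_betw_same_card)
  ultimately show ?thesis unfolding rooted_count_def by simp
qed

lemma embeddings_rooted:
  assumes "parcs H \<subseteq> pverts H \<times> pverts H"
  shows "{f \<in> embeddings H G. f a = v} =
    rooted_maps G (pverts H) (parcs H) {(x, y). x \<in> pverts H \<and> y \<in> pverts H \<and> x \<noteq> y} a v"
  using assms unfolding embeddings_def rooted_maps_def inj_on_def by (intro set_eqI) (auto; blast)

section \<open>Cost of the enumerations\<close>

text \<open>With two leaves, the innermost iterations are the wedges with centre \<open>x\<close>,
  including those that turn back.\<close>

definition star :: "nat \<Rightarrow> nat list \<Rightarrow> (nat \<times> level) list" where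
  "star x zs = (x, Rng 0) # map (\<lambda>z. (z, Fam 2 [x])) zs"

text \<open>With two tips, the innermost iterations are the diamonds with chord \<open>x\<close>,
  \<open>y\<close>, including those whose tips coincide.\<close>

definition fan :: "nat \<Rightarrow> nat \<Rightarrow> nat list \<Rightarrow> (nat \<times> level) list" where
  "fan x y zs = (x, Rng 0) # (y, Fam 2 [x]) # map (\<lambda>z. (z, Fam 4 [x, y])) zs"

lemma finite_fam: "good G \<Longrightarrow> finite (fam G h ks)"
  by (rule finite_subset[OF fam_sub finite_lessThan])

lemma good_pverts: "good G \<Longrightarrow> pverts G = {..<nV G}"
  by (simp add: good_def)

text \<open>Each list is read as an embedding of \<open>H\<close>, and a copy of \<open>H\<close> is
  the image of \<open>card (auts H)\<close> embeddings. The shift by one is due to patterns being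
  numbered from 1.\<close>

lemma card_lists_le:
  assumes "pverts H = {1..k}" "finite (pverts G)"
    and S: "\<And>t. t \<in> S \<Longrightarrow> length (F t) = k \<and> distinct (F t) \<and> set (F t) \<subseteq> pverts G \<and>
      (\<forall>(i, j)\<in>parcs H. (F t ! (i - 1), F t ! (j - 1)) \<in> parcs G)" and inj: "inj_on F S"
  shows "card S \<le> card (auts H) * num_copies H G"
proof -
  let ?e = "\<lambda>t. restrict (\<lambda>i. F t ! (i - 1)) {1..k}"
  have fin: "finite (pverts H)" using assms(1) by simp
  have "card S \<le> card (embeddings H G)"
  proof (rule card_inj_on_le[of ?e])
    show "inj_on ?e S"
    proof (rule inj_onI)
      fix t u assume tu: "t \<in> S" "u \<in> S" "?e t = ?e u"
      have "F t = F u"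
      proof (rule nth_equalityI)
        show "length (F t) = length (F u)" using S tu by simp
        fix i assume "i < length (F t)"
        then have "Suc i \<in> {1..k}" using S tu by simp
        then show "F t ! i = F u ! i" using fun_cong[OF tu(3), of "Suc i"] by simp
      qed
      then show "t = u" using inj tu by (simp add: inj_on_eq_iff)
    qed
    show "?e ` S \<subseteq> embeddings H G"
    proof
      fix f assume "f \<in> ?e ` S"
      then obtain t where t: "t \<in> S" "f = ?e t" by blast
      note St = S[OF t(1)]
      have "F t ! (i - 1) \<in> pverts G" if "i \<in> {1..k}" for i
      proof -
        have "i - 1 < length (F t)" using that St by auto
        then show ?thesis using St nth_mem by blast
      qed
      moreover have "inj_on f {1..k}"
      proof (rule inj_onI)
        fix i j assume ij: "i \<in> {1..k}" "j \<in> {1..k}" "f i = f j"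
        then have "i - 1 = j - 1" using St t(2) nth_eq_iff_index_eq[of "F t" "i - 1" "j - 1"] by auto
        then show "i = j" using ij by auto
      qed
      moreover have "(f a, f b) \<in> parcs G" if "a \<in> {1..k}" "b \<in> {1..k}" "(a, b) \<in> parcs H" for a b
        using St that t(2) by auto
      ultimately show "f \<in> embeddings H G" unfolding embeddings_def assms(1) using t(2) by auto
    qed
    show "finite (embeddings H G)" using finite_embeddings fin assms(2) by blast
  qed
  then show ?thesis using card_embeddings[OF fin assms(2)] by simp
qed

lemma onbr_asym: "onbr G u v \<Longrightarrow> \<not> onbr G v u"
  by (auto simp: orient_def deg_less_def)

lemma onbr_neq: "onbr G u v \<Longrightarrow> u \<noteq> v"
  by (auto simp: orient_def deg_less_def)

lemma pverts_orient: "pverts (orient G) = pverts G"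
  by (simp add: orient_def)

section \<open>Sizes of the iteration spaces\<close>

context
  fixes G assumes G: "good G"
begin

private abbreviation "N \<equiv> \<lambda>x. fam G 2 [x]"
private abbreviation "Out \<equiv> \<lambda>x. fam G 3 [x]"
private abbreviation "Tr \<equiv> \<lambda>x y. fam G 4 [x, y]"
private abbreviation "Qu \<equiv> \<lambda>x y z. fam G 5 [x, y, z]"
private abbreviation "V \<equiv> {..<nV G}"

text \<open>The tuples visited by the nests at their various depths. They need not have distinct
  entries; tuples with a coincidence are charged to a smaller space: \<open>S3\<close> to
  \<open>S2\<close>, \<open>T4\<close> to \<open>T3\<close>, \<open>Q5\<close> to \<open>Q4\<close>.
  This is where the edges enter the time bound.\<close>

private definition "S2 = (SIGMA x:V. N x)"
private definition "S3 = (SIGMA x:V. N x \<times> N x)"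
private definition "T3 = (SIGMA x:V. SIGMA y:N x. Tr x y)"
private definition "T4 = (SIGMA x:V. SIGMA y:N x. Tr x y \<times> Tr x y)"
private definition "P4 = (SIGMA k:V. SIGMA j:Out k. SIGMA l:Out k. Out j)"
private definition "Q4 = (SIGMA a:V. SIGMA b:Out a. SIGMA c:Tr a b. Qu a b c)"
private definition "Q5 = (SIGMA a:V. SIGMA b:Out a. SIGMA c:Tr a b. Qu a b c \<times> Qu a b c)"

private lemmas arcs = good_arc[OF G]
private lemmas fin = finite_fam[OF G]

private lemma finite_S: "finite S2" "finite S3" "finite T3" "finite T4" "finite P4" "finite Q4" "finite Q5"
  unfolding S2_def S3_def T3_def T4_def P4_def Q4_def Q5_def
  by (intro finite_SigmaI finite_lessThan fin)+

private lemma S2_le: "card S2 \<le> 2 * mE G"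
proof -
  have E: "edge_set G = (\<lambda>(u, v). {u, v}) ` S2"
    using arcs by (auto simp: edge_set_def S2_def image_iff)
  have finE: "finite (edge_set G)" unfolding E using finite_S by simp
  have "S2 \<subseteq> (\<Union>e\<in>edge_set G. {(u, v). {u, v} = e})" using E by auto
  moreover have f: "finite {(u, v). {u, v} = e} \<and> card {(u, v). {u, v} = e} \<le> 2" if he: "e \<in> edge_set G" for e
  proof -
    obtain a b where e: "e = {a, b}" using he by (auto simp: edge_set_def)
    have sub: "{(u, v). {u, v} = e} \<subseteq> {(a, b), (b, a)}" unfolding e by (auto simp: doubleton_eq_iff)
    have "card {(a, b), (b, a)} \<le> 2"
      using card_length[of "[(a, b), (b, a)]"] unfolding list.set list.size by (simp only: numeral_2_eq_2 add_0 add_Suc_right add_0_right)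
    moreover have "finite {(u, v). {u, v} = e}" by (rule finite_subset[OF sub]) simp
    moreover have "card {(u, v). {u, v} = e} \<le> card {(a, b), (b, a)}" by (rule card_mono[OF _ sub]) simp
    ultimately show ?thesis by (intro conjI) (assumption, rule order_trans)
  qed
  ultimately have "card S2 \<le> card (\<Union>e\<in>edge_set G. {(u, v). {u, v} = e})"
    using finE by (intro card_mono) auto
  also have "\<dots> \<le> (\<Sum>e\<in>edge_set G. card {(u, v). {u, v} = e})" by (rule card_UN_le[OF finE])
  also have "\<dots> \<le> (\<Sum>e\<in>edge_set G. 2)" using f by (intro sum_mono) blast
  finally show ?thesis by (simp add: mE_def)
qed

private lemma S3_le: "card S3 \<le> 2 * mE G + card (auts wedge) * num_copies wedge G"
proof -
  let ?A = "{t \<in> S3. fst (snd t) = snd (snd t)}" and ?B = "{t \<in> S3. fst (snd t) \<noteq> snd (snd t)}"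
  have "card ?A \<le> card S2"
    by (rule card_inj_on_le[of "\<lambda>(x, y, z). (x, y)", OF _ _ finite_S(1)]) (auto simp: S3_def S2_def inj_on_def finite_S)
  moreover have "card ?B \<le> card (auts wedge) * num_copies wedge G"
  \<comment> \<open>The centre of \<open>wedge\<close> is its vertex 2, so \<open>x\<close> comes
    second.\<close>
  proof (rule card_lists_le[where k = 3 and F = "\<lambda>(x, y, z). [y, x, z]"])
    show "pverts wedge = {1..3}" by (auto simp: wedge_def mk_symmetric_def)
    show "inj_on (\<lambda>(x, y, z). [y, x, z]) ?B" by (auto simp: inj_on_def)
    fix t assume "t \<in> ?B"
    then show "length ((\<lambda>(x, y, z). [y, x, z]) t) = 3 \<and> distinct ((\<lambda>(x, y, z). [y, x, z]) t) \<and>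
      set ((\<lambda>(x, y, z). [y, x, z]) t) \<subseteq> pverts G \<and>
      (\<forall>(i, j)\<in>parcs wedge. ((\<lambda>(x, y, z). [y, x, z]) t ! (i - 1), (\<lambda>(x, y, z). [y, x, z]) t ! (j - 1)) \<in> parcs G)"
      using arcs by (auto simp: S3_def wedge_def mk_symmetric_def good_pverts[OF G] numeral_2_eq_2 numeral_3_eq_3)
  qed (simp add: good_pverts[OF G])
  moreover have "card S3 = card ?A + card ?B"
    by (subst card_Un_disjoint[symmetric]) (auto simp: finite_S intro!: arg_cong[where f = card])
  ultimately show ?thesis using S2_le by simp
qed

private lemma T3_le: "card T3 \<le> card S3"
  by (rule card_inj_on_le[of "\<lambda>(x, y, z). (x, y, z)", OF _ _ finite_S(2)]) (auto simp: S3_def T3_def inj_on_def finite_S)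

private lemma T4_le: "card T4 \<le> card S3 + card (auts diamond) * num_copies diamond G"
proof -
  let ?A = "{t \<in> T4. fst (snd (snd t)) = snd (snd (snd t))}" and ?B = "{t \<in> T4. fst (snd (snd t)) \<noteq> snd (snd (snd t))}"
  have "card ?A \<le> card T3"
    by (rule card_inj_on_le[of "\<lambda>(x, y, z, w). (x, y, z)", OF _ _ finite_S(3)]) (auto simp: T4_def T3_def inj_on_def finite_S)
  moreover have "card ?B \<le> card (auts diamond) * num_copies diamond G"
  \<comment> \<open>The chord of \<open>diamond\<close> joins its vertices 1 and 3, so
    \<open>x\<close> and \<open>y\<close> take these places.\<close>
  proof (rule card_lists_le[where k = 4 and F = "\<lambda>(x, y, z, w). [x, z, y, w]"])
    show "pverts diamond = {1..4}" by (auto simp: diamond_def mk_symmetric_def)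
    show "inj_on (\<lambda>(x, y, z, w). [x, z, y, w]) ?B" by (auto simp: inj_on_def)
    fix t assume "t \<in> ?B"
    then obtain x y z w where t: "t = (x, y, z, w)" "nbr G x y" "nbr G x z" "nbr G x w" "nbr G y z" "nbr G y w" "z \<noteq> w"
      by (auto simp: T4_def)
    note sym = t(2-6)[THEN arcs(3)] t(2-6)[THEN arcs(4)] t(2-6)[THEN arcs(1)] t(2-6)[THEN arcs(2)]
    show "length ((\<lambda>(x, y, z, w). [x, z, y, w]) t) = 4 \<and> distinct ((\<lambda>(x, y, z, w). [x, z, y, w]) t) \<and>
      set ((\<lambda>(x, y, z, w). [x, z, y, w]) t) \<subseteq> pverts G \<and>
      (\<forall>(i, j)\<in>parcs diamond. ((\<lambda>(x, y, z, w). [x, z, y, w]) t ! (i - 1), (\<lambda>(x, y, z, w). [x, z, y, w]) t ! (j - 1)) \<in> parcs G)"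
      using t sym by (auto simp: diamond_def mk_symmetric_def good_pverts[OF G])
  qed (simp add: good_pverts[OF G])
  moreover have "card T4 = card ?A + card ?B"
    by (subst card_Un_disjoint[symmetric]) (auto simp: finite_S intro!: arg_cong[where f = card])
  ultimately show ?thesis using T3_le by simp
qed

text \<open>The vertex \<open>l\<close> may coincide with \<open>j\<close> or with \<open>i\<close>;
  what is left then is a wedge with centre \<open>j\<close>. The coincidence of \<open>i\<close> and
  \<open>k\<close> is ruled out by the orientation.\<close>

private lemma P4_le: "card P4 \<le> 2 * card S3 + card (auts directed_3path) * num_copies directed_3path (orient G)"
proof -
  let ?A = "{t \<in> P4. fst (snd (snd t)) = fst (snd t)}"
  let ?B = "{t \<in> P4. fst (snd (snd t)) = snd (snd (snd t))}"
  let ?C = "{t \<in> P4. fst (snd (snd t)) \<noteq> fst (snd t) \<and> fst (snd (snd t)) \<noteq> snd (snd (snd t))}"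
  have img: "(\<lambda>(k, j, l, i). (j, k, i)) ` P4 \<subseteq> S3"
  proof (clarify)
    fix k j l i assume "(k, j, l, i) \<in> P4"
    then have "onbr G k j" "onbr G j i" by (simp_all add: P4_def)
    then have "nbr G k j" "nbr G j i" by (simp_all add: oarc_arc)
    then show "(j, k, i) \<in> S3" using arcs(2,3)[of k j] by (simp add: S3_def)
  qed
  have "card ?A \<le> card S3"
    by (rule card_inj_on_le[of "\<lambda>(k, j, l, i). (j, k, i)", OF _ _ finite_S(2)]) (use img in \<open>auto simp: inj_on_def\<close>)
  moreover have "card ?B \<le> card S3"
    by (rule card_inj_on_le[of "\<lambda>(k, j, l, i). (j, k, i)", OF _ _ finite_S(2)]) (use img in \<open>auto simp: inj_on_def\<close>)
  moreover have "card ?C \<le> card (auts directed_3path) * num_copies directed_3path (orient G)"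
  proof (rule card_lists_le[where k = 4 and F = "\<lambda>(k, j, l, i). [i, j, k, l]"])
    show "pverts directed_3path = {1..4}" by (auto simp: directed_3path_def)
    show "inj_on (\<lambda>(k, j, l, i). [i, j, k, l]) ?C" by (auto simp: inj_on_def)
    fix t assume "t \<in> ?C"
    then obtain k j l i where t: "t = (k, j, l, i)" "onbr G k j" "onbr G k l" "onbr G j i" "l \<noteq> j" "l \<noteq> i"
      by (auto simp: P4_def)
    note ne = t(2-4)[THEN onbr_neq] t(2-4)[THEN oarc_arc, THEN arcs(1)] t(2-4)[THEN oarc_arc, THEN arcs(2)]
    have "i \<noteq> k" using onbr_asym t by blast
    then show "length ((\<lambda>(k, j, l, i). [i, j, k, l]) t) = 4 \<and> distinct ((\<lambda>(k, j, l, i). [i, j, k, l]) t) \<and>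
      set ((\<lambda>(k, j, l, i). [i, j, k, l]) t) \<subseteq> pverts (orient G) \<and>
      (\<forall>(i, j)\<in>parcs directed_3path. ((\<lambda>(k, j, l, i). [i, j, k, l]) t ! (i - 1), (\<lambda>(k, j, l, i). [i, j, k, l]) t ! (j - 1)) \<in> parcs (orient G))"
      using t ne by (auto simp: directed_3path_def good_pverts[OF G] pverts_orient)
  qed (simp add: good_pverts[OF G] pverts_orient)
  moreover have "card P4 \<le> card ?A + card ?B + card ?C"
  proof -
    have "P4 = ?A \<union> ?B \<union> ?C" by auto
    then have "card P4 = card (?A \<union> ?B \<union> ?C)" by (rule arg_cong)
    also have "\<dots> \<le> card ?A + card ?B + card ?C"
      by (rule order_trans[OF card_Un_le add_right_mono[OF card_Un_le]])
    finally show ?thesis .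
  qed
  ultimately show ?thesis by simp
qed

private lemma Q4_le: "card Q4 \<le> card T4"
  by (rule card_inj_on_le[of "\<lambda>(a, b, c, d). (a, b, c, d)", OF _ _ finite_S(4)])
    (auto simp: Q4_def T4_def inj_on_def finite_S dest: oarc_arc)

private lemma Q5_le: "card Q5 \<le> card T4 + card (auts directed_bipyramid) * num_copies directed_bipyramid (orient G)"
proof -
  let ?A = "{t \<in> Q5. fst (snd (snd (snd t))) = snd (snd (snd (snd t)))}"
  let ?B = "{t \<in> Q5. fst (snd (snd (snd t))) \<noteq> snd (snd (snd (snd t)))}"
  have "card ?A \<le> card Q4"
    by (rule card_inj_on_le[of "\<lambda>(a, b, c, d, e). (a, b, c, d)", OF _ _ finite_S(6)]) (auto simp: Q4_def Q5_def inj_on_def finite_S)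
  moreover have "card ?B \<le> card (auts directed_bipyramid) * num_copies directed_bipyramid (orient G)"
  \<comment> \<open>In \<open>directed_bipyramid\<close> the directed triangle is 1, 3, 2 in this
    order, and 4 and 5 are the apexes.\<close>
  proof (rule card_lists_le[where k = 5 and F = "\<lambda>(a, b, c, d, e). [a, c, b, d, e]"])
    show "pverts directed_bipyramid = {1..5}" by (auto simp: directed_bipyramid_def)
    show "inj_on (\<lambda>(a, b, c, d, e). [a, c, b, d, e]) ?B" by (auto simp: inj_on_def)
    fix t assume "t \<in> ?B"
    then obtain a b c d e where t: "t = (a, b, c, d, e)" "onbr G a b" "onbr G b c" "onbr G a c"
      "onbr G a d" "onbr G b d" "onbr G c d" "onbr G a e" "onbr G b e" "onbr G c e" "d \<noteq> e"
      by (auto simp: Q5_def)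
    note ne = t(2-10)[THEN onbr_neq] t(2-10)[THEN oarc_arc, THEN arcs(1)] t(2-10)[THEN oarc_arc, THEN arcs(2)]
    show "length ((\<lambda>(a, b, c, d, e). [a, c, b, d, e]) t) = 5 \<and> distinct ((\<lambda>(a, b, c, d, e). [a, c, b, d, e]) t) \<and>
      set ((\<lambda>(a, b, c, d, e). [a, c, b, d, e]) t) \<subseteq> pverts (orient G) \<and>
      (\<forall>(i, j)\<in>parcs directed_bipyramid. ((\<lambda>(a, b, c, d, e). [a, c, b, d, e]) t ! (i - 1), (\<lambda>(a, b, c, d, e). [a, c, b, d, e]) t ! (j - 1)) \<in> parcs (orient G))"
      using t ne by (auto simp: directed_bipyramid_def good_pverts[OF G] pverts_orient)
  qed (simp add: good_pverts[OF G] pverts_orient)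
  moreover have "card Q5 = card ?A + card ?B"
    by (subst card_Un_disjoint[symmetric]) (auto simp: finite_S intro!: arg_cong[where f = card])
  ultimately show ?thesis using Q4_le by simp
qed

text \<open>The factor 40 is slack. After expanding all bounds in \<open>le_budget\<close>, the
  terms without automorphism numbers amount to 10 + 2 n + 20 m, which is at most 32 times the
  budget; each automorphism number occurs with a coefficient of at most 8.\<close>

definition big :: nat where
  "big = 40 * (1 + card (auts wedge) + card (auts diamond) + card (auts directed_3path) + card (auts directed_bipyramid))"

private lemma le_budget:
  "10 + 2 * nV G + 4 * mE G + 3 * card S3 + 2 * card T4 + card P4 + card Q5 \<le> big * budget G"
proof -
  let ?w = "card (auts wedge)" and ?d = "card (auts diamond)" and ?p = "card (auts directed_3path)" and ?b = "card (auts directed_bipyramid)"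
  have m: "num_copies wedge G \<le> budget G" "num_copies diamond G \<le> budget G" "num_copies directed_3path (orient G) \<le> budget G"
    "num_copies directed_bipyramid (orient G) \<le> budget G" "mE G \<le> budget G" "nV G \<le> budget G" "1 \<le> budget G"
    by (simp_all add: budget_def mE_def)
  have "?w * num_copies wedge G \<le> ?w * budget G" "?d * num_copies diamond G \<le> ?d * budget G"
    "?p * num_copies directed_3path (orient G) \<le> ?p * budget G"
    "?b * num_copies directed_bipyramid (orient G) \<le> ?b * budget G" using m by simp_all
  moreover have "big * budget G = 40 * budget G + 40 * (?w * budget G) + 40 * (?d * budget G) + 40 * (?p * budget G) + 40 * (?b * budget G)"
    by (simp add: big_def algebra_simps)
  ultimately show ?thesis using S3_le T4_le P4_le Q5_le m(5,6,7)
    by linarith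
qed

private lemma card_S:
  "card S2 = (\<Sum>x\<in>V. card (N x))" "card S3 = (\<Sum>x\<in>V. card (N x) * card (N x))"
  "card T3 = (\<Sum>x\<in>V. \<Sum>y\<in>N x. card (Tr x y))"
  "card T4 = (\<Sum>x\<in>V. \<Sum>y\<in>N x. card (Tr x y) * card (Tr x y))"
  "card P4 = (\<Sum>k\<in>V. \<Sum>j\<in>Out k. \<Sum>l\<in>Out k. card (Out j))"
  "card Q4 = (\<Sum>a\<in>V. \<Sum>b\<in>Out a. \<Sum>c\<in>Tr a b. card (Qu a b c))"
  "card Q5 = (\<Sum>a\<in>V. \<Sum>b\<in>Out a. \<Sum>c\<in>Tr a b. card (Qu a b c) * card (Qu a b c))"
  unfolding S2_def S3_def T3_def T4_def P4_def Q4_def Q5_def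
  by (simp_all add: card_cartesian_product fin finite_SigmaI del: fam.simps)

private lemma Out_N: "Out x \<subseteq> N x"
  using oarc_arc by auto

private lemma sub_sums:
  "(\<Sum>x\<in>V. card (Out x)) \<le> card S2" "(\<Sum>x\<in>V. card (Out x) * card (Out x)) \<le> card S3"
  "(\<Sum>a\<in>V. \<Sum>b\<in>Out a. card (Tr a b)) \<le> card T3"
  unfolding card_S
  by (intro sum_mono sum_mono2 mult_mono card_mono fin Out_N; simp del: fam.simps)+

private lemma budgets:
  "1 + nV G + card S2 + card S3 \<le> big * budget G" "1 + nV G + card S2 + card T3 + card T4 \<le> big * budget G"
  "1 + nV G + card S2 + card S3 + card P4 \<le> big * budget G"
  "1 + nV G + card S2 + card T3 + card Q4 + card Q5 \<le> big * budget G"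
  using le_budget S2_le T3_le Q4_le by linarith+

lemma star_steps:
  assumes "distinct (x # zs)" "length zs \<le> 2"
  shows "nsteps (rs G) (fam G) (star x zs) \<phi> \<le> big * budget G"
proof -
  consider "zs = []" | y where "zs = [y]" | y z where "zs = [y, z]"
    using assms(2) by (cases zs rule: list.exhaust[case_product list.exhaust]; cases "tl zs"; cases "tl (tl zs)") auto
  then show ?thesis
  proof cases
    case 1
    then show ?thesis using budgets(1) by (simp add: star_def rs_def del: fam.simps)
  next
    case 2
    then have "nsteps (rs G) (fam G) (star x zs) \<phi> = 1 + nV G + card S2"
      using assms(1) by (simp add: star_def rs_def sum_Suc card_S sum.distrib del: fam.simps)
    then show ?thesis using budgets(1) by simp
  next
    case 3
    then have "nsteps (rs G) (fam G) (star x zs) \<phi> = 1 + nV G + card S2 + card S3"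
      using assms(1) by (simp add: star_def rs_def sum_Suc card_S sum.distrib del: fam.simps)
    then show ?thesis using budgets(1) by simp
  qed
qed

lemma fan_steps:
  assumes "distinct (x # y # zs)" "length zs \<le> 2"
  shows "nsteps (rs G) (fam G) (fan x y zs) \<phi> \<le> big * budget G"
proof -
  consider "zs = []" | z where "zs = [z]" | z w where "zs = [z, w]"
    using assms(2) by (cases zs rule: list.exhaust[case_product list.exhaust]; cases "tl zs"; cases "tl (tl zs)") auto
  then show ?thesis
  proof cases
    case 1
    then have "nsteps (rs G) (fam G) (fan x y zs) \<phi> = 1 + nV G + card S2"
      using assms(1) by (simp add: fan_def rs_def sum_Suc card_S sum.distrib del: fam.simps)
    then show ?thesis using budgets(1) by simp
  next
    case 2
    then have "nsteps (rs G) (fam G) (fan x y zs) \<phi> = 1 + nV G + card S2 + card T3"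
      using assms(1) by (simp add: fan_def rs_def sum_Suc card_S sum.distrib del: fam.simps)
    then show ?thesis using budgets(2) by simp
  next
    case 3
    then have "nsteps (rs G) (fam G) (fan x y zs) \<phi> = 1 + nV G + card S2 + card T3 + card T4"
      using assms(1) by (simp add: fan_def rs_def sum_Suc card_S sum.distrib del: fam.simps)
    then show ?thesis using budgets(2) by simp
  qed
qed

private lemma Out_Tr_sum:
  "(\<Sum>a\<in>V. \<Sum>b\<in>Out a. card (Tr a b) * card (Tr a b)) \<le> card T4"
  unfolding card_S
  by (intro sum_mono sum_mono2 fin Out_N; simp del: fam.simps)+

text \<open>The enumeration that finds the directed 4-cliques: pairs of triangles on a common arc
  are diamonds, up to coincidence of the tips.\<close>

lemma triangle_pair_steps:
  assumes "distinct [a, b, c, d]"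
  shows "nsteps (rs G) (fam G) [(a, Rng 0), (b, Fam 3 [a]), (c, Fam 4 [a, b]), (d, Fam 4 [a, b])] \<phi> \<le> big * budget G"
proof -
  have "nsteps (rs G) (fam G) [(a, Rng 0), (b, Fam 3 [a]), (c, Fam 4 [a, b]), (d, Fam 4 [a, b])] \<phi> =
    1 + nV G + (\<Sum>x\<in>V. card (Out x)) + (\<Sum>a\<in>V. \<Sum>b\<in>Out a. card (Tr a b)) +
    (\<Sum>a\<in>V. \<Sum>b\<in>Out a. card (Tr a b) * card (Tr a b))"
    using assms by (simp add: rs_def sum_Suc sum.distrib del: fam.simps)
  then show ?thesis using budgets(2) sub_sums Out_Tr_sum by linarith
qed

lemma dpath_steps:
  assumes "distinct [i, j, k, l]"
  shows "nsteps (rs G) (fam G) [(k, Rng 0), (j, Fam 3 [k]), (l, Fam 3 [k]), (i, Fam 3 [j])] \<phi> \<le> big * budget G"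
proof -
  have "nsteps (rs G) (fam G) [(k, Rng 0), (j, Fam 3 [k]), (l, Fam 3 [k]), (i, Fam 3 [j])] \<phi> =
    1 + nV G + (\<Sum>x\<in>V. card (Out x)) + (\<Sum>x\<in>V. card (Out x) * card (Out x)) + card P4"
    using assms by (simp add: rs_def sum_Suc card_S sum.distrib del: fam.simps)
  then show ?thesis using budgets(3) sub_sums by linarith
qed

text \<open>The variable \<open>c\<close> runs through all triangles on the arc, whatever their
  orientation. Those that are not directed as \<open>a\<close>, \<open>b\<close>, \<open>c\<close>
  have an empty family of apexes, so they cost no more than \<open>T3\<close>.\<close>

lemma dbipyramid_steps:
  assumes "distinct [a, b, c, d, e]"
  shows "nsteps (rs G) (fam G) [(a, Rng 0), (b, Fam 3 [a]), (c, Fam 4 [a, b]), (d, Fam 5 [a, b, c]), (e, Fam 5 [a, b, c])] \<phi> \<le> big * budget G"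
proof -
  have "nsteps (rs G) (fam G) [(a, Rng 0), (b, Fam 3 [a]), (c, Fam 4 [a, b]), (d, Fam 5 [a, b, c]), (e, Fam 5 [a, b, c])] \<phi> =
    1 + nV G + (\<Sum>x\<in>V. card (Out x)) + (\<Sum>a\<in>V. \<Sum>b\<in>Out a. card (Tr a b)) + card Q4 + card Q5"
    using assms by (simp add: rs_def sum_Suc card_S sum.distrib del: fam.simps)
  then show ?thesis using budgets(4) sub_sums by linarith
qed

end

section \<open>Loop nests that meet the budget\<close>

lemma cheapI:
  assumes "wf_levels ls" "levels_in {2..5} ls" "\<forall>(x, l)\<in>set ls. l \<noteq> Rng 1" "closed_levels {} ls"
    "\<And>G \<phi>. good G \<Longrightarrow> nsteps (rs G) (fam G) ls \<phi> \<le> big * budget G"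
  shows "cheap ls"
  unfolding cheap_def by (intro conjI exI[of _ big] allI impI assms(1-4)) (rule assms(5))

lemma cheap_star:
  assumes "distinct (x # zs)" "length zs \<le> 2" shows "cheap (star x zs)"
proof (rule cheapI)
  have "wf_levels (map (\<lambda>z. (z, Fam 2 [x])) zs)" using assms(1)
    by (induction zs) (auto simp: image_image)
  then show "wf_levels (star x zs)" using assms(1) by (auto simp: star_def image_image)
  have "closed_levels X (map (\<lambda>z. (z, Fam 2 [x])) zs)" if "x \<in> X" for X using that
    by (induction zs arbitrary: X) auto
  then show "closed_levels {} (star x zs)" by (simp add: star_def)
qed (use star_steps[OF _ assms] in \<open>auto simp: star_def\<close>)

lemma cheap_fan:
  assumes "distinct (x # y # zs)" "length zs \<le> 2" shows "cheap (fan x y zs)"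
proof (rule cheapI)
  have "wf_levels (map (\<lambda>z. (z, Fam 4 [x, y])) zs)" using assms(1)
    by (induction zs) (auto simp: image_image)
  then show "wf_levels (fan x y zs)" using assms(1) by (auto simp: fan_def image_image)
  have "closed_levels X (map (\<lambda>z. (z, Fam 4 [x, y])) zs)" if "x \<in> X" "y \<in> X" for X using that
    by (induction zs arbitrary: X) auto
  then show "closed_levels {} (fan x y zs)" by (simp add: fan_def)
qed (use fan_steps[OF _ assms] in \<open>auto simp: fan_def\<close>)

lemma cheap_dpath:
  assumes "distinct [i, j, k, l]"
  shows "cheap [(k, Rng 0), (j, Fam 3 [k]), (l, Fam 3 [k]), (i, Fam 3 [j])]"
  by (rule cheapI) (use assms dpath_steps[OF _ assms] in auto)

lemma cheap_dbipyramid: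
  assumes "distinct [a, b, c, d, e]"
  shows "cheap [(a, Rng 0), (b, Fam 3 [a]), (c, Fam 4 [a, b]), (d, Fam 5 [a, b, c]), (e, Fam 5 [a, b, c])]"
  by (rule cheapI) (use assms dbipyramid_steps[OF _ assms] in auto)

lemma computable_cong:
  assumes "computable w" and eq: "\<And>G \<phi>. good G \<Longrightarrow> w G \<phi> = w' G \<phi>"
  shows "computable w'"
proof -
  have "bounded_fn w = bounded_fn w'" unfolding bounded_fn_def using eq by (intro ext) (metis (no_types, lifting))
  moreover have "evaluates G B T N e w = evaluates G B T N e w'" if "good G" for G B T N e
    unfolding evaluates_def using eq[OF that] by simp
  ultimately have c: "computes N P N' e c k w \<Longrightarrow> computes N P N' e c k w'" for N P N' e c k
    unfolding computes_def by simp
  show ?thesis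
    unfolding computable_def
  proof (intro allI impI)
    fix N :: nat assume "6 \<le> N"
    then obtain P N' e k' k where "computes N P N' e k' k w" using assms(1) unfolding computable_def by blast
    then show "\<exists>P N' e c k. computes N P N' e c k w'" using c by blast
  qed
qed

lemma lset_finite: "good G \<Longrightarrow> finite (lset (rs G) (fam G) l \<phi>)"
  by (rule finite_subset[OF lset_Mx finite_lessThan])

section \<open>Sums over the values of a set of variables\<close>

definition asg :: "nat \<Rightarrow> nat set \<Rightarrow> (nat \<Rightarrow> nat) \<Rightarrow> (nat \<Rightarrow> nat) set" where
  "asg n X \<phi> = {\<psi>. (\<forall>x\<in>X. \<psi> x < n) \<and> (\<forall>x. x \<notin> X \<longrightarrow> \<psi> x = \<phi> x)}"

lemma asg_empty [simp]: "asg n {} \<phi> = {\<phi>}"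
  by (rule set_eqI) (simp add: asg_def fun_eq_iff)

lemma finite_asg: "finite X \<Longrightarrow> finite (asg n X \<phi>)"
proof -
  assume X: "finite X"
  have "asg n X \<phi> \<subseteq> (\<lambda>f x. if x \<in> X then f x else \<phi> x) ` (X \<rightarrow>\<^sub>E {..<n})"
  proof
    fix \<psi> assume "\<psi> \<in> asg n X \<phi>"
    then have "\<psi> = (\<lambda>x. if x \<in> X then restrict \<psi> X x else \<phi> x)" "restrict \<psi> X \<in> X \<rightarrow>\<^sub>E {..<n}"
      by (auto simp: asg_def)
    then show "\<psi> \<in> (\<lambda>f x. if x \<in> X then f x else \<phi> x) ` (X \<rightarrow>\<^sub>E {..<n})" by blast
  qed
  then show ?thesis using X by (meson finite_PiE finite_imageI finite_lessThan finite_subset)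
qed

lemma sum_asg_insert:
  assumes "u \<notin> X" "finite X"
  shows "sum g (asg n (insert u X) \<phi>) = (\<Sum>\<psi>\<in>asg n X \<phi>. sum g (asg n {u} \<psi>))"
proof -
  have "asg n (insert u X) \<phi> = (\<Union>\<psi>\<in>asg n X \<phi>. asg n {u} \<psi>)"
  proof (intro equalityI subsetI)
    fix \<chi> assume a: "\<chi> \<in> asg n (insert u X) \<phi>"
    have "\<chi>(u := \<phi> u) \<in> asg n X \<phi>" "\<chi> \<in> asg n {u} (\<chi>(u := \<phi> u))"
      using a assms by (auto simp: asg_def)
    then show "\<chi> \<in> (\<Union>\<psi>\<in>asg n X \<phi>. asg n {u} \<psi>)" by blast
  qed (use assms in \<open>auto simp: asg_def\<close>)
  moreover have "asg n {u} \<psi> \<inter> asg n {u} \<psi>' = {}" if "\<psi> \<in> asg n X \<phi>" "\<psi>' \<in> asg n X \<phi>" "\<psi> \<noteq> \<psi>'" for \<psi> \<psi>'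
  proof (rule ccontr)
    assume "asg n {u} \<psi> \<inter> asg n {u} \<psi>' \<noteq> {}"
    then obtain \<chi> where "\<chi> \<in> asg n {u} \<psi>" "\<chi> \<in> asg n {u} \<psi>'" by blast
    then have "\<psi> x = \<psi>' x" for x using that assms by (cases "x = u") (auto simp: asg_def)
    then show False using that by blast
  qed
  ultimately show ?thesis using assms
    by (simp add: sum.UNION_disjoint finite_asg)
qed

lemma sum_asg_Un:
  assumes "finite X" "finite Y" "X \<inter> Y = {}"
  shows "sum g (asg n (X \<union> Y) \<phi>) = (\<Sum>\<psi>\<in>asg n X \<phi>. sum g (asg n Y \<psi>))"
  using assms(2,3)
proof (induction Y arbitrary: g rule: finite_induct)
  case (insert u Y)
  have "sum g (asg n (X \<union> insert u Y) \<phi>) = (\<Sum>\<psi>\<in>asg n (X \<union> Y) \<phi>. sum g (asg n {u} \<psi>))"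
    using insert assms(1) sum_asg_insert[of u "X \<union> Y" g n \<phi>] by simp
  also have "\<dots> = (\<Sum>\<psi>\<in>asg n X \<phi>. \<Sum>\<chi>\<in>asg n Y \<psi>. sum g (asg n {u} \<chi>))" using insert by simp
  also have "\<dots> = (\<Sum>\<psi>\<in>asg n X \<phi>. sum g (asg n (insert u Y) \<psi>))"
    by (intro sum.cong refl sum_asg_insert[symmetric] insert.hyps)
  finally show ?case .
qed simp

lemma sum_asg_cong:
  assumes dep: "\<And>\<phi> \<psi>. \<forall>x\<in>V. \<phi> x = \<psi> x \<Longrightarrow> w \<phi> = w \<psi>" and eq: "\<forall>x\<in>V - X. \<phi> x = \<psi> x"
  shows "sum w (asg n X \<phi>) = sum w (asg n X \<psi>)"
proof (rule sum.reindex_bij_witness[where i = "\<lambda>\<chi> x. if x \<in> X then \<chi> x else \<phi> x" and j = "\<lambda>\<chi> x. if x \<in> X then \<chi> x else \<psi> x"])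
  fix \<chi> assume "\<chi> \<in> asg n X \<phi>"
  then have c: "\<And>x. x \<in> X \<Longrightarrow> \<chi> x < n" "\<And>x. x \<notin> X \<Longrightarrow> \<chi> x = \<phi> x" by (auto simp: asg_def)
  show "(\<lambda>x. if x \<in> X then if x \<in> X then \<chi> x else \<psi> x else \<phi> x) = \<chi>" using c(2) by (simp add: fun_eq_iff)
  show "(\<lambda>x. if x \<in> X then \<chi> x else \<psi> x) \<in> asg n X \<psi>" using c(1) by (simp add: asg_def)
  show "w (\<lambda>x. if x \<in> X then \<chi> x else \<psi> x) = w \<chi>"
  proof (rule dep, intro ballI)
    fix x assume "x \<in> V"
    then show "(if x \<in> X then \<chi> x else \<psi> x) = \<chi> x" using eq c(2)[of x] by simp
  qed
next
  fix \<chi> assume "\<chi> \<in> asg n X \<psi>"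
  then have c: "\<And>x. x \<in> X \<Longrightarrow> \<chi> x < n" "\<And>x. x \<notin> X \<Longrightarrow> \<chi> x = \<psi> x" by (auto simp: asg_def)
  show "(\<lambda>x. if x \<in> X then if x \<in> X then \<chi> x else \<phi> x else \<psi> x) = \<chi>" using c(2) by (simp add: fun_eq_iff)
  show "(\<lambda>x. if x \<in> X then \<chi> x else \<phi> x) \<in> asg n X \<phi>" using c(1) by (simp add: asg_def)
qed

abbreviation rel :: "nat pair_pre_digraph \<Rightarrow> (nat \<times> level) list \<Rightarrow> (nat \<Rightarrow> nat) \<Rightarrow> bool" where
  "rel G ls \<psi> \<equiv> \<forall>(x, l)\<in>set ls. \<psi> x \<in> lset (rs G) (fam G) l \<psi>"

lemma rel_cong:
  assumes "closed_levels X ls" "\<forall>x\<in>X \<union> vars ls. \<phi> x = \<psi> x"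
  shows "rel G ls \<phi> = rel G ls \<psi>"
  using assms
proof (induction ls arbitrary: X)
  case (Cons xl ls)
  obtain x l where xl: "xl = (x, l)" by force
  have "rel G ls \<phi> = rel G ls \<psi>" using Cons xl by (intro Cons.IH[of "insert x X"]) auto
  moreover have "lset (rs G) (fam G) l \<phi> = lset (rs G) (fam G) l \<psi>"
    using Cons.prems xl by (intro lset_cong) (auto split: level.splits)
  moreover have "\<phi> x = \<psi> x" using Cons.prems xl by simp
  ultimately show ?case using xl by simp
qed simp

text \<open>Summing out the variables \<open>X\<close>: the result is tabulated under the values of the other ones.\<close>

theorem computable_elim:
  assumes w: "computable w" and dep: "\<And>G \<phi> \<psi>. \<forall>x\<in>vars ls. \<phi> x = \<psi> x \<Longrightarrow> w G \<phi> = w G \<psi>"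
    and ls: "cheap ls" and X: "X \<subseteq> vars ls"
    and supp: "\<And>G \<phi>. good G \<Longrightarrow> w G \<phi> \<noteq> 0 \<Longrightarrow> rel G ls \<phi>"
  shows "computable (\<lambda>G \<phi>. \<Sum>\<psi>\<in>asg (nV G) X \<phi>. w G \<psi>)"
proof -
  have finV: "finite (vars ls)" by (simp add: vars_def)
  define ks where "ks = sorted_list_of_set (vars ls - X)"
  have ks: "set ks = vars ls - X" using finV by (simp add: ks_def)
  have wf: "wf_levels ls" "closed_levels {} ls" "\<forall>(x, l)\<in>set ls. l \<noteq> Rng 1" using ls by (auto simp: cheap_def)
  have finX: "finite X" using X finV finite_subset by blast
  show ?thesis
  proof (rule computable_cong[OF computable_nsum[OF w dep ls, of ks ks]])
    show "set ks \<subseteq> vars ls" using ks by simp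
    fix G \<phi> assume G: "good G"
    have rng: "\<psi> x < nV G" if r: "rel G ls \<psi>" and v: "x \<in> vars ls" for \<psi> x
    proof -
      obtain l where l: "(x, l) \<in> set ls" using v unfolding vars_def by force
      then have "\<psi> x \<in> lset (rs G) (fam G) l \<psi>" "l \<noteq> Rng 1" using r wf by auto
      moreover have "case l of Rng q \<Rightarrow> q < 2 | _ \<Rightarrow> True" using l wf(1)
        by (induction ls) (auto split: level.splits)
      ultimately show ?thesis using fam_sub[OF G]
        by (cases l) (auto simp: rs_def less_Suc_eq numeral_2_eq_2)
    qed
    let ?A = "{\<psi>' \<in> asgs (rs G) (fam G) ls (\<lambda>_. 0). map \<psi>' ks = map \<phi> ks}"
    let ?B = "{\<psi> \<in> asg (nV G) X \<phi>. rel G ls \<psi>}"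
    have "nsum (rs G) (fam G) ls (\<lambda>\<psi>. if map \<psi> ks = map \<phi> ks then w G \<psi> else 0) (\<lambda>_. 0) =
      (\<Sum>\<psi>\<in>asgs (rs G) (fam G) ls (\<lambda>_. 0). if map \<psi> ks = map \<phi> ks then w G \<psi> else 0)"
      by (rule nsum_asgs[OF wf(1) lset_finite[OF G]])
    also have "\<dots> = (\<Sum>\<psi>\<in>?A. w G \<psi>)"
      by (rule sum.inter_filter[symmetric], rule finite_asgs[OF wf(1) lset_finite[OF G]])
    also have "\<dots> = (\<Sum>\<psi>\<in>?B. w G \<psi>)"
    \<comment> \<open>The two sums differ in the values off the nest, which are 0 on one side and
      those of \<phi> on the other. Neither \<open>w\<close> nor the constraints of the closed nest
      see them.\<close>
    proof (rule sum.reindex_bij_witness[where i = "\<lambda>\<psi> x. if x \<in> vars ls then \<psi> x else 0"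
          and j = "\<lambda>\<psi>' x. if x \<in> vars ls then \<psi>' x else \<phi> x"])
      fix \<psi>' assume a: "\<psi>' \<in> ?A"
      let ?\<psi> = "\<lambda>x. if x \<in> vars ls then \<psi>' x else \<phi> x"
      have r: "rel G ls \<psi>'" and o: "\<And>x. x \<notin> vars ls \<Longrightarrow> \<psi>' x = 0" and k: "\<And>x. x \<in> set ks \<Longrightarrow> \<psi>' x = \<phi> x"
        using a by (auto simp: asgs_def)
      show "(\<lambda>x. if x \<in> vars ls then ?\<psi> x else 0) = \<psi>'" using o by auto
      have "rel G ls ?\<psi> = rel G ls \<psi>'" by (rule rel_cong[OF wf(2)]) simp
      moreover have "?\<psi> \<in> asg (nV G) X \<phi>"
        unfolding asg_def using rng[OF r] X k ks by auto
      ultimately show "?\<psi> \<in> ?B" using r by simp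
      show "w G ?\<psi> = w G \<psi>'" by (rule dep) simp
    next
      fix \<psi> assume a: "\<psi> \<in> ?B"
      let ?\<psi>' = "\<lambda>x. if x \<in> vars ls then \<psi> x else 0"
      have r: "rel G ls \<psi>" and o: "\<And>x. x \<notin> X \<Longrightarrow> \<psi> x = \<phi> x" using a by (auto simp: asg_def)
      show "(\<lambda>x. if x \<in> vars ls then ?\<psi>' x else \<phi> x) = \<psi>"
      proof
        fix x show "(if x \<in> vars ls then ?\<psi>' x else \<phi> x) = \<psi> x" using o[of x] X by (cases "x \<in> X") auto
      qed
      have "rel G ls ?\<psi>' = rel G ls \<psi>" by (rule rel_cong[OF wf(2)]) simp
      then have "?\<psi>' \<in> asgs (rs G) (fam G) ls (\<lambda>_. 0)" using r by (simp add: asgs_def)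
      moreover have "map ?\<psi>' ks = map \<phi> ks" using o ks by simp
      ultimately show "?\<psi>' \<in> ?A" by simp
    qed
    \<comment> \<open>The nest visits only assignments that satisfy its constraints; all others
      contribute 0 by \<open>supp\<close>.\<close>
    also have "\<dots> = (\<Sum>\<psi>\<in>asg (nV G) X \<phi>. w G \<psi>)"
      using supp[OF G] by (intro sum.mono_neutral_left finite_asg finX) auto
    finally show "nsum (rs G) (fam G) ls (\<lambda>\<psi>. if map \<psi> ks = map \<phi> ks then w G \<psi> else 0) (\<lambda>_. 0) =
      (\<Sum>\<psi>\<in>asg (nV G) X \<phi>. w G \<psi>)" .
  qed
qed

section \<open>Variable elimination\<close>

definition epr :: "(nat \<times> nat) list \<Rightarrow> nat pair_pre_digraph \<Rightarrow> (nat \<Rightarrow> nat) \<Rightarrow> int" where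
  "epr E G \<phi> = of_bool (\<forall>(x, y)\<in>set E. nbr G (\<phi> x) (\<phi> y))"

definition fprod :: "(nat list \<times> (nat pair_pre_digraph \<Rightarrow> (nat \<Rightarrow> nat) \<Rightarrow> int)) list \<Rightarrow> nat pair_pre_digraph \<Rightarrow> (nat \<Rightarrow> nat) \<Rightarrow> int" where
  "fprod fs G \<phi> = (\<Prod>f\<leftarrow>fs. snd f G \<phi>)"

lemma computable_epr: "computable (epr E)"
proof -
  have "epr E G \<phi> = (\<Prod>e\<leftarrow>E. of_bool (nbr G (\<phi> (fst e)) (\<phi> (snd e))))" for G \<phi>
    unfolding epr_def case_prod_beta
  proof (induction E)
    case (Cons e E)
    then show ?case by (simp only: list.set ball_simps list.map prod_list.Cons of_bool_conj)
  qed simp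
  then have "epr E = (\<lambda>G \<phi>. \<Prod>e\<leftarrow>E. of_bool (nbr G (\<phi> (fst e)) (\<phi> (snd e))))" by (intro ext)
  then show ?thesis by (simp only:) (intro computable_prod_list computable_arc)
qed

lemma computable_fprod: "\<forall>f\<in>set fs. computable (snd f) \<Longrightarrow> computable (fprod fs)"
  unfolding fprod_def by (intro computable_prod_list) auto

lemma epr_cong: "(\<And>x y. (x, y) \<in> set E \<Longrightarrow> \<phi> x = \<psi> x \<and> \<phi> y = \<psi> y) \<Longrightarrow> epr E G \<phi> = epr E G \<psi>"
  unfolding epr_def by (intro arg_cong[where f = of_bool] ball_cong refl) auto

lemma epr_mult: "epr E G \<phi> * epr E' G \<phi> = epr (E @ E') G \<phi>"
  by (auto simp: epr_def)

text \<open>The first component is the scope: the variables on which the function may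
  depend.\<close>

definition factor :: "nat list \<times> (nat pair_pre_digraph \<Rightarrow> (nat \<Rightarrow> nat) \<Rightarrow> int) \<Rightarrow> bool" where
  "factor f \<longleftrightarrow> computable (snd f) \<and> (\<forall>G \<phi> \<psi>. (\<forall>x\<in>set (fst f). \<phi> x = \<psi> x) \<longrightarrow> snd f G \<phi> = snd f G \<psi>)"

lemma fprod_cong:
  assumes "\<forall>f\<in>set fs. factor f" "\<And>f x. f \<in> set fs \<Longrightarrow> x \<in> set (fst f) \<Longrightarrow> \<phi> x = \<psi> x"
  shows "fprod fs G \<phi> = fprod fs G \<psi>"
proof -
  have "map (\<lambda>f. snd f G \<phi>) fs = map (\<lambda>f. snd f G \<psi>) fs"
    using assms unfolding factor_def by (intro map_cong refl) blast
  then show ?thesis unfolding fprod_def by (rule arg_cong)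
qed

lemma fprod_filter: "fprod fs G \<phi> = fprod (filter P fs) G \<phi> * fprod (filter (\<lambda>f. \<not> P f) fs) G \<phi>"
  unfolding fprod_def by (induction fs) auto

definition adj :: "(nat \<times> nat) list \<Rightarrow> nat \<Rightarrow> nat \<Rightarrow> bool" where
  "adj E x y \<longleftrightarrow> (x, y) \<in> set E \<or> (y, x) \<in> set E"

text \<open>A bag may be enumerated within the time bound if it is spanned by an edge, a wedge or a diamond.\<close>

definition bag_ok :: "(nat \<times> nat) list \<Rightarrow> nat list \<Rightarrow> bool" where
  "bag_ok E B \<longleftrightarrow>
     (length B \<le> 3 \<and> (\<exists>x\<in>set B. \<forall>z\<in>set B. z \<noteq> x \<longrightarrow> adj E x z)) \<or>
     (length B \<le> 4 \<and> (\<exists>x\<in>set B. \<exists>y\<in>set B. x \<noteq> y \<and> adj E x y \<and>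
       (\<forall>z\<in>set B. z \<noteq> x \<and> z \<noteq> y \<longrightarrow> adj E x z \<and> adj E y z)))"

fun elim_bag :: "(nat \<times> nat) list \<Rightarrow> nat list list \<Rightarrow> nat \<Rightarrow> nat list" where
  "elim_bag E Fs u = remdups (u # concat (filter (\<lambda>F. u \<in> set F) (map (\<lambda>(x, y). [x, y]) E @ Fs)))"

text \<open>A symbolic run of variable elimination that tracks scopes only. Eliminating
  \<open>u\<close> consumes the edges at \<open>u\<close> and creates a factor on the rest of its
  bag. Edges inside the bag that avoid \<open>u\<close> stay in \<open>E\<close>, where they can
  span later bags.\<close>

fun elim :: "(nat \<times> nat) list \<Rightarrow> nat list list \<Rightarrow> nat list \<Rightarrow> bool" where
  "elim E Fs [] \<longleftrightarrow> True"
| "elim E Fs (u # us) \<longleftrightarrow> bag_ok E (elim_bag E Fs u) \<and>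
     elim (filter (\<lambda>(x, y). x \<noteq> u \<and> y \<noteq> u) E)
       (remove1 u (elim_bag E Fs u) # filter (\<lambda>F. u \<notin> set F) Fs) us"

text \<open>An edge inside the bag forces its ends to be vertices of the graph. A bag with one
  element has no such edge, which is why some variable is assumed to be in range.\<close>

lemma bag_levels:
  assumes "bag_ok E B" "distinct B"
  obtains ls where "cheap ls" "vars ls = set B"
    "\<And>G \<phi>. good G \<Longrightarrow> epr (filter (\<lambda>(x, y). x \<in> set B \<and> y \<in> set B) E) G \<phi> \<noteq> 0 \<Longrightarrow> (\<exists>x\<in>set B. \<phi> x < nV G) \<Longrightarrow> rel G ls \<phi>"
proof -
  let ?E = "filter (\<lambda>(x, y). x \<in> set B \<and> y \<in> set B) E"
  have adj: "nbr G (\<phi> x) (\<phi> y)" if "good G" "epr ?E G \<phi> \<noteq> 0" "adj E x y" "x \<in> set B" "y \<in> set B" for G \<phi> x y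
    using that good_arc(3)[OF that(1)] unfolding epr_def adj_def by (auto split: if_splits)
  consider (s) x where "length B \<le> 3" "x \<in> set B" "\<And>z. z \<in> set B \<Longrightarrow> z \<noteq> x \<Longrightarrow> adj E x z"
    | (f) x y where "length B \<le> 4" "x \<in> set B" "y \<in> set B" "x \<noteq> y" "adj E x y"
      "\<And>z. z \<in> set B \<Longrightarrow> z \<noteq> x \<Longrightarrow> z \<noteq> y \<Longrightarrow> adj E x z \<and> adj E y z"
    using assms(1) unfolding bag_ok_def by blast
  then show ?thesis
  proof cases
    case s
    let ?zs = "remove1 x B"
    have zs: "distinct (x # ?zs)" "length ?zs \<le> 2" "set ?zs = set B - {x}"
      using s assms(2) by (auto simp: length_remove1)
    show ?thesis
    proof (rule that[of "star x ?zs"])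
      show "cheap (star x ?zs)" by (rule cheap_star) (use zs in auto)
      show "vars (star x ?zs) = set B" using zs s by (auto simp: star_def vars_def image_image)
      fix G and \<phi> :: "nat \<Rightarrow> nat" assume G: "good G" and e: "epr ?E G \<phi> \<noteq> 0" and n: "\<exists>x\<in>set B. \<phi> x < nV G"
      have a: "nbr G (\<phi> x) (\<phi> z)" if "z \<in> set ?zs" for z
        using adj[OF G e s(3)] that zs(3) s by auto
      have "\<phi> x < nV G"
      proof (cases "set ?zs = {}")
        case True
        then have "set B = {x}" using zs(3) s(2) by auto
        then show ?thesis using n by simp
      next
        case False
        then obtain z where "z \<in> set ?zs" by (metis all_not_in_conv)
        then show ?thesis using a good_arc(1)[OF G] by blast
      qed
      then show "rel G (star x ?zs) \<phi>" using a by (auto simp: star_def rs_def)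
    qed
  next
    case f
    let ?zs = "remove1 y (remove1 x B)"
    have zs: "distinct (x # y # ?zs)" "length ?zs \<le> 2" "set ?zs = set B - {x, y}"
      using f assms(2) by (auto simp: length_remove1)
    show ?thesis
    proof (rule that[of "fan x y ?zs"])
      show "cheap (fan x y ?zs)" by (rule cheap_fan) (use zs in auto)
      show "vars (fan x y ?zs) = set B" using zs f by (auto simp: fan_def vars_def image_image)
      fix G and \<phi> :: "nat \<Rightarrow> nat" assume G: "good G" and e: "epr ?E G \<phi> \<noteq> 0"
      have xy: "nbr G (\<phi> x) (\<phi> y)" using adj[OF G e f(5)] f by auto
      have a: "nbr G (\<phi> x) (\<phi> z)" "nbr G (\<phi> y) (\<phi> z)" if "z \<in> set ?zs" for z
        using adj[OF G e] f(6)[of z] that zs(3) f by auto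
      show "rel G (fan x y ?zs) \<phi>" using a xy good_arc[OF G xy] by (auto simp: fan_def rs_def)
    qed
  qed
qed

text \<open>Distributivity: the edges and factors that mention \<open>u\<close> live on the bag of
  \<open>u\<close>. Their product is summed over \<open>u\<close> by enumerating the bag and becomes
  a new factor on the remaining bag. All edges inside the bag take part, as they are what makes the
  enumeration cheap.\<close>

theorem computable_elimination:
  assumes "elim E (map fst fs) us" "\<forall>f\<in>set fs. factor f" "distinct us"
  shows "computable (\<lambda>G \<phi>. \<Sum>\<psi>\<in>asg (nV G) (set us) \<phi>. epr E G \<psi> * fprod fs G \<psi>)"
  using assms
proof (induction us arbitrary: E fs)
  case Nil
  show ?case
    using computable_mult[OF computable_epr computable_fprod, of fs E] Nil by (simp add: factor_def)
next
  case (Cons u us)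
  define B where "B = elim_bag E (map fst fs) u"
  define E' where "E' = filter (\<lambda>(x, y). x \<noteq> u \<and> y \<noteq> u) E"
  define EB where "EB = filter (\<lambda>(x, y). x \<in> set B \<and> y \<in> set B) E"
  define fu where "fu = filter (\<lambda>f. u \<in> set (fst f)) fs"
  define f' where "f' = filter (\<lambda>f. u \<notin> set (fst f)) fs"
  have B: "distinct B" "u \<in> set B" "\<And>x y. (x, y) \<in> set E \<Longrightarrow> x = u \<or> y = u \<Longrightarrow> x \<in> set B \<and> y \<in> set B"
    "\<And>f. f \<in> set fs \<Longrightarrow> u \<in> set (fst f) \<Longrightarrow> set (fst f) \<subseteq> set B"
  proof -
    show "distinct B" "u \<in> set B" by (simp_all add: B_def)
    have mem: "set F \<subseteq> set B" if "F \<in> set (map (\<lambda>(x, y). [x, y]) E @ map fst fs)" "u \<in> set F" for F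
    proof -
      have "F \<in> set (filter (\<lambda>F. u \<in> set F) (map (\<lambda>(x, y). [x, y]) E @ map fst fs))" using that by simp
      then have "set F \<subseteq> set (concat (filter (\<lambda>F. u \<in> set F) (map (\<lambda>(x, y). [x, y]) E @ map fst fs)))"
        unfolding set_concat by (rule Union_upper[OF imageI])
      then show ?thesis unfolding B_def elim_bag.simps set_remdups list.set by (rule subset_trans) (rule subset_insertI)
    qed
    show "x \<in> set B \<and> y \<in> set B" if "(x, y) \<in> set E" "x = u \<or> y = u" for x y
    proof -
      have "[x, y] \<in> (\<lambda>(x, y). [x, y]) ` set E" using that(1) by (rule rev_image_eqI) simp
      then show ?thesis using mem[of "[x, y]"] that(2) by auto
    qed
    show "set (fst f) \<subseteq> set B" if "f \<in> set fs" "u \<in> set (fst f)" for f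
      using mem[of "fst f"] that by simp
  qed
  obtain ls where ls: "cheap ls" "vars ls = set B"
    "\<And>G \<phi>. good G \<Longrightarrow> epr EB G \<phi> \<noteq> 0 \<Longrightarrow> (\<exists>x\<in>set B. \<phi> x < nV G) \<Longrightarrow> rel G ls \<phi>"
    using bag_levels[of E B] B(1) Cons.prems(1) unfolding EB_def B_def by auto
  \<comment> \<open>The range indicator makes the support of the summand lie in the enumerated set
    even if the bag is \<open>u\<close> alone.\<close>
  let ?w = "\<lambda>G \<phi>. of_bool (\<phi> u < nV G) * (epr EB G \<phi> * fprod fu G \<phi>)"
  have fu: "\<forall>f\<in>set fu. factor f" and f': "\<forall>f\<in>set f'. factor f" using Cons.prems by (auto simp: fu_def f'_def)
  have w: "computable ?w"
    by (intro computable_mult computable_lt computable_epr computable_fprod) (use fu in \<open>auto simp: factor_def\<close>)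
  have dep: "?w G \<phi> = ?w G \<psi>" if "\<forall>x\<in>vars ls. \<phi> x = \<psi> x" for G \<phi> \<psi>
  proof -
    have "epr EB G \<phi> = epr EB G \<psi>" by (rule epr_cong) (use that ls(2) in \<open>auto simp: EB_def\<close>)
    moreover have "fprod fu G \<phi> = fprod fu G \<psi>"
    proof (rule fprod_cong[OF fu])
      fix f x assume "f \<in> set fu" "x \<in> set (fst f)"
      then have "x \<in> set B" using B(4)[of f] by (auto simp: fu_def)
      then show "\<phi> x = \<psi> x" using that ls(2) by simp
    qed
    moreover have "\<phi> u = \<psi> u" using that ls(2) B(2) by simp
    ultimately show ?thesis by simp
  qed
  let ?w' = "\<lambda>G \<phi>. \<Sum>\<psi>\<in>asg (nV G) {u} \<phi>. ?w G \<psi>"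
  have "computable ?w'"
  proof (rule computable_elim[OF w dep ls(1)])
    show "{u} \<subseteq> vars ls" using B ls by simp
    fix G \<phi> assume "good G" "?w G \<phi> \<noteq> 0"
    then have "epr EB G \<phi> \<noteq> 0" "\<phi> u < nV G" by (auto split: if_splits)
    then show "rel G ls \<phi>" using ls(3)[OF \<open>good G\<close>] B(2) by blast
  qed
  moreover have "?w' G \<phi> = ?w' G \<psi>" if eq: "\<forall>x\<in>set (remove1 u B). \<phi> x = \<psi> x" for G \<phi> \<psi>
    by (rule sum_asg_cong[where V = "vars ls", OF dep]) (use eq B(1) ls(2) in auto)
  ultimately have fac: "factor (remove1 u B, ?w')" unfolding factor_def by auto
  have u: "u \<notin> set us" using Cons.prems by simp
  have mf: "map fst ((remove1 u B, ?w') # f') = remove1 u (elim_bag E (map fst fs) u) # filter (\<lambda>F. u \<notin> set F) (map fst fs)"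
    unfolding f'_def B_def by (simp add: filter_map comp_def)
  have IH: "computable (\<lambda>G \<phi>. \<Sum>\<psi>\<in>asg (nV G) (set us) \<phi>. epr E' G \<psi> * fprod ((remove1 u B, ?w') # f') G \<psi>)"
  proof (rule Cons.IH)
    show "elim E' (map fst ((remove1 u B, ?w') # f')) us"
      unfolding mf E'_def using Cons.prems(1) by simp
  qed (use fac f' Cons.prems in auto)
  show ?case
  proof (rule computable_cong[OF IH])
    fix G \<phi> assume "good G"
    have "epr E' G \<psi> * fprod ((remove1 u B, ?w') # f') G \<psi> =
      (\<Sum>\<chi>\<in>asg (nV G) {u} \<psi>. epr E G \<chi> * fprod fs G \<chi>)" for \<psi>
    proof -
      have "epr E' G \<psi> * fprod ((remove1 u B, ?w') # f') G \<psi> =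
        (\<Sum>\<chi>\<in>asg (nV G) {u} \<psi>. epr E' G \<psi> * (?w G \<chi> * fprod f' G \<psi>))"
        by (simp add: fprod_def sum_distrib_left sum_distrib_right)
      also have "\<dots> = (\<Sum>\<chi>\<in>asg (nV G) {u} \<psi>. epr E G \<chi> * fprod fs G \<chi>)"
      proof (rule sum.cong[OF refl])
        fix \<chi> assume \<chi>: "\<chi> \<in> asg (nV G) {u} \<psi>"
        then have o: "\<And>x. x \<noteq> u \<Longrightarrow> \<psi> x = \<chi> x" and lt: "\<chi> u < nV G" by (auto simp: asg_def)
        have 1: "epr E' G \<psi> = epr E' G \<chi>" by (rule epr_cong) (use o in \<open>auto simp: E'_def\<close>)
        have 2: "fprod f' G \<psi> = fprod f' G \<chi>"
        proof (rule fprod_cong[OF f'])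
          fix f x assume "f \<in> set f'" "x \<in> set (fst f)"
          then have "x \<noteq> u" by (auto simp: f'_def)
          then show "\<psi> x = \<chi> x" by (rule o)
        qed
        \<comment> \<open>Edges inside the bag that avoid \<open>u\<close> occur in both
          \<open>E'\<close> and \<open>EB\<close>. Using them twice does no harm, since a product of
          indicators depends on the set of edges only.\<close>
        have "set (E' @ EB) = set E" using B(3) by (auto simp: E'_def EB_def)
        then have 3: "epr E' G \<chi> * epr EB G \<chi> = epr E G \<chi>" unfolding epr_mult by (simp add: epr_def)
        have 4: "fprod fs G \<chi> = fprod fu G \<chi> * fprod f' G \<chi>" unfolding fu_def f'_def by (rule fprod_filter)
        show "epr E' G \<psi> * (?w G \<chi> * fprod f' G \<psi>) = epr E G \<chi> * fprod fs G \<chi>"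
          unfolding 1 2 4 3[symmetric] using lt by (simp add: mult.assoc)
      qed
      finally show ?thesis .
    qed
    then show "(\<Sum>\<psi>\<in>asg (nV G) (set us) \<phi>. epr E' G \<psi> * fprod ((remove1 u B, ?w') # f') G \<psi>) =
      (\<Sum>\<psi>\<in>asg (nV G) (set (u # us)) \<phi>. epr E G \<psi> * fprod fs G \<psi>)"
      using sum_asg_insert[OF u, of "\<lambda>\<chi>. epr E G \<chi> * fprod fs G \<chi>" "nV G" \<phi>] by simp
  qed
qed

section \<open>Canonical codes of rooted graphs\<close>

definition pairs :: "nat \<Rightarrow> (nat \<times> nat) list" where
  "pairs p = concat (map (\<lambda>i. map (Pair i) [Suc i..<p]) [0..<p])"

definition root_perms :: "nat \<Rightarrow> nat list list" where
  "root_perms p = map ((#) 0) (filter distinct (List.n_lists (p - 1) [1..<p]))"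

definition pair_index :: "nat \<Rightarrow> nat \<Rightarrow> nat \<Rightarrow> nat" where
  "pair_index p i j = length (takeWhile (\<lambda>e. e \<noteq> (min i j, max i j)) (pairs p))"

text \<open>The action of root-fixing permutations on codes, written as permutations of bit
  positions so that it is computed once for all codes.\<close>

definition index_perms :: "nat \<Rightarrow> nat list list" where
  "index_perms p = map (\<lambda>\<sigma>. map (\<lambda>(i, j). pair_index p (\<sigma> ! i) (\<sigma> ! j)) (pairs p)) (root_perms p)"

text \<open>Compares a code with its permuted form without building the latter, stopping at the
  first difference; \<open>False\<close> is the smaller bit.\<close>

fun lex_le_sel :: "bool list \<Rightarrow> bool list \<Rightarrow> nat list \<Rightarrow> bool" where
  "lex_le_sel bs (x # xs) (k # ks) = (if x = bs ! k then lex_le_sel bs xs ks else \<not> x)"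
| "lex_le_sel bs _ _ = True"

fun min_code :: "nat list list \<Rightarrow> bool list \<Rightarrow> bool" where
  "min_code [] bs = True"
| "min_code (ks # kss) bs = (if lex_le_sel bs bs ks then min_code kss bs else False)"

definition edges_of :: "nat \<Rightarrow> bool list \<Rightarrow> (nat \<times> nat) list" where
  "edges_of p bs = map fst (filter snd (zip (pairs p) bs))"

text \<open>It suffices to test cuts by sets that avoid the root, because a set and its complement
  are crossed by the same edges.\<close>

definition conn_code :: "nat \<Rightarrow> (nat \<times> nat) list \<Rightarrow> bool" where
  "conn_code p E = list_all (\<lambda>X. X = [] \<or> list_ex (\<lambda>(x, y). (x \<in> set X) \<noteq> (y \<in> set X)) E) (subseqs [1..<p])"

text \<open>A graph on \<open>0, \<dots>, p - 1\<close> with root \<open>0\<close> is coded by the list of its adjacency bits for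
  \<open>i < j\<close>. Its isomorphism class is represented by the lexicographically least code that is
  obtained by permuting the vertices other than the root.\<close>

definition codes :: "nat \<Rightarrow> nat list list \<Rightarrow> bool list list" where
  "codes p kss = filter (\<lambda>bs. conn_code p (edges_of p bs)) (filter (min_code kss) (List.n_lists (length (pairs p)) [False, True]))"

definition decode :: "nat \<Rightarrow> bool list \<Rightarrow> nat pair_pre_digraph" where
  "decode p bs = \<lparr>pverts = {..<p}, parcs = {(i, j). (i, j) \<in> set (edges_of p bs) \<or> (j, i) \<in> set (edges_of p bs)}\<rparr>"

definition code :: "'a pair_pre_digraph \<Rightarrow> (nat \<Rightarrow> 'a) \<Rightarrow> nat \<Rightarrow> bool list" where
  "code H h p = map (\<lambda>(i, j). (h i, h j) \<in> parcs H) (pairs p)"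

lemma set_pairs: "set (pairs p) = {(i, j). i < j \<and> j < p}"
  by (auto simp: pairs_def image_iff)

lemma distinct_pairs: "distinct (pairs p)"
  unfolding pairs_def
  by (rule distinct_concat) (auto simp: distinct_map inj_on_def dest!: map_eq_imp_length_eq)

lemma filter_zip_map: "map fst (filter snd (zip xs (map P xs))) = filter P xs"
  by (induction xs) auto

lemma edges_of_code: "set (edges_of p (code H h p)) = {(i, j). i < j \<and> j < p \<and> (h i, h j) \<in> parcs H}"
  unfolding edges_of_def code_def filter_zip_map by (auto simp: set_pairs)

lemma isomorphism_decode_code:
  assumes "pair_graph H" "bij_betw h {..<p} (pverts H)"
  shows "isomorphism (decode p (code H h p)) H h"
proof -
  interpret pair_graph H by fact
  have sym: "(x, y) \<in> parcs H \<longleftrightarrow> (y, x) \<in> parcs H" for x y using arcs_symmetric by auto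
  have irr: "(x, x) \<notin> parcs H" for x using no_loops by fastforce
  have "(i, j) \<in> parcs (decode p (code H h p)) \<longleftrightarrow> (h i, h j) \<in> parcs H" if "i < p" "j < p" for i j
    using that sym irr by (cases i j rule: linorder_cases) (auto simp: decode_def edges_of_code)
  then show ?thesis using assms(2) by (simp add: isomorphism_def decode_def)
qed

lemma pair_graph_decode:
  assumes "length bs = length (pairs p)" shows "pair_graph (decode p bs)"
proof -
  have "set (edges_of p bs) \<subseteq> set (pairs p)" unfolding edges_of_def by (auto dest: set_zip_leftD)
  then have e: "\<And>i j. (i, j) \<in> set (edges_of p bs) \<Longrightarrow> i < j \<and> j < p" using set_pairs by auto
  have "finite (parcs (decode p bs))"
    by (rule finite_subset[of _ "{..<p} \<times> {..<p}"]) (auto simp: decode_def dest: e)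
  then show ?thesis
    by unfold_locales (auto simp: decode_def symmetric_def intro!: symI dest: e)
qed

lemma code_decode:
  assumes "length bs = length (pairs p)" shows "code (decode p bs) id p = bs"
proof (rule nth_equalityI)
  show "length (code (decode p bs) id p) = length bs" using assms by (simp add: code_def)
  fix k assume "k < length (code (decode p bs) id p)"
  then have k: "k < length (pairs p)" by (simp add: code_def)
  obtain i j where ij: "pairs p ! k = (i, j)" by force
  have E: "(x, y) \<in> set (edges_of p bs) \<longleftrightarrow> (\<exists>k<length (pairs p). pairs p ! k = (x, y) \<and> bs ! k)" for x y
    unfolding edges_of_def using assms by (force simp: set_zip)
  have "i < j" using nth_mem[OF k] ij set_pairs by auto
  have "(j, i) \<notin> set (edges_of p bs)"
  proof
    assume "(j, i) \<in> set (edges_of p bs)"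
    then have "(j, i) \<in> set (pairs p)" unfolding edges_of_def by (auto dest: set_zip_leftD)
    then show False using \<open>i < j\<close> set_pairs by auto
  qed
  moreover have "(i, j) \<in> set (edges_of p bs) \<longleftrightarrow> bs ! k"
    unfolding E using ij k distinct_pairs[of p] by (auto simp: nth_eq_iff_index_eq)
      (metis nth_eq_iff_index_eq)
  ultimately show "code (decode p bs) id p ! k = bs ! k" using k ij by (simp add: code_def decode_def)
qed

lemma length_takeWhile_neq: "x \<in> set xs \<Longrightarrow> length (takeWhile (\<lambda>y. y \<noteq> x) xs) < length xs"
  by (induction xs) auto

lemma pair_index:
  assumes "i < p" "j < p" "i \<noteq> j"
  shows "pair_index p i j < length (pairs p)" "pairs p ! pair_index p i j = (min i j, max i j)"
proof -
  have "(min i j, max i j) \<in> set (pairs p)" using assms by (auto simp: set_pairs min_def max_def)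
  then show lt: "pair_index p i j < length (pairs p)"
    unfolding pair_index_def by (rule length_takeWhile_neq)
  then show "pairs p ! pair_index p i j = (min i j, max i j)"
    unfolding pair_index_def using nth_length_takeWhile by blast
qed

lemma root_perms_iff:
  assumes "1 \<le> p"
  shows "\<sigma> \<in> set (root_perms p) \<longleftrightarrow> length \<sigma> = p \<and> bij_betw ((!) \<sigma>) {..<p} {..<p} \<and> \<sigma> ! 0 = 0"
proof -
  have "\<sigma> \<in> set (root_perms p) \<longleftrightarrow> length \<sigma> = p \<and> \<sigma> ! 0 = 0 \<and> distinct (tl \<sigma>) \<and> set (tl \<sigma>) \<subseteq> {1..<p}"
    using assms by (cases \<sigma>) (auto simp: root_perms_def set_n_lists)
  also have "\<dots> \<longleftrightarrow> length \<sigma> = p \<and> \<sigma> ! 0 = 0 \<and> distinct \<sigma> \<and> set \<sigma> \<subseteq> {..<p}"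
    using assms by (cases \<sigma>) (auto simp: subset_iff Suc_le_eq intro!: gr0I)
  also have "\<dots> \<longleftrightarrow> length \<sigma> = p \<and> bij_betw ((!) \<sigma>) {..<p} {..<p} \<and> \<sigma> ! 0 = 0"
  proof -
    have "distinct \<sigma> \<and> set \<sigma> \<subseteq> {..<p} \<longleftrightarrow> bij_betw ((!) \<sigma>) {..<p} {..<p}" if len: "length \<sigma> = p"
    proof
      assume a: "distinct \<sigma> \<and> set \<sigma> \<subseteq> {..<p}"
      then have "set \<sigma> = {..<p}" using len by (intro card_subset_eq) (auto simp: distinct_card)
      then show "bij_betw ((!) \<sigma>) {..<p} {..<p}" using a len by (intro bij_betw_nth) auto
    next
      assume b: "bij_betw ((!) \<sigma>) {..<p} {..<p}"
      then have "distinct \<sigma>" using len by (auto simp: distinct_conv_nth bij_betw_def inj_on_def)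
      moreover have "set \<sigma> \<subseteq> {..<p}" using b len by (fastforce simp: set_conv_nth bij_betw_def)
      ultimately show "distinct \<sigma> \<and> set \<sigma> \<subseteq> {..<p}" by simp
    qed
    then show ?thesis by blast
  qed
  finally show ?thesis .
qed

text \<open>Renumbering permutes the bits. A pair may come out in the wrong order, which does not
  matter by symmetry.\<close>

lemma code_perm:
  assumes "pair_graph H" "\<sigma> \<in> set (root_perms p)" "1 \<le> p"
  shows "map ((!) (code H h p)) (map (\<lambda>(i, j). pair_index p (\<sigma> ! i) (\<sigma> ! j)) (pairs p)) = code H (\<lambda>i. h (\<sigma> ! i)) p"
proof -
  interpret pair_graph H by fact
  have sym: "(x, y) \<in> parcs H \<longleftrightarrow> (y, x) \<in> parcs H" for x y using arcs_symmetric by auto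
  have \<sigma>: "bij_betw ((!) \<sigma>) {..<p} {..<p}" using assms root_perms_iff by blast
  have "code H h p ! pair_index p (\<sigma> ! i) (\<sigma> ! j) \<longleftrightarrow> (h (\<sigma> ! i), h (\<sigma> ! j)) \<in> parcs H" if "i < j" "j < p" for i j
  proof -
    have "\<sigma> ! i < p" "\<sigma> ! j < p" "\<sigma> ! i \<noteq> \<sigma> ! j" using \<sigma> that by (auto simp: bij_betw_def inj_on_def)
    note pi = pair_index[OF this]
    have "code H h p ! pair_index p (\<sigma> ! i) (\<sigma> ! j) \<longleftrightarrow> (h (min (\<sigma> ! i) (\<sigma> ! j)), h (max (\<sigma> ! i) (\<sigma> ! j))) \<in> parcs H"
      unfolding code_def using pi by simp
    then show ?thesis using sym by (auto simp: min_def max_def)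
  qed
  then show ?thesis unfolding code_def[of H "\<lambda>i. h (\<sigma> ! i)"] by (auto simp: set_pairs)
qed

lemma lex_le_sel: "length xs = length ks \<Longrightarrow> lex_le_sel bs xs ks \<longleftrightarrow> xs \<le> map ((!) bs) ks"
  by (induction bs xs ks rule: lex_le_sel.induct) auto

lemma min_code: "\<forall>ks\<in>set kss. length ks = length bs \<Longrightarrow> min_code kss bs \<longleftrightarrow> (\<forall>ks\<in>set kss. bs \<le> map ((!) bs) ks)"
  by (induction kss) (auto simp: lex_le_sel)

lemma codes_iff:
  "bs \<in> set (codes p (index_perms p)) \<longleftrightarrow> length bs = length (pairs p) \<and> conn_code p (edges_of p bs) \<and>
    (\<forall>\<sigma>\<in>set (root_perms p). bs \<le> map ((!) bs) (map (\<lambda>(i, j). pair_index p (\<sigma> ! i) (\<sigma> ! j)) (pairs p)))"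
proof -
  have "set [False, True] = UNIV" by auto
  then have "bs \<in> set (codes p (index_perms p)) \<longleftrightarrow> length bs = length (pairs p) \<and> conn_code p (edges_of p bs) \<and> min_code (index_perms p) bs"
    unfolding codes_def by (auto simp: set_n_lists)
  moreover have "length bs = length (pairs p) \<Longrightarrow> min_code (index_perms p) bs \<longleftrightarrow> (\<forall>ks\<in>set (index_perms p). bs \<le> map ((!) bs) ks)"
    by (rule min_code) (auto simp: index_perms_def)
  ultimately show ?thesis by (auto simp: index_perms_def)
qed

section \<open>Connectedness\<close>

text \<open>Connectedness in terms of cuts passes to images under arbitrary maps, hence to
  contractions, and can be evaluated on codes.\<close>

definition cut_conn :: "'a set \<Rightarrow> ('a \<times> 'a) set \<Rightarrow> bool" where
  "cut_conn V E \<longleftrightarrow> (\<forall>X\<subseteq>V. X \<noteq> {} \<longrightarrow> X \<noteq> V \<longrightarrow> (\<exists>(x, y)\<in>E. (x \<in> X) \<noteq> (y \<in> X)))"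

text \<open>By symmetry, no arc crosses the boundary of the set of vertices reachable from
  \<open>u\<close>, so this set is no proper cut. Conversely, a walk cannot leave a set that no arc
  crosses.\<close>

lemma connected_cut_conn:
  assumes "pair_graph H" "pverts H \<noteq> {}"
  shows "connected (with_proj H) \<longleftrightarrow> cut_conn (pverts H) (parcs H)"
proof -
  interpret pair_graph H by fact
  have sym: "(x, y) \<in> parcs H \<Longrightarrow> (y, x) \<in> parcs H" for x y using arcs_symmetric by auto
  have "parcs (mk_symmetric (with_proj H)) = parcs H" "pverts (mk_symmetric (with_proj H)) = pverts H"
    using sym by (auto simp: mk_symmetric_def)
  then have conn: "connected (with_proj H) \<longleftrightarrow> (\<forall>u\<in>pverts H. \<forall>v\<in>pverts H. (u, v) \<in> rtrancl_on (pverts H) (parcs H))"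
    using assms(2) by (simp add: connected_def strongly_connected_def reachable_def)
  show ?thesis
  proof
    assume c: "connected (with_proj H)"
    show "cut_conn (pverts H) (parcs H)"
      unfolding cut_conn_def
    proof (intro allI impI)
      fix X assume X: "X \<subseteq> pverts H" "X \<noteq> {}" "X \<noteq> pverts H"
      then obtain u v where uv: "u \<in> X" "v \<in> pverts H" "v \<notin> X" by blast
      show "\<exists>(x, y)\<in>parcs H. (x \<in> X) \<noteq> (y \<in> X)"
      proof (rule ccontr)
        assume n: "\<not> (\<exists>(x, y)\<in>parcs H. (x \<in> X) \<noteq> (y \<in> X))"
        have "(u, v) \<in> rtrancl_on (pverts H) (parcs H)" using c X uv unfolding conn by blast
        then have "v \<in> X"
        proof (induction rule: rtrancl_on_induct)
          case base
          then show ?case using uv(1) by simp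
        next
          case (step y z)
          then show ?case using n by blast
        qed
        then show False using uv by simp
      qed
    qed
  next
    assume c: "cut_conn (pverts H) (parcs H)"
    show "connected (with_proj H)"
      unfolding conn
    proof (intro ballI)
      fix u v assume u: "u \<in> pverts H" and v: "v \<in> pverts H"
      let ?X = "{v \<in> pverts H. (u, v) \<in> rtrancl_on (pverts H) (parcs H)}"
      have "u \<in> ?X" using u by simp
      have step: "y \<in> ?X" if "x \<in> ?X" "(x, y) \<in> parcs H" for x y
        using that in_arcsD2 by (auto intro: rtrancl_on_into_rtrancl_on)
      have "?X = pverts H"
      proof (rule ccontr)
        assume "?X \<noteq> pverts H"
        moreover have "?X \<noteq> {}" using \<open>u \<in> ?X\<close> by blast
        ultimately obtain x y where "(x, y) \<in> parcs H" "(x \<in> ?X) \<noteq> (y \<in> ?X)"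
          using c[unfolded cut_conn_def, rule_format, of ?X] by blast
        then show False using step sym by blast
      qed
      then show "(u, v) \<in> rtrancl_on (pverts H) (parcs H)" using v by blast
    qed
  qed
qed

text \<open>The preimage of a proper cut is a proper cut, and an edge that crosses it maps to an
  edge that crosses the original one.\<close>

lemma cut_conn_image:
  assumes "cut_conn V E" "E \<subseteq> V \<times> V" shows "cut_conn (h ` V) (map_prod h h ` E)"
  unfolding cut_conn_def
proof (intro allI impI)
  fix X assume X: "X \<subseteq> h ` V" "X \<noteq> {}" "X \<noteq> h ` V"
  let ?Y = "{x \<in> V. h x \<in> X}"
  have "?Y \<noteq> {}" "?Y \<noteq> V" "?Y \<subseteq> V" using X by blast+
  then have "\<exists>(x, y)\<in>E. (x \<in> ?Y) \<noteq> (y \<in> ?Y)" using assms(1) unfolding cut_conn_def by blast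
  then obtain x y where xy: "(x, y) \<in> E" "(x \<in> ?Y) \<noteq> (y \<in> ?Y)" by blast
  then have "x \<in> V" "y \<in> V" using assms(2) by auto
  then have "(h x \<in> X) \<noteq> (h y \<in> X)" using xy(2) by simp
  moreover have "(h x, h y) \<in> map_prod h h ` E" using xy(1) by force
  ultimately show "\<exists>(x, y)\<in>map_prod h h ` E. (x \<in> X) \<noteq> (y \<in> X)"
    by (intro bexI[of _ "(h x, h y)"]) simp_all
qed

lemma isomorphism_image:
  assumes "isomorphism H H' \<phi>" "parcs H \<subseteq> pverts H \<times> pverts H" "parcs H' \<subseteq> pverts H' \<times> pverts H'"
  shows "pverts H' = \<phi> ` pverts H" "parcs H' = map_prod \<phi> \<phi> ` parcs H"
proof -
  show V: "pverts H' = \<phi> ` pverts H" using assms by (simp add: isomorphism_def bij_betw_def)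
  have iff: "(a, b) \<in> parcs H \<longleftrightarrow> (\<phi> a, \<phi> b) \<in> parcs H'" if "a \<in> pverts H" "b \<in> pverts H" for a b
    using assms(1) that unfolding isomorphism_def by blast
  show "parcs H' = map_prod \<phi> \<phi> ` parcs H"
  proof (intro equalityI subsetI)
    fix e assume e: "e \<in> parcs H'"
    then obtain x y where xy: "e = (x, y)" "x \<in> \<phi> ` pverts H" "y \<in> \<phi> ` pverts H" using assms(3) V by (cases e) auto
    then obtain a b where ab: "a \<in> pverts H" "b \<in> pverts H" "x = \<phi> a" "y = \<phi> b" by blast
    then have "(a, b) \<in> parcs H" using e xy iff by simp
    then show "e \<in> map_prod \<phi> \<phi> ` parcs H" using ab xy by force
  next
    fix e assume "e \<in> map_prod \<phi> \<phi> ` parcs H"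
    then obtain a b where "(a, b) \<in> parcs H" "e = (\<phi> a, \<phi> b)" by auto
    moreover from this have "a \<in> pverts H" "b \<in> pverts H" using assms(2) by auto
    ultimately show "e \<in> parcs H'" using iff by simp
  qed
qed

lemma pair_graph_parcs: "pair_graph H \<Longrightarrow> parcs H \<subseteq> pverts H \<times> pverts H"
proof -
  assume "pair_graph H"
  then interpret pair_graph H .
  show ?thesis using in_arcsD1 in_arcsD2 by auto
qed

lemma conn_code:
  assumes "length bs = length (pairs p)"
  shows "conn_code p (edges_of p bs) \<longleftrightarrow> cut_conn {..<p} (parcs (decode p bs))"
proof -
  let ?E = "set (edges_of p bs)"
  have "?E \<subseteq> set (pairs p)" unfolding edges_of_def by (auto dest: set_zip_leftD)
  then have e: "\<And>i j. (i, j) \<in> ?E \<Longrightarrow> i < p \<and> j < p" using set_pairs by fastforce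
  have sub: "set ` set (subseqs [1..<p]) = Pow {1..<p}" by (simp add: subseqs_powset)
  have "conn_code p (edges_of p bs) \<longleftrightarrow> (\<forall>X\<in>set (subseqs [1..<p]). set X = {} \<or> (\<exists>(x, y)\<in>?E. (x \<in> set X) \<noteq> (y \<in> set X)))"
    by (simp add: conn_code_def list_all_iff list_ex_iff)
  also have "\<dots> \<longleftrightarrow> (\<forall>X\<in>set ` set (subseqs [1..<p]). X = {} \<or> (\<exists>(x, y)\<in>?E. (x \<in> X) \<noteq> (y \<in> X)))"
    by (simp only: ball_simps)
  also have "\<dots> \<longleftrightarrow> (\<forall>X\<subseteq>{1..<p}. X \<noteq> {} \<longrightarrow> (\<exists>(x, y)\<in>?E. (x \<in> X) \<noteq> (y \<in> X)))"
    unfolding sub by blast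
  also have "\<dots> \<longleftrightarrow> cut_conn {..<p} (parcs (decode p bs))"
  proof
    assume a: "\<forall>X\<subseteq>{1..<p}. X \<noteq> {} \<longrightarrow> (\<exists>(x, y)\<in>?E. (x \<in> X) \<noteq> (y \<in> X))"
    show "cut_conn {..<p} (parcs (decode p bs))"
      unfolding cut_conn_def
    proof (intro allI impI)
      fix X assume X: "X \<subseteq> {..<p}" "X \<noteq> {}" "X \<noteq> {..<p}"
      let ?Y = "if 0 \<in> X then {..<p} - X else X"
      have Y0: "0 \<notin> ?Y" by simp
      have Y: "?Y \<noteq> {}" "?Y \<subseteq> {..<p}" using X by auto
      have "?Y \<subseteq> {1..<p}"
      proof
        fix z assume z: "z \<in> ?Y"
        then have "z \<noteq> 0" using Y0 by metis
        moreover have "z < p" using z Y(2) by blast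
        ultimately show "z \<in> {1..<p}" by simp
      qed
      with a Y(1) obtain x y where xy: "(x, y) \<in> ?E" "(x \<in> ?Y) \<noteq> (y \<in> ?Y)" by blast
      have "x < p" "y < p" using e[OF xy(1)] by auto
      then have "(x \<in> X) \<noteq> (y \<in> X)" using xy(2) by (auto split: if_splits)
      then show "\<exists>(x, y)\<in>parcs (decode p bs). (x \<in> X) \<noteq> (y \<in> X)" using xy(1) by (auto simp: decode_def)
    qed
  next
    assume a: "cut_conn {..<p} (parcs (decode p bs))"
    show "\<forall>X\<subseteq>{1..<p}. X \<noteq> {} \<longrightarrow> (\<exists>(x, y)\<in>?E. (x \<in> X) \<noteq> (y \<in> X))"
    proof (intro allI impI)
      fix X assume X: "X \<subseteq> {1..<p}" "X \<noteq> {}"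
      have "X \<subseteq> {..<p}" using X(1) by auto
      moreover have "X \<noteq> {..<p}"
      proof
        assume eq: "X = {..<p}"
        with X(2) have "0 \<in> X" by auto
        then show False using X(1) by auto
      qed
      ultimately obtain x y where xy: "(x, y) \<in> parcs (decode p bs)" "(x \<in> X) \<noteq> (y \<in> X)"
        using a X(2) unfolding cut_conn_def by blast
      then have "(x, y) \<in> ?E \<or> (y, x) \<in> ?E" by (simp add: decode_def)
      then show "\<exists>(x, y)\<in>?E. (x \<in> X) \<noteq> (y \<in> X)" using xy(2) by blast
    qed
  qed
  finally show ?thesis .
qed

section \<open>Rooted patterns up to isomorphism, and vertex orbits\<close>

definition patterns :: "(nat \<times> bool list) list" where
  "patterns = concat (map (\<lambda>p. map (Pair p) (codes p (index_perms p))) [2, 3, 4, 5])"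

lemma patterns_iff: "(p, bs) \<in> set patterns \<longleftrightarrow> p \<in> {2..5} \<and> bs \<in> set (codes p (index_perms p))"
proof -
  have "p \<in> {2..5} \<longleftrightarrow> p = 2 \<or> p = 3 \<or> p = 4 \<or> p = (5::nat)" by (auto simp: le_Suc_eq numeral_eq_Suc)
  then show ?thesis by (auto simp: patterns_def)
qed

lemma pattern_decode:
  assumes "(p, bs) \<in> set patterns" shows "pattern (decode p bs)"
proof -
  have p: "2 \<le> p" "p \<le> 5" and bs: "length bs = length (pairs p)" "conn_code p (edges_of p bs)"
    using assms patterns_iff codes_iff by auto
  have V: "pverts (decode p bs) = {..<p}" by (simp add: decode_def)
  have "connected (with_proj (decode p bs))"
    using connected_cut_conn[OF pair_graph_decode[OF bs(1)]] conn_code[OF bs(1)] bs(2) p V by (auto simp: lessThan_empty_iff)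
  then show ?thesis using pair_graph_decode[OF bs(1)] p V by (simp add: pattern_def)
qed

text \<open>Among the finitely many codes of \<open>H\<close> over all numberings that give
  \<open>a\<close> the number 0, the least one is canonical: permuting its bits yields the code of
  another such numbering, which is not smaller.\<close>

theorem pattern_classification:
  assumes H: "pattern H" and a: "a \<in> pverts H"
  obtains p bs h where "(p, bs) \<in> set patterns" "isomorphism (decode p bs) H h" "h 0 = a"
proof -
  have G: "pair_graph H" and conn: "connected (with_proj H)" and card: "2 \<le> card (pverts H)" "card (pverts H) \<le> 5"
    using H by (auto simp: pattern_def)
  define p where "p = card (pverts H)"
  have fin: "finite (pverts H)" using card by (metis card.infinite not_numeral_le_zero)
  let ?C = "{code H h p |h. bij_betw h {..<p} (pverts H) \<and> h 0 = a}"
  have "card {1..<p} = card (pverts H - {a})" using a fin by (simp add: p_def)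
  then obtain g where g: "bij_betw g {1..<p} (pverts H - {a})" using finite_same_card_bij fin by blast
  have p: "2 \<le> p" "p \<le> 5" using card by (simp_all add: p_def)
  have "bij_betw (g(0 := a)) {1..<p} (pverts H - {a})"
    using g by (subst bij_betw_cong[of _ _ g]) auto
  then have "bij_betw (g(0 := a)) (insert 0 {1..<p}) (insert a (pverts H - {a}))"
    using notIn_Un_bij_betw[of 0 "{1..<p}" "g(0 := a)" "pverts H - {a}"] by simp
  moreover have "insert 0 {1..<p} = {..<p}" "insert a (pverts H - {a}) = pverts H" using p a by auto
  ultimately have "bij_betw (g(0 := a)) {..<p} (pverts H)" by simp
  then have "code H (g(0 := a)) p \<in> ?C" by (intro CollectI exI[of _ "g(0 := a)"]) simp
  then have ne: "?C \<noteq> {}" by blast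
  have "?C \<subseteq> {bs. set bs \<subseteq> UNIV \<and> length bs = length (pairs p)}" by (auto simp: code_def)
  then have finC: "finite ?C" by (rule finite_subset) (rule finite_lists_length_eq, simp)
  \<comment> \<open>The minimum refers to the lexicographic order of lists.\<close>
  have "Min ?C \<in> ?C" using finC ne by (rule Min_in)
  then obtain h where h: "Min ?C = code H h p" "bij_betw h {..<p} (pverts H)" "h 0 = a" by blast
  let ?bs = "code H h p"
  have iso: "isomorphism (decode p ?bs) H h" by (rule isomorphism_decode_code[OF G h(2)])
  have len: "length ?bs = length (pairs p)" by (simp add: code_def)
  have "?bs \<in> set (codes p (index_perms p))"
    unfolding codes_iff
  proof (intro conjI ballI len)
    note Gd = pair_graph_decode[OF len]
    have "cut_conn (pverts H) (parcs H)" using connected_cut_conn[OF G] conn a by blast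
    then have "cut_conn (inv_into {..<p} h ` pverts H) (map_prod (inv_into {..<p} h) (inv_into {..<p} h) ` parcs H)"
      by (rule cut_conn_image[OF _ pair_graph_parcs[OF G]])
    moreover have "isomorphism H (decode p ?bs) (inv_into {..<p} h)"
      using isomorphism_inv[OF iso] by (simp add: decode_def)
    note isomorphism_image[OF this pair_graph_parcs[OF G] pair_graph_parcs[OF Gd]]
    ultimately show "conn_code p (edges_of p ?bs)" using conn_code[OF len] by (simp add: decode_def)
  next
    fix \<sigma> assume \<sigma>: "\<sigma> \<in> set (root_perms p)"
    have 1: "bij_betw ((!) \<sigma>) {..<p} {..<p}" "\<sigma> ! 0 = 0" using \<sigma> root_perms_iff[of p] p by auto
    have "bij_betw (h \<circ> (!) \<sigma>) {..<p} (pverts H)" by (rule bij_betw_trans[OF 1(1) h(2)])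
    then have "code H (\<lambda>i. h (\<sigma> ! i)) p \<in> ?C" using 1(2) h(3) by (auto simp: comp_def)
    then have "Min ?C \<le> code H (\<lambda>i. h (\<sigma> ! i)) p" by (rule Min_le[OF finC])
    then show "?bs \<le> map ((!) ?bs) (map (\<lambda>(i, j). pair_index p (\<sigma> ! i) (\<sigma> ! j)) (pairs p))"
      using h(1) code_perm[OF G \<sigma>] p by simp
  qed
  then have "(p, ?bs) \<in> set patterns" using p by (simp add: patterns_iff)
  then show ?thesis using iso h(3) that by blast
qed

text \<open>An isomorphism that fixes the root is a root permutation and turns \<open>bs'\<close>
  into \<open>bs\<close>; the minimality of \<open>bs'\<close> applies. Used in both directions,
  this gives uniqueness.\<close>

lemma codes_le:
  assumes bs: "bs \<in> set (codes p (index_perms p))" and bs': "bs' \<in> set (codes p (index_perms p))" and p: "1 \<le> p"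
    and iso: "isomorphism (decode p bs) (decode p bs') \<phi>" "\<phi> 0 = 0"
  shows "bs' \<le> bs"
proof -
  have len: "length bs = length (pairs p)" "length bs' = length (pairs p)" using bs bs' codes_iff by auto
  let ?\<sigma> = "map \<phi> [0..<p]"
  have b: "bij_betw \<phi> {..<p} {..<p}" using iso by (simp add: isomorphism_def decode_def)
  have "bij_betw ((!) ?\<sigma>) {..<p} {..<p}" using b by (subst bij_betw_cong[of _ _ \<phi>]) auto
  then have \<sigma>: "?\<sigma> \<in> set (root_perms p)" using root_perms_iff[OF p, of ?\<sigma>] iso(2) p by simp
  have "map ((!) bs') (map (\<lambda>(i, j). pair_index p (?\<sigma> ! i) (?\<sigma> ! j)) (pairs p)) = code (decode p bs') (\<lambda>i. id (?\<sigma> ! i)) p"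
    using code_perm[OF pair_graph_decode[OF len(2)] \<sigma> p, of id] unfolding code_decode[OF len(2)] .
  also have "\<dots> = code (decode p bs) id p"
    using iso(1) by (auto simp: code_def set_pairs isomorphism_def decode_def)
  also have "\<dots> = bs" by (rule code_decode[OF len(1)])
  finally show ?thesis using bs' \<sigma> codes_iff by metis
qed

theorem patterns_unique:
  assumes "(p, bs) \<in> set patterns" "(p', bs') \<in> set patterns"
    and iso: "isomorphism (decode p bs) (decode p' bs') \<phi>" "\<phi> 0 = 0"
  shows "(p, bs) = (p', bs')"
proof -
  have "bij_betw \<phi> {..<p} {..<p'}" using iso by (simp add: isomorphism_def decode_def)
  then have p: "p' = p" using bij_betw_same_card by fastforce
  have p1: "1 \<le> p" using assms(1) patterns_iff by auto
  have c: "bs \<in> set (codes p (index_perms p))" "bs' \<in> set (codes p (index_perms p))"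
    using assms(1,2) patterns_iff p by auto
  have "inv_into {..<p} \<phi> (\<phi> 0) = 0" using iso(1) p1 by (intro inv_into_f_f) (auto simp: isomorphism_def decode_def bij_betw_def)
  then have inv0: "inv_into {..<p} \<phi> 0 = 0" using iso(2) by simp
  have inv: "isomorphism (decode p bs') (decode p bs) (inv_into {..<p} \<phi>)"
    using isomorphism_inv[OF iso(1)] p by (simp add: decode_def)
  have "bs' \<le> bs" using codes_le[OF c p1, of \<phi>] iso p by simp
  moreover have "bs \<le> bs'" by (rule codes_le[OF c(2,1) p1 inv inv0])
  ultimately show ?thesis using p by simp
qed

text \<open>Conjugation with an isomorphism carries automorphisms of \<open>H\<close> to
  automorphisms of \<open>H'\<close> and back, so orbits are mapped onto orbits and one common
  element identifies them.\<close>

lemma orbit_isomorphism: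
  assumes iso: "isomorphism H H' \<phi>" and S: "S \<in> vertex_orbits H" "S' \<in> vertex_orbits H'" and a: "a \<in> S" "\<phi> a \<in> S'"
  shows "\<phi> ` S = S'"
proof -
  have aV: "a \<in> pverts H"
    using S(1) a(1) equiv_aut_rel[of H] unfolding vertex_orbits_aut_rel by (meson in_quotient_imp_subset subsetD)
  have cls: "S = aut_rel H `` {a}" "S' = aut_rel H' `` {\<phi> a}"
    using S a equiv_aut_rel unfolding vertex_orbits_aut_rel by (metis Image_singleton_iff equiv_class_eq_iff quotientE)+
  let ?i = "inv_into (pverts H) \<phi>"
  have inv: "isomorphism H' H ?i" by (rule isomorphism_inv[OF iso])
  have b: "bij_betw \<phi> (pverts H) (pverts H')" using iso by (simp add: isomorphism_def)
  have i: "?i (\<phi> x) = x" if "x \<in> pverts H" for x using b that by (simp add: bij_betw_def)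
  have i': "\<phi> (?i y) = y" "?i y \<in> pverts H" if "y \<in> pverts H'" for y
    using b that by (auto simp: bij_betw_def f_inv_into_f inv_into_into)
  have \<phi>V: "\<phi> x \<in> pverts H'" if "x \<in> pverts H" for x using b that by (auto simp: bij_betw_def)
  show ?thesis
  proof (intro equalityI subsetI)
    fix y assume "y \<in> \<phi> ` S"
    then obtain b \<sigma> where b: "b \<in> pverts H" "y = \<phi> b" "automorphism H \<sigma>" "\<sigma> a = b"
      unfolding cls by (auto simp: aut_rel_def)
    have "automorphism H' (\<phi> \<circ> (\<sigma> \<circ> ?i))" by (intro isomorphism_comp[OF _ iso] isomorphism_comp[OF inv] b)
    moreover have "(\<phi> \<circ> (\<sigma> \<circ> ?i)) (\<phi> a) = y" using b i[OF aV] by simp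
    moreover have "\<phi> a \<in> pverts H'" "y \<in> pverts H'" using \<phi>V[OF aV] \<phi>V[OF b(1)] b(2) by auto
    ultimately have "(\<phi> a, y) \<in> aut_rel H'"
      unfolding aut_rel_def mem_Collect_eq prod.case by (intro conjI exI[of _ "\<phi> \<circ> (\<sigma> \<circ> ?i)"])
    then show "y \<in> S'" unfolding cls by simp
  next
    fix y assume "y \<in> S'"
    then obtain \<tau> where t: "y \<in> pverts H'" "automorphism H' \<tau>" "\<tau> (\<phi> a) = y"
      unfolding cls by (auto simp: aut_rel_def)
    have "automorphism H (?i \<circ> (\<tau> \<circ> \<phi>))" by (intro isomorphism_comp[OF _ inv] isomorphism_comp[OF iso] t)
    moreover have "(?i \<circ> (\<tau> \<circ> \<phi>)) a = ?i y" using t by simp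
    ultimately have "(a, ?i y) \<in> aut_rel H"
      unfolding aut_rel_def mem_Collect_eq prod.case using i'(2)[OF t(1)] aV
      by (intro conjI exI[of _ "?i \<circ> (\<tau> \<circ> \<phi>)"])
    then have "?i y \<in> S" unfolding cls by simp
    then show "y \<in> \<phi> ` S" using i'(1)[OF t(1)] by (metis imageI)
  qed
qed

definition root_orbit :: "nat \<times> bool list \<Rightarrow> orbit" where
  "root_orbit c = (decode (fst c) (snd c), aut_rel (decode (fst c) (snd c)) `` {0})"

text \<open>Choosing a root in \<open>S\<close> makes an orbit a rooted pattern. If an isomorphism
  maps the orbit of one root onto that of another, composing it with an automorphism of the target
  makes it preserve the roots, so orbits and classes of rooted patterns correspond.\<close>

theorem ex_orbit_numbering:
  assumes "length patterns = 73" shows "\<exists>\<theta>. orbit_numbering \<theta>"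
proof (intro exI)
  let ?\<theta> = "\<lambda>i. root_orbit (patterns ! i)"
  have root: "0 \<in> pverts (decode p bs)" if "(p, bs) \<in> set patterns" for p bs
    using that patterns_iff by (auto simp: decode_def)
  have orb: "is_orbit (root_orbit c)" "0 \<in> snd (root_orbit c)" if "c \<in> set patterns" for c
  proof -
    obtain p bs where c: "c = (p, bs)" by force
    have r: "0 \<in> pverts (decode p bs)" using root that c by simp
    show "is_orbit (root_orbit c)"
      using pattern_decode[of p bs] that c r by (auto simp: is_orbit_def root_orbit_def vertex_orbits_aut_rel quotient_def)
    show "0 \<in> snd (root_orbit c)"
      using r equiv_aut_rel equiv_class_self unfolding root_orbit_def c by fastforce
  qed
  have dist: "distinct patterns"
  proof -
    have "distinct (codes p (index_perms p))" for p
      unfolding codes_def by (intro distinct_filter distinct_n_lists) simp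
    then show ?thesis unfolding patterns_def by (auto simp: distinct_map inj_on_def)
  qed
  have "i = j" if ij: "i < 73" "j < 73" and same: "same_orbit (?\<theta> i) (?\<theta> j)" for i j
  proof -
    obtain p bs p' bs' where c: "patterns ! i = (p, bs)" "patterns ! j = (p', bs')" by (metis surj_pair)
    have m: "(p, bs) \<in> set patterns" "(p', bs') \<in> set patterns" using ij assms c nth_mem by metis+
    let ?H = "decode p bs" and ?H' = "decode p' bs'"
    obtain \<phi> where \<phi>: "isomorphism ?H ?H' \<phi>" "\<phi> ` (aut_rel ?H `` {0}) = aut_rel ?H' `` {0}"
      using same c by (auto simp: same_orbit_def root_orbit_def)
    have "\<phi> 0 \<in> aut_rel ?H' `` {0}"
      using orb(2)[OF m(1)] \<phi>(2) by (auto simp: root_orbit_def)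
    then have "(\<phi> 0, 0) \<in> aut_rel ?H'" using equiv_aut_rel[of ?H'] by (auto dest: equivE symD)
    then obtain \<tau> where t: "automorphism ?H' \<tau>" "\<tau> (\<phi> 0) = 0" by (auto simp: aut_rel_def)
    have "(p, bs) = (p', bs')"
      by (rule patterns_unique[OF m isomorphism_comp[OF \<phi>(1) t(1)]]) (simp add: t)
    then show "i = j" using c ij assms dist nth_eq_iff_index_eq by metis
  qed
  moreover have "\<exists>i<73. same_orbit \<tau> (?\<theta> i)" if t: "is_orbit \<tau>" for \<tau>
  proof -
    obtain H S where HS: "\<tau> = (H, S)" by force
    have H: "pattern H" and S: "S \<in> vertex_orbits H" using t HS by (auto simp: is_orbit_def)
    have "S \<noteq> {}" using S equiv_aut_rel[of H] in_quotient_imp_non_empty unfolding vertex_orbits_aut_rel by metis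
    then obtain a where a: "a \<in> S" by blast
    then have "a \<in> pverts H"
      using S equiv_aut_rel[of H] unfolding vertex_orbits_aut_rel by (meson in_quotient_imp_subset subsetD)
    then obtain p bs h where c: "(p, bs) \<in> set patterns" "isomorphism (decode p bs) H h" "h 0 = a"
      using pattern_classification[OF H] by blast
    obtain i where i: "i < 73" "patterns ! i = (p, bs)" using c(1) assms by (metis in_set_conv_nth)
    let ?i = "inv_into (pverts (decode p bs)) h"
    have "bij_betw h (pverts (decode p bs)) (pverts H)" using c(2) by (simp add: isomorphism_def)
    then have "?i a = 0" using root[OF c(1)] c(3) by (auto simp: bij_betw_def)
    moreover have inv: "isomorphism H (decode p bs) ?i" by (rule isomorphism_inv[OF c(2)])
    ultimately have "?i ` S = snd (root_orbit (p, bs))"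
      using orb[OF c(1)] S a by (intro orbit_isomorphism[OF inv, of _ _ a]) (auto simp: is_orbit_def root_orbit_def)
    then have "same_orbit \<tau> (?\<theta> i)" using inv i HS by (auto simp: same_orbit_def root_orbit_def)
    then show ?thesis using i(1) by blast
  qed
  ultimately show "orbit_numbering ?\<theta>"
    unfolding orbit_numbering_def using orb(1) assms by (auto simp: nth_mem)
qed

section \<open>The finite check on the rooted patterns\<close>

fun some_order :: "(nat \<times> nat) list \<Rightarrow> nat list list \<Rightarrow> bool" where
  "some_order E [] = False"
| "some_order E (us # uss) = (if elim E [] us then True else some_order E uss)"

lemma some_order_iff: "some_order E uss \<longleftrightarrow> (\<exists>us\<in>set uss. elim E [] us)"
  by (induction uss) auto

text \<open>The number \<open>n\<close> of classes and the search for elimination orders are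
  verified by one evaluation of the code list; the codes in \<open>exc\<close> are exempt from the
  search.\<close>

definition checked :: "nat \<Rightarrow> nat \<Rightarrow> bool list list \<Rightarrow> nat list list \<Rightarrow> bool list list \<Rightarrow> bool" where
  "checked p n exc uss cs \<longleftrightarrow> length cs = n \<and>
     list_all (\<lambda>bs. if bs \<in> set exc then True else some_order (edges_of p bs) uss) cs"

text \<open>The orders tried are all orders of the non-root vertices, as the root is never summed
  out. The class numbers add up to 1 + 3 + 11 + 58 = 73.\<close>

lemma codes2: "checked 2 1 [] (map tl (root_perms 2)) (codes 2 (index_perms 2))" by code_simp
lemma codes3: "checked 3 3 [] (map tl (root_perms 3)) (codes 3 (index_perms 3))" by code_simp
lemma codes4: "checked 4 11 [] (map tl (root_perms 4)) (codes 4 (index_perms 4))" by code_simp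

text \<open>The least code of the 5-cycle: the root is joined to 3 and 4, and the cycle is 0, 3, 2,
  1, 4.\<close>

definition C5_code :: "bool list" where
  "C5_code = [False, False, True, True, True, False, True, True, False, False]"
lemma codes5: "checked 5 58 [C5_code, replicate 10 True] (map tl (root_perms 5)) (codes 5 (index_perms 5))" by code_simp

section \<open>The 5-cycle\<close>

lemma nbr_onbr: "good G \<Longrightarrow> nbr G u v \<longleftrightarrow> onbr G u v \<or> onbr G v u"
proof -
  assume G: "good G"
  have "deg_less G u v \<or> deg_less G v u" if "u \<noteq> v" using that by (auto simp: deg_less_def)
  then have "nbr G u v \<Longrightarrow> onbr G u v \<or> onbr G v u"
    using good_arc(3,4)[OF G] unfolding orient_def by auto
  then show ?thesis using oarc_arc good_arc(3)[OF G] by blast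
qed

definition path_part :: "nat \<Rightarrow> nat \<Rightarrow> nat \<Rightarrow> nat \<Rightarrow> nat pair_pre_digraph \<Rightarrow> (nat \<Rightarrow> nat) \<Rightarrow> int" where
  "path_part i j k l G \<psi> = of_bool (onbr G (\<psi> k) (\<psi> j) \<and> onbr G (\<psi> k) (\<psi> l) \<and> onbr G (\<psi> j) (\<psi> i))"

text \<open>In an acyclic orientation of a 5-cycle, in general only one maximal directed path has
  two or more arcs, and it determines the position. The exception is a source joined to a sink by
  paths of length 2 and 3, where both qualify. Forbidding the directed path from \<open>l\<close>
  over \<open>m\<close> to \<open>i\<close> discards the shorter one.\<close>

definition wedge_part :: "nat \<Rightarrow> nat \<Rightarrow> nat \<Rightarrow> nat pair_pre_digraph \<Rightarrow> (nat \<Rightarrow> nat) \<Rightarrow> int" where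
  "wedge_part i l m G \<psi> = of_bool (nbr G (\<psi> m) (\<psi> i) \<and> nbr G (\<psi> m) (\<psi> l) \<and> \<not> (onbr G (\<psi> l) (\<psi> m) \<and> onbr G (\<psi> m) (\<psi> i)))"

lemma computable_path_part: "computable (path_part i j k l)"
proof -
  have "computable (\<lambda>G \<psi>. of_bool (onbr G (\<psi> k) (\<psi> j)) * (of_bool (onbr G (\<psi> k) (\<psi> l)) * of_bool (onbr G (\<psi> j) (\<psi> i))))"
    by (intro computable_mult computable_oarc)
  then show ?thesis by (rule computable_cong) (simp add: path_part_def of_bool_conj)
qed

lemma computable_wedge_part: "computable (wedge_part i l m)"
proof -
  have "computable (\<lambda>G \<psi>. of_bool (nbr G (\<psi> m) (\<psi> i)) * (of_bool (nbr G (\<psi> m) (\<psi> l)) *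
    (1 - of_bool (onbr G (\<psi> l) (\<psi> m)) * of_bool (onbr G (\<psi> m) (\<psi> i)))))"
    by (intro computable_mult computable_diff computable_const computable_oarc computable_arc)
  then show ?thesis by (rule computable_cong) (simp add: wedge_part_def)
qed

text \<open>The 3-path and the wedge share only \<open>i\<close> and \<open>l\<close>. One of them
  is first tabulated by these two variables, and the table becomes a factor in the enumeration of
  the other. The root must not be summed out, so the wedge goes first unless its private vertex
  \<open>m\<close> is the root.\<close>

lemma computable_cycle_part:
  assumes d: "distinct [i, j, k, l, m]" and V: "{i, j, k, l, m} = {0..<5}"
  shows "computable (\<lambda>G \<phi>. \<Sum>\<psi>\<in>asg (nV G) {1..<5} \<phi>. path_part i j k l G \<psi> * wedge_part i l m G \<psi>)"
proof -
  let ?path = "[(k, Rng 0), (j, Fam 3 [k]), (l, Fam 3 [k]), (i, Fam 3 [j])]"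
  have cp: "cheap ?path" by (rule cheap_dpath) (use d in auto)
  have cw: "cheap (star m [i, l])" by (rule cheap_star) (use d in auto)
  have vp: "vars ?path = {i, j, k, l}" by (auto simp: vars_def)
  have vw: "vars (star m [i, l]) = {i, l, m}" by (auto simp: vars_def star_def)
  have dp: "path_part i j k l G \<phi> = path_part i j k l G \<psi>" if "\<forall>x\<in>{i, j, k, l}. \<phi> x = \<psi> x" for G \<phi> \<psi>
    using that by (simp add: path_part_def)
  have dw: "wedge_part i l m G \<phi> = wedge_part i l m G \<psi>" if "\<forall>x\<in>{i, l, m}. \<phi> x = \<psi> x" for G \<phi> \<psi>
    using that by (simp add: wedge_part_def)
  have rp: "rel G ?path \<phi>" if "good G" "path_part i j k l G \<phi> \<noteq> 0" for G \<phi>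
    using that good_arc(1)[OF that(1) oarc_arc] by (auto simp: path_part_def rs_def)
  have rw: "rel G (star m [i, l]) \<phi>" if "good G" "wedge_part i l m G \<phi> \<noteq> 0" for G \<phi>
    using that good_arc(1)[OF that(1)] by (auto simp: wedge_part_def rs_def star_def)
  have U: "{1..<5} = {0..<5::nat} - {0}" by auto
  show ?thesis
  proof (cases "m = 0")
    case True
    let ?w = "\<lambda>G \<phi>. \<Sum>\<psi>\<in>asg (nV G) {j, k} \<phi>. path_part i j k l G \<psi>"
    have w: "computable ?w"
    proof (rule computable_elim[OF computable_path_part _ cp])
      show "path_part i j k l G \<phi> = path_part i j k l G \<psi>" if "\<forall>x\<in>vars ?path. \<phi> x = \<psi> x" for G \<phi> \<psi>
        by (rule dp) (use that in \<open>simp only: vp\<close>)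
      show "{j, k} \<subseteq> vars ?path" unfolding vp by auto
    qed (rule rp)
    have dep: "?w G \<phi> = ?w G \<psi>" if "\<forall>x\<in>{i, l}. \<phi> x = \<psi> x" for G \<phi> \<psi>
      by (rule sum_asg_cong[where V = "{i, j, k, l}", OF dp]) (use that d in auto)
    have W: "computable (\<lambda>G \<phi>. \<Sum>\<psi>\<in>asg (nV G) {i, l} \<phi>. ?w G \<psi> * wedge_part i l m G \<psi>)"
    proof (rule computable_elim[OF computable_mult[OF w computable_wedge_part] _ cw])
      fix G and \<phi> \<psi> :: "nat \<Rightarrow> nat" assume "\<forall>x\<in>vars (star m [i, l]). \<phi> x = \<psi> x"
      then have a: "\<forall>x\<in>{i, l, m}. \<phi> x = \<psi> x" unfolding vw .
      show "?w G \<phi> * wedge_part i l m G \<phi> = ?w G \<psi> * wedge_part i l m G \<psi>"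
        by (rule arg_cong2[where f = "(*)", OF dep dw[OF a]]) (use a in auto)
    next
      show "{i, l} \<subseteq> vars (star m [i, l])" unfolding vw by auto
    qed (use rw in auto)
    show ?thesis
    proof (rule computable_cong[OF W])
      fix G \<phi>
      have X: "{1..<5} = {i, l} \<union> {j, k}" unfolding U V[symmetric] using d True by auto
      have "(\<Sum>\<psi>\<in>asg (nV G) {1..<5} \<phi>. path_part i j k l G \<psi> * wedge_part i l m G \<psi>) =
        (\<Sum>\<psi>\<in>asg (nV G) {i, l} \<phi>. \<Sum>\<chi>\<in>asg (nV G) {j, k} \<psi>. path_part i j k l G \<chi> * wedge_part i l m G \<chi>)"
        unfolding X by (rule sum_asg_Un) (use d in auto)
      also have "\<dots> = (\<Sum>\<psi>\<in>asg (nV G) {i, l} \<phi>. ?w G \<psi> * wedge_part i l m G \<psi>)"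
        unfolding sum_distrib_right
      proof (intro sum.cong refl arg_cong2[where f = "(*)"] dw ballI)
        fix \<psi> \<chi> x assume "\<chi> \<in> asg (nV G) {j, k} \<psi>" "x \<in> {i, l, m}"
        then show "\<chi> x = \<psi> x" using d by (auto simp: asg_def)
      qed
      finally show "(\<Sum>\<psi>\<in>asg (nV G) {i, l} \<phi>. ?w G \<psi> * wedge_part i l m G \<psi>) =
        (\<Sum>\<psi>\<in>asg (nV G) {1..<5} \<phi>. path_part i j k l G \<psi> * wedge_part i l m G \<psi>)" by (rule sym)
    qed
  next
    case False
    let ?w = "\<lambda>G \<phi>. \<Sum>\<psi>\<in>asg (nV G) {m} \<phi>. wedge_part i l m G \<psi>"
    let ?X = "{i, j, k, l} - {0}"
    have w: "computable ?w"
    proof (rule computable_elim[OF computable_wedge_part _ cw])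
      show "wedge_part i l m G \<phi> = wedge_part i l m G \<psi>" if "\<forall>x\<in>vars (star m [i, l]). \<phi> x = \<psi> x" for G \<phi> \<psi>
        by (rule dw) (use that in \<open>simp only: vw\<close>)
      show "{m} \<subseteq> vars (star m [i, l])" unfolding vw by auto
    qed (rule rw)
    have dep: "?w G \<phi> = ?w G \<psi>" if "\<forall>x\<in>{i, l}. \<phi> x = \<psi> x" for G \<phi> \<psi>
      by (rule sum_asg_cong[where V = "{i, l, m}", OF dw]) (use that d in auto)
    have W: "computable (\<lambda>G \<phi>. \<Sum>\<psi>\<in>asg (nV G) ?X \<phi>. path_part i j k l G \<psi> * ?w G \<psi>)"
    proof (rule computable_elim[OF computable_mult[OF computable_path_part w] _ cp])
      fix G and \<phi> \<psi> :: "nat \<Rightarrow> nat" assume "\<forall>x\<in>vars ?path. \<phi> x = \<psi> x"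
      then have a: "\<forall>x\<in>{i, j, k, l}. \<phi> x = \<psi> x" unfolding vp .
      show "path_part i j k l G \<phi> * ?w G \<phi> = path_part i j k l G \<psi> * ?w G \<psi>"
        by (rule arg_cong2[where f = "(*)", OF dp[OF a] dep]) (use a in auto)
    next
      show "?X \<subseteq> vars ?path" unfolding vp by auto
    qed (use rp in auto)
    show ?thesis
    proof (rule computable_cong[OF W])
      fix G \<phi>
      have X: "{1..<5} = ?X \<union> {m}" unfolding U V[symmetric] using d False by auto
      have "(\<Sum>\<psi>\<in>asg (nV G) {1..<5} \<phi>. path_part i j k l G \<psi> * wedge_part i l m G \<psi>) =
        (\<Sum>\<psi>\<in>asg (nV G) ?X \<phi>. \<Sum>\<chi>\<in>asg (nV G) {m} \<psi>. path_part i j k l G \<chi> * wedge_part i l m G \<chi>)"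
        unfolding X by (rule sum_asg_Un) (use d in auto)
      also have "\<dots> = (\<Sum>\<psi>\<in>asg (nV G) ?X \<phi>. path_part i j k l G \<psi> * ?w G \<psi>)"
        unfolding sum_distrib_left
      proof (intro sum.cong refl arg_cong2[where f = "(*)"] dp ballI)
        fix \<psi> \<chi> x assume "\<chi> \<in> asg (nV G) {m} \<psi>" "x \<in> {i, j, k, l}"
        then show "\<chi> x = \<psi> x" using d by (auto simp: asg_def)
      qed
      finally show "(\<Sum>\<psi>\<in>asg (nV G) ?X \<phi>. path_part i j k l G \<psi> * ?w G \<psi>) =
        (\<Sum>\<psi>\<in>asg (nV G) {1..<5} \<phi>. path_part i j k l G \<psi> * wedge_part i l m G \<psi>)" by (rule sym)
    qed
  qed
qed

text \<open>An acyclic orientation of a 5-cycle has exactly one position that carries a directed 3-path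
  \<open>i \<leftarrow> j \<leftarrow> k \<rightarrow> l\<close> whose fifth vertex \<open>m\<close> does not satisfy \<open>l \<rightarrow> m \<rightarrow> i\<close>. Below, \<open>u\<close> and \<open>d\<close>
  tell which edges are directed along and against the cycle.\<close>

lemma cycle_orientation:
  fixes u0 u1 u2 u3 u4 d0 d1 d2 d3 d4 :: bool
  assumes "\<not> (u0 \<and> d0)" "\<not> (u1 \<and> d1)" "\<not> (u2 \<and> d2)" "\<not> (u3 \<and> d3)" "\<not> (u4 \<and> d4)"
    and "\<not> (u0 \<and> u1 \<and> u2 \<and> u3 \<and> u4)" "\<not> (d0 \<and> d1 \<and> d2 \<and> d3 \<and> d4)"
  shows "(of_bool ((u0 \<or> d0) \<and> (u1 \<or> d1) \<and> (u2 \<or> d2) \<and> (u3 \<or> d3) \<and> (u4 \<or> d4)) :: int) =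
    of_bool ((u0 \<and> d4 \<and> u1) \<and> (u2 \<or> d2) \<and> (u3 \<or> d3) \<and> \<not> (d3 \<and> d2)) +
    of_bool ((d4 \<and> u0 \<and> d3) \<and> (u2 \<or> d2) \<and> (u1 \<or> d1) \<and> \<not> (u1 \<and> u2)) +
    of_bool ((u1 \<and> d0 \<and> u2) \<and> (u3 \<or> d3) \<and> (u4 \<or> d4) \<and> \<not> (d4 \<and> d3)) +
    of_bool ((d0 \<and> u1 \<and> d4) \<and> (u3 \<or> d3) \<and> (u2 \<or> d2) \<and> \<not> (u2 \<and> u3)) +
    of_bool ((u2 \<and> d1 \<and> u3) \<and> (u4 \<or> d4) \<and> (u0 \<or> d0) \<and> \<not> (d0 \<and> d4)) +
    of_bool ((d1 \<and> u2 \<and> d0) \<and> (u4 \<or> d4) \<and> (u3 \<or> d3) \<and> \<not> (u3 \<and> u4)) +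
    of_bool ((u3 \<and> d2 \<and> u4) \<and> (u0 \<or> d0) \<and> (u1 \<or> d1) \<and> \<not> (d1 \<and> d0)) +
    of_bool ((d2 \<and> u3 \<and> d1) \<and> (u0 \<or> d0) \<and> (u4 \<or> d4) \<and> \<not> (u4 \<and> u0)) +
    of_bool ((u4 \<and> d3 \<and> u0) \<and> (u1 \<or> d1) \<and> (u2 \<or> d2) \<and> \<not> (d2 \<and> d1)) +
    of_bool ((d3 \<and> u4 \<and> d2) \<and> (u1 \<or> d1) \<and> (u0 \<or> d0) \<and> \<not> (u0 \<and> u1))"
proof (cases "(u0 \<or> d0) \<and> (u1 \<or> d1) \<and> (u2 \<or> d2) \<and> (u3 \<or> d3) \<and> (u4 \<or> d4)")
  case True
  then have "d0 = (\<not> u0)" "d1 = (\<not> u1)" "d2 = (\<not> u2)" "d3 = (\<not> u3)" "d4 = (\<not> u4)" using assms by auto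
  then show ?thesis using assms(6,7)
    by (simp only:) (cases u0; cases u1; cases u2; cases u3; cases u4; simp)
next
  case False
  then have "(\<not> u0 \<and> \<not> d0) \<or> (\<not> u1 \<and> \<not> d1) \<or> (\<not> u2 \<and> \<not> d2) \<or> (\<not> u3 \<and> \<not> d3) \<or> (\<not> u4 \<and> \<not> d4)" by blast
  then show ?thesis by (elim disjE conjE) simp_all
qed

definition cycle_edges :: "(nat \<times> nat) list" where
  "cycle_edges = [(0, 3), (0, 4), (1, 2), (1, 4), (2, 3)]"

text \<open>Each of the five vertices as \<open>k\<close>, in both directions around the cycle, in
  the order of the summands of \<open>cycle_orientation\<close>.\<close>

definition cycle_parts :: "(nat \<times> nat \<times> nat \<times> nat \<times> nat) list" where
  "cycle_parts = [(2, 3, 0, 4, 1), (1, 4, 0, 3, 2), (1, 2, 3, 0, 4), (4, 0, 3, 2, 1), (4, 1, 2, 3, 0), (0, 3, 2, 1, 4), (0, 4, 1, 2, 3), (3, 2, 1, 4, 0), (3, 0, 4, 1, 2), (2, 1, 4, 0, 3)]"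

lemma epr_cycle:
  assumes "good G"
  shows "epr cycle_edges G \<psi> = (\<Sum>(i, j, k, l, m)\<leftarrow>cycle_parts. path_part i j k l G \<psi> * wedge_part i l m G \<psi>)"
proof -
  have acyc: "\<not> (onbr G a b \<and> onbr G b c \<and> onbr G c d \<and> onbr G d e \<and> onbr G e a)" for a b c d e
    unfolding orient_def deg_less_def by auto
  note N = nbr_onbr[OF assms]
  note C = cycle_orientation[of "onbr G (\<psi> 0) (\<psi> 3)" "onbr G (\<psi> 3) (\<psi> 0)" "onbr G (\<psi> 3) (\<psi> 2)" "onbr G (\<psi> 2) (\<psi> 3)"
      "onbr G (\<psi> 2) (\<psi> 1)" "onbr G (\<psi> 1) (\<psi> 2)" "onbr G (\<psi> 1) (\<psi> 4)" "onbr G (\<psi> 4) (\<psi> 1)"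
      "onbr G (\<psi> 4) (\<psi> 0)" "onbr G (\<psi> 0) (\<psi> 4)"]
  have "epr cycle_edges G \<psi> = of_bool ((onbr G (\<psi> 0) (\<psi> 3) \<or> onbr G (\<psi> 3) (\<psi> 0)) \<and> (onbr G (\<psi> 3) (\<psi> 2) \<or> onbr G (\<psi> 2) (\<psi> 3)) \<and>
     (onbr G (\<psi> 2) (\<psi> 1) \<or> onbr G (\<psi> 1) (\<psi> 2)) \<and> (onbr G (\<psi> 1) (\<psi> 4) \<or> onbr G (\<psi> 4) (\<psi> 1)) \<and>
     (onbr G (\<psi> 4) (\<psi> 0) \<or> onbr G (\<psi> 0) (\<psi> 4)))"
    unfolding epr_def cycle_edges_def by (simp add: N) blast
  also have "\<dots> = (\<Sum>(i, j, k, l, m)\<leftarrow>cycle_parts. path_part i j k l G \<psi> * wedge_part i l m G \<psi>)"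
    apply (subst C)
    using onbr_asym acyc apply (blast+)[7]
    apply (simp only: cycle_parts_def list.map sum_list.Cons sum_list.Nil prod.case path_part_def wedge_part_def N of_bool_conj[symmetric] add.assoc add_0_right)
    apply (intro arg_cong2[where f = "(+)"] arg_cong[where f = of_bool]; blast)
    done
  finally show ?thesis .
qed

lemma sum_list_sum_swap: "(\<Sum>t\<leftarrow>ts. \<Sum>\<psi>\<in>A. f t \<psi>) = (\<Sum>\<psi>\<in>A. \<Sum>t\<leftarrow>ts. f t \<psi> :: int)"
  by (induction ts) (simp_all add: sum.distrib)

theorem computable_cycle: "computable (\<lambda>G \<phi>. \<Sum>\<psi>\<in>asg (nV G) {1..<5} \<phi>. epr cycle_edges G \<psi>)"
proof -
  let ?f = "\<lambda>(i, j, k, l, m) G \<psi>. path_part i j k l G \<psi> * wedge_part i l m G \<psi>"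
  have "computable (\<lambda>G \<phi>. \<Sum>t\<leftarrow>cycle_parts. \<Sum>\<psi>\<in>asg (nV G) {1..<5} \<phi>. ?f t G \<psi>)"
  proof (rule computable_sum_list)
    fix t assume t: "t \<in> set cycle_parts"
    obtain i j k l m where e: "t = (i, j, k, l, m)" by (cases t)
    have five: "{0..<5} = {0, 1, 2, 3, 4::nat}" by (auto simp: numeral_eq_Suc less_Suc_eq)
    have "distinct [i, j, k, l, m] \<and> {i, j, k, l, m} = {0..<5}"
      using t unfolding e cycle_parts_def five by (auto simp: insert_commute)
    then show "computable (\<lambda>G \<phi>. \<Sum>\<psi>\<in>asg (nV G) {1..<5} \<phi>. ?f t G \<psi>)"
      using computable_cycle_part[of i j k l m] unfolding e by simp
  qed
  then show ?thesis
  proof (rule computable_cong)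
    fix G \<phi> assume G: "good G"
    show "(\<Sum>t\<leftarrow>cycle_parts. \<Sum>\<psi>\<in>asg (nV G) {1..<5} \<phi>. ?f t G \<psi>) = (\<Sum>\<psi>\<in>asg (nV G) {1..<5} \<phi>. epr cycle_edges G \<psi>)"
      unfolding epr_cycle[OF G] sum_list_sum_swap
      by (intro sum.cong refl arg_cong[where f = sum_list] map_cong) auto
  qed
qed

section \<open>The 5-clique\<close>

lemma computable_sorted_clique:
  assumes xs: "distinct xs" "set xs = {0..<5}"
  shows "computable (\<lambda>G \<phi>. \<Sum>\<psi>\<in>asg (nV G) {1..<5} \<phi>. of_bool (sorted_wrt (\<lambda>x y. onbr G (\<psi> x) (\<psi> y)) xs))"
proof -
  have "length xs = 5" using xs distinct_card by fastforce
  then obtain a b c d e where abc: "xs = [a, b, c, d, e]" by (auto simp: numeral_eq_Suc length_Suc_conv)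
  let ?ls = "[(a, Rng 0), (b, Fam 3 [a]), (c, Fam 4 [a, b]), (d, Fam 5 [a, b, c]), (e, Fam 5 [a, b, c])]"
  let ?E = "[(a, b), (a, c), (a, d), (a, e), (b, c), (b, d), (b, e), (c, d), (c, e), (d, e)]"
  have "computable (\<lambda>G \<psi>. \<Prod>p\<leftarrow>?E. of_bool (onbr G (\<psi> (fst p)) (\<psi> (snd p))))"
    by (intro computable_prod_list computable_oarc)
  then have w: "computable (\<lambda>G \<psi>. of_bool (sorted_wrt (\<lambda>x y. onbr G (\<psi> x) (\<psi> y)) xs))"
    by (rule computable_cong) (simp add: abc)
  show ?thesis
  proof (rule computable_elim[OF w])
    show "cheap ?ls" by (rule cheap_dbipyramid) (use xs abc in simp)
    show "{1..<5} \<subseteq> vars ?ls" using xs(2) unfolding abc by (auto simp: vars_def)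
    fix G and \<phi> :: "nat \<Rightarrow> nat" assume "good G" "of_bool (sorted_wrt (\<lambda>x y. onbr G (\<phi> x) (\<phi> y)) xs) \<noteq> (0 :: int)"
    then show "rel G ?ls \<phi>" using good_arc(1)[OF _ oarc_arc, of G "\<phi> a" "\<phi> b"] oarc_arc
      by (auto simp: abc rs_def)
  next
    fix G and \<phi> \<psi> :: "nat \<Rightarrow> nat" assume "\<forall>x\<in>vars ?ls. \<phi> x = \<psi> x"
    then show "(of_bool (sorted_wrt (\<lambda>x y. onbr G (\<phi> x) (\<phi> y)) xs) :: int) = of_bool (sorted_wrt (\<lambda>x y. onbr G (\<psi> x) (\<psi> y)) xs)"
      by (simp add: abc)
  qed
qed

text \<open>The orientation is a strict total order on a clique, so exactly one order of the five
  variables is sorted, and on a non-clique none is. All orders are needed because the root may have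
  any position.\<close>

lemma clique_orders:
  assumes G: "good G" and E: "set E = {(i, j). i < j \<and> j < (5::nat)}"
  shows "epr E G \<psi> = (\<Sum>xs\<in>{xs. distinct xs \<and> set xs = {0..<5}}. of_bool (sorted_wrt (\<lambda>x y. onbr G (\<psi> x) (\<psi> y)) xs))"
proof -
  let ?P = "{xs. distinct xs \<and> set xs = {0..<5::nat}}"
  let ?s = "\<lambda>xs. sorted_wrt (\<lambda>x y. onbr G (\<psi> x) (\<psi> y)) xs"
  have "?P \<subseteq> {xs. set xs \<subseteq> {0..<5} \<and> length xs = 5}" using distinct_card by fastforce
  then have finP: "finite ?P" by (rule finite_subset) (rule finite_lists_length_eq, simp)
  have S: "(\<Sum>xs\<in>?P. of_bool (?s xs) :: int) = int (card {xs \<in> ?P. ?s xs})"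
    using finP by (simp add: of_bool_def sum.If_cases Int_def)
  show ?thesis
  proof (cases "\<forall>(i, j)\<in>set E. nbr G (\<psi> i) (\<psi> j)")
    case True
    \<comment> \<open>Degree and id packed into one number: ids are below \<open>nV G\<close>, so
      comparing \<open>f\<close> is the lexicographic comparison of \<open>deg_less\<close>.\<close>
    define f where "f x = out_degree (with_proj G) (\<psi> x) * nV G + \<psi> x" for x
    have nb: "nbr G (\<psi> x) (\<psi> y)" if "x < 5" "y < 5" "x \<noteq> y" for x y
      using that True good_arc(3)[OF G] unfolding E by (cases x y rule: linorder_cases) auto
    have lt: "\<psi> x < nV G" if "x < 5" for x
      using that nb[of x 1] nb[of x 0] good_arc(1)[OF G] by (cases "x = 0") auto
    have lex: "p * n + q < p' * n + q'" if "p < p'" "q < n" for p p' q q' n :: nat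
    proof -
      have "p * n + q < Suc p * n" using that by simp
      also have "\<dots> \<le> p' * n" using that by (intro mult_right_mono) auto
      finally show ?thesis by simp
    qed
    have f: "onbr G (\<psi> x) (\<psi> y) \<longleftrightarrow> f x < f y" if "x < 5" "y < 5" "x \<noteq> y" for x y
    proof -
      let ?p = "out_degree (with_proj G) (\<psi> x)" and ?q = "out_degree (with_proj G) (\<psi> y)"
      have "onbr G (\<psi> x) (\<psi> y) \<longleftrightarrow> deg_less G (\<psi> x) (\<psi> y)" using nb[OF that] by (simp add: orient_def)
      also have "\<dots> \<longleftrightarrow> f x < f y"
        using lex[of ?p ?q "\<psi> x" "nV G" "\<psi> y"] lex[of ?q ?p "\<psi> y" "nV G" "\<psi> x"] lt that
        unfolding deg_less_def f_def by (cases ?p ?q rule: linorder_cases) auto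
      finally show ?thesis .
    qed
    have inj: "inj_on f {0..<5}"
    proof (rule inj_onI, rule ccontr)
      fix x y assume xy: "x \<in> {0..<5}" "y \<in> {0..<5}" "f x = f y" "x \<noteq> y"
      then have "\<not> onbr G (\<psi> x) (\<psi> y)" "\<not> onbr G (\<psi> y) (\<psi> x)" using f[of x y] f[of y x] by auto
      then show False using nb[of x y] xy nbr_onbr[OF G] by auto
    qed
    have sf: "?s xs \<longleftrightarrow> sorted_wrt (<) (map f xs)" if "xs \<in> ?P" for xs
    proof -
      have "onbr G (\<psi> (xs ! i)) (\<psi> (xs ! j)) \<longleftrightarrow> f (xs ! i) < f (xs ! j)" if ij: "i < j" "j < length xs" for i j
      proof (rule f)
        have "xs ! i \<in> set xs" "xs ! j \<in> set xs" using ij by auto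
        then show "xs ! i < 5" "xs ! j < 5" using \<open>xs \<in> ?P\<close> by auto
        show "xs ! i \<noteq> xs ! j" using ij \<open>xs \<in> ?P\<close> by (simp add: nth_eq_iff_index_eq)
      qed
      then show ?thesis by (auto simp: sorted_wrt_iff_nth_less)
    qed
    let ?x0 = "sort_key f [0..<5]"
    have x0: "?x0 \<in> ?P" by auto
    have "sorted (map f ?x0)" "distinct (map f ?x0)" using inj x0 by (auto simp: distinct_map)
    then have s0: "sorted_wrt (<) (map f ?x0)" by (simp add: strict_sorted_iff)
    have "{xs \<in> ?P. ?s xs} = {?x0}"
    proof (intro equalityI subsetI)
      fix xs assume xs: "xs \<in> {xs \<in> ?P. ?s xs}"
      then have "map f xs = map f ?x0"
        using sf[of xs] s0 by (intro strict_sorted_equal) auto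
      then have "xs = ?x0" using inj xs by (subst (asm) inj_on_map_eq_map) auto
      then show "xs \<in> {?x0}" by simp
    qed (use x0 sf[OF x0] s0 in auto)
    then show ?thesis unfolding S using True by (simp add: epr_def)
  next
    case False
    then obtain i j where ij: "i < j" "j < 5" "\<not> nbr G (\<psi> i) (\<psi> j)" unfolding E by auto
    have emp: "{xs \<in> ?P. ?s xs} = {}"
    proof (rule ccontr)
      assume "{xs \<in> ?P. ?s xs} \<noteq> {}"
      then obtain xs where xs: "set xs = {0..<5}" "?s xs" by auto
      have "i \<in> set xs" "j \<in> set xs" using ij xs(1) by auto
      then obtain p q where pq: "p < length xs" "q < length xs" "xs ! p = i" "xs ! q = j"
        unfolding in_set_conv_nth by blast
      then have "p \<noteq> q" using ij by auto
      then have "onbr G (\<psi> i) (\<psi> j) \<or> onbr G (\<psi> j) (\<psi> i)"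
        using xs(2) pq by (cases p q rule: linorder_cases) (auto simp: sorted_wrt_iff_nth_less)
      then show False using ij(3) nbr_onbr[OF G] by blast
    qed
    have "epr E G \<psi> = 0" using False by (simp only: epr_def of_bool_eq)
    then show ?thesis unfolding S emp by simp
  qed
qed

theorem computable_clique:
  assumes E: "set E = {(i, j). i < j \<and> j < (5::nat)}"
  shows "computable (\<lambda>G \<phi>. \<Sum>\<psi>\<in>asg (nV G) {1..<5} \<phi>. epr E G \<psi>)"
proof -
  let ?P = "{xs. distinct xs \<and> set xs = {0..<5::nat}}"
  let ?f = "\<lambda>xs G \<psi>. of_bool (sorted_wrt (\<lambda>x y. onbr G (\<psi> x) (\<psi> y)) xs) :: int"
  have "?P \<subseteq> {xs. set xs \<subseteq> {0..<5} \<and> length xs = 5}" using distinct_card by fastforce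
  then have fin: "finite ?P" by (rule finite_subset) (rule finite_lists_length_eq, simp)
  obtain Ps where Ps: "set Ps = ?P" "distinct Ps" using finite_distinct_list[OF fin] by (elim exE conjE)
  have "computable (\<lambda>G \<phi>. \<Sum>xs\<leftarrow>Ps. \<Sum>\<psi>\<in>asg (nV G) {1..<5} \<phi>. ?f xs G \<psi>)"
    by (rule computable_sum_list, rule computable_sorted_clique) (use Ps in auto)
  then show ?thesis
  proof (rule computable_cong)
    fix G \<phi> assume G: "good G"
    show "(\<Sum>xs\<leftarrow>Ps. \<Sum>\<psi>\<in>asg (nV G) {1..<5} \<phi>. ?f xs G \<psi>) = (\<Sum>\<psi>\<in>asg (nV G) {1..<5} \<phi>. epr E G \<psi>)"
      unfolding clique_orders[OF G E] sum_list_distinct_conv_sum_set[OF Ps(2)] Ps(1) by (rule sum.swap)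
  qed
qed

section \<open>Homomorphism counts of patterns\<close>

lemma edges_of_C5: "edges_of 5 C5_code = cycle_edges"
  unfolding cycle_edges_def by code_simp

lemma edges_of_K5: "edges_of 5 (replicate 10 True) = pairs 5"
  by code_simp

lemma computable_codes:
  assumes c: "checked p n exc (map tl (root_perms p)) (codes p (index_perms p))"
    and bs: "bs \<in> set (codes p (index_perms p))" "bs \<notin> set exc" and p: "1 \<le> p"
  shows "computable (\<lambda>G \<phi>. \<Sum>\<psi>\<in>asg (nV G) {1..<p} \<phi>. epr (edges_of p bs) G \<psi>)"
proof -
  have "\<forall>bs\<in>set (codes p (index_perms p)). if bs \<in> set exc then True else some_order (edges_of p bs) (map tl (root_perms p))"
    using c unfolding checked_def list_all_iff by (rule conjunct2)
  then have "if bs \<in> set exc then True else some_order (edges_of p bs) (map tl (root_perms p))"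
    using bs(1) by (rule bspec)
  then have "some_order (edges_of p bs) (map tl (root_perms p))"
    unfolding if_not_P[OF bs(2)] .
  then obtain \<sigma> where \<sigma>: "\<sigma> \<in> set (root_perms p)" "elim (edges_of p bs) [] (tl \<sigma>)"
    unfolding some_order_iff by auto
  have len: "length \<sigma> = p" and b: "bij_betw ((!) \<sigma>) {..<p} {..<p}" and z: "\<sigma> ! 0 = 0"
    using root_perms_iff[OF p] \<sigma>(1) by auto
  have "distinct \<sigma>" using b len by (auto simp: distinct_conv_nth bij_betw_def inj_on_def)
  moreover have "set \<sigma> = {..<p}" using b len by (auto simp: set_conv_nth bij_betw_def)
  moreover obtain us where us: "\<sigma> = 0 # us" using len z p by (cases \<sigma>) auto
  ultimately have i: "distinct us" "0 \<notin> set us" "insert 0 (set us) = {..<p}" by simp_all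
  then have "set us = {..<p} - {0}" by (metis Diff_insert_absorb)
  also have "\<dots> = {1..<p}" by auto
  finally have d: "distinct us" "set us = {1..<p}" using i(1) by simp_all
  have "computable (\<lambda>G \<phi>. \<Sum>\<psi>\<in>asg (nV G) (set us) \<phi>. epr (edges_of p bs) G \<psi> * fprod [] G \<psi>)"
    by (rule computable_elimination) (use \<sigma>(2) us d in auto)
  then show ?thesis by (simp add: d(2) fprod_def)
qed

lemma computable_pattern:
  assumes "(p, bs) \<in> set patterns"
  shows "computable (\<lambda>G \<phi>. \<Sum>\<psi>\<in>asg (nV G) {1..<p} \<phi>. epr (edges_of p bs) G \<psi>)"
proof -
  have p: "p \<in> {2..5}" and bs: "bs \<in> set (codes p (index_perms p))" using assms patterns_iff by auto
  then consider "p = 2" | "p = 3" | "p = 4" | "p = 5" "bs \<notin> {C5_code, replicate 10 True}"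
    | "p = 5" "bs = C5_code" | "p = 5" "bs = replicate 10 True" by fastforce
  then show ?thesis
  proof cases
    case 1
    then show ?thesis using computable_codes[OF codes2, of bs] bs by simp
  next
    case 2
    then show ?thesis using computable_codes[OF codes3, of bs] bs by simp
  next
    case 3
    then show ?thesis using computable_codes[OF codes4, of bs] bs by simp
  next
    case 4
    then show ?thesis using computable_codes[OF codes5, of bs] bs by simp
  next
    case 5
    then show ?thesis using computable_cycle by (simp only: edges_of_C5)
  next
    case 6
    then show ?thesis using computable_clique[of "pairs 5"] set_pairs[of 5] by (simp only: edges_of_K5)
  qed
qed

lemma length_patterns: "length patterns = 73"
  using codes2 codes3 codes4 codes5 by (simp add: patterns_def checked_def)

section \<open>Counts as functions of the root\<close>

definition computable_count :: "(nat pair_pre_digraph \<Rightarrow> nat \<Rightarrow> nat) \<Rightarrow> bool" where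
  "computable_count F \<longleftrightarrow> computable (\<lambda>G \<phi>. int (F G (\<phi> 0)))"

lemma computable_count_cong:
  assumes "computable_count F" "\<And>G v. good G \<Longrightarrow> F G v = F' G v"
  shows "computable_count F'"
  using assms(1) unfolding computable_count_def by (rule computable_cong) (simp add: assms(2))

lemma computable_count_zero: "computable_count (\<lambda>G v. 0)"
  unfolding computable_count_def by (simp add: computable_const)

lemma computable_count_diff:
  assumes "computable_count F" "computable_count F'" "\<And>G v. good G \<Longrightarrow> F G v = F'' G v + F' G v"
  shows "computable_count F''"
proof -
  have "computable (\<lambda>G \<phi>. int (F G (\<phi> 0)) - int (F' G (\<phi> 0)))"
    using assms(1,2) unfolding computable_count_def by (rule computable_diff)
  then show ?thesis unfolding computable_count_def by (rule computable_cong) (simp add: assms(3))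
qed

text \<open>The root variable is not summed over and may hold any number up to \<open>Mx G\<close>;
  the indicator confines it to the vertices.\<close>

lemma rooted_count_decode:
  assumes G: "good G" and p: "1 \<le> p" and len: "length bs = length (pairs p)"
  shows "int (rooted_count G {..<p} (parcs (decode p bs)) {} 0 (\<phi> 0)) =
    of_bool (\<phi> 0 < nV G) * (\<Sum>\<psi>\<in>asg (nV G) {1..<p} \<phi>. epr (edges_of p bs) G \<psi>)"
proof (cases "\<phi> 0 < nV G")
  case False
  then have "rooted_maps G {..<p} (parcs (decode p bs)) {} 0 (\<phi> 0) = {}"
  proof (intro equals0I)
    fix f assume "f \<in> rooted_maps G {..<p} (parcs (decode p bs)) {} 0 (\<phi> 0)"
    then have "f \<in> {..<p} \<rightarrow>\<^sub>E {..<nV G}" "f 0 = \<phi> 0" using good_pverts[OF G] by (auto simp: rooted_maps_def)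
    moreover from this(1) have "f 0 \<in> {..<nV G}" by (rule PiE_mem) (use p in simp)
    ultimately show False using False by simp
  qed
  then show ?thesis using False by (simp add: rooted_count_def)
next
  case True
  let ?R = "rooted_maps G {..<p} (parcs (decode p bs)) {} 0 (\<phi> 0)"
  let ?E = "set (edges_of p bs)"
  let ?A = "{\<psi> \<in> asg (nV G) {1..<p} \<phi>. \<forall>(x, y)\<in>?E. nbr G (\<psi> x) (\<psi> y)}"
  have "?E \<subseteq> set (pairs p)" unfolding edges_of_def by (auto dest: set_zip_leftD)
  then have lt: "x < p \<and> y < p" if "(x, y) \<in> ?E" for x y using that by (force simp: set_pairs)
  have hom: "(\<forall>(x, y)\<in>parcs (decode p bs). nbr G (f x) (f y)) \<longleftrightarrow> (\<forall>(x, y)\<in>?E. nbr G (f x) (f y))" for f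
    using good_arc(3)[OF G] unfolding decode_def by auto
  have "bij_betw (\<lambda>\<psi>. restrict \<psi> {..<p}) ?A ?R"
  proof (rule bij_betwI[where g = "\<lambda>f x. if x < p then f x else \<phi> x"])
    show "(\<lambda>\<psi>. restrict \<psi> {..<p}) \<in> ?A \<rightarrow> ?R"
    proof
      fix \<psi> assume \<psi>: "\<psi> \<in> ?A"
      then have r: "\<And>x. 1 \<le> x \<Longrightarrow> x < p \<Longrightarrow> \<psi> x < nV G" "\<psi> 0 = \<phi> 0" by (auto simp: asg_def)
      have r': "\<psi> x < nV G" if "x < p" for x using r that True by (cases "x = 0") auto
      have "\<forall>(x, y)\<in>?E. nbr G (restrict \<psi> {..<p} x) (restrict \<psi> {..<p} y)" using \<psi> lt by auto
      then show "restrict \<psi> {..<p} \<in> ?R"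
        unfolding rooted_maps_def mem_Collect_eq hom using r r' p good_pverts[OF G] by auto
    qed
    show "(\<lambda>f x. if x < p then f x else \<phi> x) \<in> ?R \<rightarrow> ?A"
    proof
      fix f assume f: "f \<in> ?R"
      let ?\<psi> = "\<lambda>x. if x < p then f x else \<phi> x"
      have f0: "f 0 = \<phi> 0" and fV: "\<And>x. x < p \<Longrightarrow> f x < nV G" and fE: "\<forall>(x, y)\<in>?E. nbr G (f x) (f y)"
        using f good_pverts[OF G] unfolding rooted_maps_def mem_Collect_eq hom by auto
      have "?\<psi> x = \<phi> x" if "x \<notin> {1..<p}" for x using that f0 by (cases "x = 0") auto
      then have "?\<psi> \<in> asg (nV G) {1..<p} \<phi>" using fV by (simp add: asg_def)
      moreover have "\<forall>(x, y)\<in>?E. nbr G (?\<psi> x) (?\<psi> y)" using fE lt by auto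
      ultimately show "?\<psi> \<in> ?A" by blast
    qed
  next
    fix \<psi> assume "\<psi> \<in> ?A"
    then have o: "\<And>x. x \<notin> {1..<p} \<Longrightarrow> \<psi> x = \<phi> x" by (auto simp: asg_def)
    show "(\<lambda>x. if x < p then restrict \<psi> {..<p} x else \<phi> x) = \<psi>"
    proof
      fix x show "(if x < p then restrict \<psi> {..<p} x else \<phi> x) = \<psi> x" using o[of x] by simp
    qed
  next
    fix f assume "f \<in> ?R"
    then have "f \<in> extensional {..<p}" by (auto simp: rooted_maps_def PiE_def)
    then show "restrict (\<lambda>x. if x < p then f x else \<phi> x) {..<p} = f"
      by (intro extensionalityI[of _ "{..<p}"]) auto
  qed
  then have "rooted_count G {..<p} (parcs (decode p bs)) {} 0 (\<phi> 0) = card ?A"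
    unfolding rooted_count_def by (rule bij_betw_same_card[symmetric])
  moreover have "(\<Sum>\<psi>\<in>asg (nV G) {1..<p} \<phi>. epr (edges_of p bs) G \<psi>) = int (card ?A)"
    unfolding epr_def using finite_asg[of "{1..<p}" "nV G" \<phi>] by (simp add: of_bool_def sum.If_cases Int_def)
  ultimately show ?thesis using True by simp
qed

text \<open>Loops are allowed because contractions may produce them; they admit no homomorphism.\<close>

definition rooted_conn :: "nat set \<Rightarrow> (nat \<times> nat) set \<Rightarrow> nat \<Rightarrow> bool" where
  "rooted_conn V E a \<longleftrightarrow> finite V \<and> card V \<le> 5 \<and> a \<in> V \<and> E \<subseteq> V \<times> V \<and> sym E \<and> cut_conn V E"

text \<open>A loop admits no homomorphism into a simple graph, a lone vertex is too small to be a
  pattern and is counted directly, and everything else is isomorphic to a classified rooted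
  pattern.\<close>

lemma computable_hom:
  assumes "rooted_conn V E a"
  shows "computable_count (\<lambda>G v. rooted_count G V E {} a v)"
proof -
  have V: "finite V" "card V \<le> 5" "a \<in> V" "E \<subseteq> V \<times> V" "sym E" "cut_conn V E"
    using assms by (simp_all add: rooted_conn_def)
  consider (loop) x where "(x, x) \<in> E" | (single) "V = {a}" "\<And>x. (x, x) \<notin> E" | (pat) "2 \<le> card V" "\<And>x. (x, x) \<notin> E"
  proof (cases "\<exists>x. (x, x) \<in> E")
    case False
    show ?thesis
    proof (cases "card V = 1")
      case True
      then obtain b where "V = {b}" by (rule card_1_singletonE)
      then show ?thesis using that(2) V(3) False by auto
    next
      case False
      moreover have "card V \<noteq> 0" using V by auto
      ultimately show ?thesis using that(3) \<open>\<not> (\<exists>x. (x, x) \<in> E)\<close> by auto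
    qed
  qed (use that in blast)
  then show ?thesis
  proof cases
    case loop
    show ?thesis
    proof (rule computable_count_cong[OF computable_count_zero])
      fix G and v :: nat assume "good G"
      then have "rooted_maps G V E {} a v = {}" using good_arc(4)[of G] loop by (fastforce simp: rooted_maps_def)
      then show "0 = rooted_count G V E {} a v" by (simp add: rooted_count_def)
    qed
  next
    case single
    then have E: "E = {}" using V(4) by auto
    have "computable_count (\<lambda>G v. of_bool (v < nV G))"
      unfolding computable_count_def using computable_lt[of 0] by simp
    then show ?thesis
    proof (rule computable_count_cong)
      fix G and v :: nat assume G: "good G"
      have "rooted_maps G V E {} a v = (if v < nV G then {\<lambda>x\<in>{a}. v} else {})"
        unfolding rooted_maps_def E single(1) good_pverts[OF G]
        by (auto simp: PiE_iff extensional_def fun_eq_iff)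
      then show "of_bool (v < nV G) = rooted_count G V E {} a v" by (simp add: rooted_count_def)
    qed
  next
    case pat
    let ?H = "\<lparr>pverts = V, parcs = E\<rparr>"
    have "finite E" using V finite_subset by (meson finite_SigmaI)
    then have pg: "pair_graph ?H"
      using V pat(2) by unfold_locales (auto simp: symmetric_def)
    have "connected (with_proj ?H)" using connected_cut_conn[OF pg] V(3,6) by auto
    then have "pattern ?H" using pg pat V(2) by (simp add: pattern_def)
    then obtain p bs h where c: "(p, bs) \<in> set patterns" "isomorphism (decode p bs) ?H h" "h 0 = a"
      using pattern_classification[of ?H a] V(3) by auto
    have p: "1 \<le> p" and len: "length bs = length (pairs p)"
      using c(1) patterns_iff codes_iff by auto
    have pg': "pair_graph (decode p bs)" by (rule pair_graph_decode[OF len])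
    have h: "bij_betw h {..<p} V" using c(2) by (simp add: isomorphism_def decode_def)
    have E: "E = map_prod h h ` parcs (decode p bs)"
      using isomorphism_image(2)[OF c(2) pair_graph_parcs[OF pg'] pair_graph_parcs[OF pg]] by simp
    have sub: "parcs (decode p bs) \<subseteq> {..<p} \<times> {..<p}" using pair_graph_parcs[OF pg'] by (simp add: decode_def)
    have "computable (\<lambda>G \<phi>. of_bool (\<phi> 0 < nV G) * (\<Sum>\<psi>\<in>asg (nV G) {1..<p} \<phi>. epr (edges_of p bs) G \<psi>))"
      by (intro computable_mult computable_lt computable_pattern[OF c(1)])
    then have "computable_count (\<lambda>G v. rooted_count G {..<p} (parcs (decode p bs)) {} 0 v)"
      unfolding computable_count_def
      by (rule computable_cong) (rule rooted_count_decode[OF _ p len, symmetric])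
    then show ?thesis
    proof (rule computable_count_cong)
      fix G v
      show "rooted_count G {..<p} (parcs (decode p bs)) {} 0 v = rooted_count G V E {} a v"
        using rooted_count_iso[OF h _ sub, of 0 "{}" G v] p unfolding E[symmetric] c(3) by simp
    qed
  qed
qed

lemma rooted_maps_swap: "rooted_maps G V E (insert (x, y) Q) a v = rooted_maps G V E (insert (y, x) Q) a v"
  unfolding rooted_maps_def by auto

text \<open>Induction on the number of disequalities: deletion and contraction both have fewer. The
  graph shrinks under contraction, hence the induction over all connected rooted graphs and not only
  over patterns.\<close>

lemma computable_rooted_count:
  assumes "rooted_conn V E a" "Q \<subseteq> V \<times> V"
  shows "computable_count (\<lambda>G v. rooted_count G V E Q a v)"
  using assms
proof (induction "card Q" arbitrary: V E Q rule: less_induct)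
  case less
  have V: "finite V" "card V \<le> 5" "a \<in> V" "E \<subseteq> V \<times> V" "sym E" "cut_conn V E"
    using less.prems(1) by (simp_all add: rooted_conn_def)
  have finQ: "finite Q" using less.prems(2) V(1) by (meson finite_SigmaI finite_subset)
  have step: "computable_count (\<lambda>G v. rooted_count G V E (insert (x, y) Q') a v)"
    if Q': "card Q' < card Q" "finite Q'" "Q' \<subseteq> V \<times> V" and xy: "x \<in> V" "y \<in> V" "x \<noteq> y" "y \<noteq> a" for x y Q'
  proof (rule computable_count_diff)
    let ?\<rho> = "id(y := x)"
    show "computable_count (\<lambda>G v. rooted_count G V E Q' a v)"
      by (rule less.hyps[OF Q'(1) less.prems(1) Q'(3)])
    have \<rho>V: "?\<rho> ` V = V - {y}" using xy by (auto simp: image_iff)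
    then have m: "?\<rho> z \<in> V - {y}" if "z \<in> V" for z using that by blast
    have "rooted_conn (V - {y}) (map_prod ?\<rho> ?\<rho> ` E) a"
      unfolding rooted_conn_def
    proof (intro conjI)
      show "card (V - {y}) \<le> 5" using V(1,2) card_Diff1_le[of V y] by simp
      show "cut_conn (V - {y}) (map_prod ?\<rho> ?\<rho> ` E)" using cut_conn_image[OF V(6,4), of ?\<rho>] unfolding \<rho>V .
      show "map_prod ?\<rho> ?\<rho> ` E \<subseteq> (V - {y}) \<times> (V - {y})"
      proof
        fix e assume "e \<in> map_prod ?\<rho> ?\<rho> ` E"
        then obtain p q where "(p, q) \<in> E" "e = (?\<rho> p, ?\<rho> q)" by auto
        then show "e \<in> (V - {y}) \<times> (V - {y})" using m[of p] m[of q] V(4) by blast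
      qed
      show "sym (map_prod ?\<rho> ?\<rho> ` E)" using V(5) unfolding sym_def by (auto simp: image_iff Bex_def)
    qed (use V xy in auto)
    moreover have "map_prod ?\<rho> ?\<rho> ` Q' \<subseteq> (V - {y}) \<times> (V - {y})"
    proof
      fix e assume "e \<in> map_prod ?\<rho> ?\<rho> ` Q'"
      then obtain p q where "(p, q) \<in> Q'" "e = (?\<rho> p, ?\<rho> q)" by auto
      then show "e \<in> (V - {y}) \<times> (V - {y})" using m[of p] m[of q] Q'(3) by blast
    qed
    moreover have "card (map_prod ?\<rho> ?\<rho> ` Q') < card Q" using card_image_le[OF Q'(2)] Q'(1) by (rule le_less_trans)
    ultimately show "computable_count (\<lambda>G v. rooted_count G (V - {y}) (map_prod ?\<rho> ?\<rho> ` E) (map_prod ?\<rho> ?\<rho> ` Q') a v)"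
      by (intro less.hyps)
    fix G and v :: nat assume G: "good G"
    show "rooted_count G V E Q' a v = rooted_count G V E (insert (x, y) Q') a v +
      rooted_count G (V - {y}) (map_prod ?\<rho> ?\<rho> ` E) (map_prod ?\<rho> ?\<rho> ` Q') a v"
      by (rule rooted_count_contract) (use V xy Q' good_pverts[OF G] in auto)
  qed
  show ?case
  proof (cases "Q = {}")
    case True
    then show ?thesis using computable_hom[OF less.prems(1)] by simp
  next
    case False
    then obtain x y where xy: "(x, y) \<in> Q" by auto
    then have xyV: "x \<in> V" "y \<in> V" using less.prems(2) by auto
    let ?Q = "Q - {(x, y)}"
    have Q: "insert (x, y) ?Q = Q" using xy by blast
    have c: "card ?Q < card Q" "finite ?Q" "?Q \<subseteq> V \<times> V"
      using card_Diff1_less[OF finQ xy] finQ less.prems(2) by blast+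
    \<comment> \<open>Contractions may produce a pair of equal vertices, and then there is no map.
      Otherwise the pair is oriented so that the vertex merged away is not the root.\<close>
    consider "x = y" | "x \<noteq> y" "y \<noteq> a" | "x \<noteq> y" "x \<noteq> a" by blast
    then show ?thesis
    proof cases
      case 1
      then have emp: "rooted_maps G V E Q a v = {}" for G :: "nat pair_pre_digraph" and v
        using xy by (auto simp: rooted_maps_def)
      show ?thesis
        by (rule computable_count_cong[OF computable_count_zero]) (simp add: rooted_count_def emp)
    next
      case 2
      then show ?thesis using step[OF c xyV] unfolding Q by blast
    next
      case 3
      then have "computable_count (\<lambda>G v. rooted_count G V E (insert (y, x) ?Q) a v)"
        using step[OF c xyV(2,1)] by blast
      then show ?thesis unfolding rooted_count_def rooted_maps_swap[of _ _ _ y x] Q .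
    qed
  qed
qed

text \<open>The number of automorphisms is a constant of the pattern, so the program divides the sum
  of embedding counts over the roots in \<open>S\<close> by it; the division is exact.\<close>

theorem computable_DM:
  assumes "is_orbit \<tau>" shows "computable_count (\<lambda>G v. DM G v \<tau>)"
proof -
  obtain H S where \<tau>: "\<tau> = (H, S)" by force
  have H: "pattern H" and S: "S \<in> vertex_orbits H" using assms \<tau> by (auto simp: is_orbit_def)
  have pg: "pair_graph H" and conn: "connected (with_proj H)" and card: "2 \<le> card (pverts H)" "card (pverts H) \<le> 5"
    using H by (auto simp: pattern_def)
  interpret H: pair_graph H by (rule pg)
  have fin: "finite (pverts H)" by (rule H.pair_finite_verts)
  have SV: "S \<subseteq> pverts H"
    using S equiv_aut_rel[of H] unfolding vertex_orbits_aut_rel by (meson in_quotient_imp_subset)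
  let ?Q = "{(x, y). x \<in> pverts H \<and> y \<in> pverts H \<and> x \<noteq> y}"
  let ?A = "int (card (auts H))"
  have rc: "rooted_conn (pverts H) (parcs H) a" if "a \<in> S" for a
  proof -
    have "a \<in> pverts H" using that SV by blast
    moreover have "sym (parcs H)" using H.arcs_symmetric by (auto intro!: symI)
    moreover have "cut_conn (pverts H) (parcs H)" using connected_cut_conn[OF pg] conn \<open>a \<in> pverts H\<close> by blast
    ultimately show ?thesis using fin card(2) pair_graph_parcs[OF pg] by (simp add: rooted_conn_def)
  qed
  have "finite S" using SV fin finite_subset by blast
  then obtain as where as: "set as = S" "distinct as" using finite_distinct_list by auto
  have "computable (\<lambda>G \<phi>. \<Sum>a\<leftarrow>as. int (rooted_count G (pverts H) (parcs H) ?Q a (\<phi> 0)))"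
    by (rule computable_sum_list, rule computable_rooted_count[unfolded computable_count_def])
      (use rc as in auto)
  then have "computable (\<lambda>G \<phi>. (\<Sum>a\<leftarrow>as. int (rooted_count G (pverts H) (parcs H) ?Q a (\<phi> 0))) div ?A)"
    by (rule computable_div) (use card_auts_pos[OF fin] in simp)
  then show ?thesis
    unfolding computable_count_def
  proof (rule computable_cong)
    fix G and \<phi> :: "nat \<Rightarrow> nat" assume "good G"
    then have "finite (pverts G)" by (simp add: good_pverts)
    then have "card (auts H) * DM G (\<phi> 0) \<tau> = (\<Sum>a\<in>S. card {f \<in> embeddings H G. f a = \<phi> 0})"
      unfolding \<tau> by (rule DM_embeddings[OF fin _ S])
    also have "\<dots> = (\<Sum>a\<in>S. rooted_count G (pverts H) (parcs H) ?Q a (\<phi> 0))"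
      unfolding embeddings_rooted[OF pair_graph_parcs[OF pg]] rooted_count_def by (rule refl)
    finally have "?A * int (DM G (\<phi> 0) \<tau>) = (\<Sum>a\<leftarrow>as. int (rooted_count G (pverts H) (parcs H) ?Q a (\<phi> 0)))"
      using as by (simp add: sum_list_distinct_conv_sum_set flip: of_nat_mult)
    then show "(\<Sum>a\<leftarrow>as. int (rooted_count G (pverts H) (parcs H) ?Q a (\<phi> 0))) div ?A = int (DM G (\<phi> 0) \<tau>)"
      using card_auts_pos[OF fin] by (metis nonzero_mult_div_cancel_left of_nat_0_less_iff less_irrefl)
  qed
qed

section \<open>Writing the output\<close>

lemma wp_write_output:
  assumes G: "good G" and B: "int (Mx G) < B" "2 \<le> B" "int i \<le> B" and N: "2 \<le> N"
    and s: "loose G s" and e: "evaluates G B (tabs s) N e (\<lambda>G \<phi>. int (F G (\<phi> 0)))"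
  shows "wp B (nest [(0, Rng 0)] (Store 1 [rvar 0, Const (int i)] e)) (nest_cost [(0, Rng 0)] (3 + cost e) * budget G)
    (\<lambda>s'. loose G s' \<and> (\<forall>h. h \<noteq> 1 \<longrightarrow> tabs s' h = tabs s h) \<and>
      (\<forall>v<nV G. tabs s' 1 [int v, int i] = int (F G v)) \<and>
      (\<forall>key. (\<forall>v. key \<noteq> [v, int i]) \<longrightarrow> tabs s' 1 key = tabs s 1 key)) s"
proof -
  let ?ls = "[(0, Rng 0)]"
  define \<phi>0 where "\<phi>0 x = nat (regs s (var x))" for x
  have st: "st (rs G) (Mx G) \<phi>0 (vars ?ls) s" using s unfolding st_def \<phi>0_def by auto
  let ?tr = "trace (rs G) (\<lambda>_ _. []) ?ls \<phi>0"
  define I where "I pre T \<longleftrightarrow> (\<forall>h. h \<noteq> 1 \<longrightarrow> T h = tabs s h) \<and>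
    (\<forall>\<phi>\<in>set pre. T 1 [int (\<phi> 0), int i] = int (F G (\<phi> 0))) \<and>
    (\<forall>key. (\<forall>v. key \<noteq> [v, int i]) \<longrightarrow> T 1 key = tabs s 1 key)" for pre :: "(nat \<Rightarrow> nat) list" and T
  have str: "stored (tabs s) (fam G) {} (\<lambda>_ _. [])" by (simp add: stored_def)
  have "wp B (nest ?ls (Store 1 [rvar 0, Const (int i)] e)) (nest_cost ?ls (3 + cost e) * nsteps (rs G) (fam G) ?ls \<phi>0)
    (\<lambda>s'. st (rs G) (Mx G) (\<lambda>_. 0) UNIV s' \<and> I ?tr (tabs s')) s"
  proof (rule wp_nest_stored[OF B(1,2) _ _ _ _ str _ _ _ _ st])
    show "rs G 0 \<le> Mx G" "rs G 1 \<le> Mx G" by (auto simp: rs_def Mx_def)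
    show "I [] (tabs s)" by (simp add: I_def)
    fix pre \<phi> post and s' :: ram
    assume I: "I pre (tabs s')" and pin: "pinned G \<phi> s'"
    have t: "\<forall>h. 2 \<le> h \<and> h < N \<longrightarrow> tabs s' h = tabs s h" using I by (simp add: I_def)
    have e': "fits B s' e" "val s' e = int (F G (\<phi> 0))" using e t pin unfolding evaluates_def by blast+
    have r: "regs s' (var 0) = int (\<phi> 0)" using pin unfolding st_def by blast
    show "wp B (Store 1 [rvar 0, Const (int i)] e) (3 + cost e) (\<lambda>s''. regs s'' = regs s' \<and> I (pre @ [\<phi>]) (tabs s'')) s'"
    proof (rule wp_Store[OF e'(1)])
      show "\<forall>k\<in>set [rvar 0, Const (int i)]. fits B s' k" using fits_rvar[OF pin B(1), of 0] B(3) by simp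
      show "1 + cost e + sum_list (map cost [rvar 0, Const (int i)]) \<le> 3 + cost e" by simp
      show "regs (s'\<lparr>tabs := (tabs s')(1 := (tabs s' 1)(map (val s') [rvar 0, Const (int i)] := val s' e))\<rparr>) = regs s' \<and>
        I (pre @ [\<phi>]) (tabs (s'\<lparr>tabs := (tabs s')(1 := (tabs s' 1)(map (val s') [rvar 0, Const (int i)] := val s' e))\<rparr>))"
        using I r e'(2) unfolding I_def by simp
    qed
  qed (auto simp: I_def)
  then show ?thesis
  proof (rule wp_mono)
    have "nsteps (rs G) (fam G) ?ls \<phi>0 \<le> budget G" by (simp add: rs_def budget_def)
    then show "nest_cost ?ls (3 + cost e) * nsteps (rs G) (fam G) ?ls \<phi>0 \<le> nest_cost ?ls (3 + cost e) * budget G"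
      by (rule mult_le_mono2)
  next
    fix s' assume a: "st (rs G) (Mx G) (\<lambda>_. 0) UNIV s' \<and> I ?tr (tabs s')"
    have "tabs s' 1 [int v, int i] = int (F G v)" if "v < nV G" for v
    proof -
      have "\<phi>0(0 := v) \<in> set ?tr" using that by (simp add: rs_def)
      then have "tabs s' 1 [int ((\<phi>0(0 := v)) 0), int i] = int (F G ((\<phi>0(0 := v)) 0))"
        using a unfolding I_def by blast
      then show ?thesis by simp
    qed
    then show "loose G s' \<and> (\<forall>h. h \<noteq> 1 \<longrightarrow> tabs s' h = tabs s h) \<and>
      (\<forall>v<nV G. tabs s' 1 [int v, int i] = int (F G v)) \<and>
      (\<forall>key. (\<forall>v. key \<noteq> [v, int i]) \<longrightarrow> tabs s' 1 key = tabs s 1 key)"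
      using a unfolding I_def by blast
  qed
qed

text \<open>One column of table 1 for each function. The tables used for earlier columns are not
  reused, and writing a column leaves the other columns alone.\<close>

lemma wp_outputs:
  assumes "\<forall>i<K. computable_count (F i)"
  shows "\<exists>P N c k. 6 \<le> N \<and> (\<forall>G B s. good G \<and> (int (nV G) + 2) ^ k \<le> B \<and> loose G s \<and> ready G (tabs s) \<and>
      (\<forall>h\<ge>6. tabs s h = (\<lambda>_. 0)) \<longrightarrow>
    wp B P (c * budget G) (\<lambda>s'. loose G s' \<and> ready G (tabs s') \<and> (\<forall>h\<ge>N. tabs s' h = (\<lambda>_. 0)) \<and>
      (\<forall>i<K. \<forall>v<nV G. tabs s' 1 [int v, int i] = int (F i G v))) s)"
  using assms
proof (induction K)
  case 0
  have "wp B Skip (1 * budget G) (\<lambda>s'. loose G s' \<and> ready G (tabs s') \<and> (\<forall>h\<ge>6. tabs s' h = (\<lambda>_. 0)) \<and>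
      (\<forall>i<0. \<forall>v<nV G. tabs s' 1 [int v, int i] = int (F i G v))) s"
    if "loose G s \<and> ready G (tabs s) \<and> (\<forall>h\<ge>6. tabs s h = (\<lambda>_. 0))" for G B s
    using that budget_pos by (intro wp_Skip) auto
  then show ?case by blast
next
  case (Suc K)
  then obtain P N c k where N: "6 \<le> N" and P: "\<And>G B s. good G \<Longrightarrow> (int (nV G) + 2) ^ k \<le> B \<Longrightarrow> loose G s \<Longrightarrow> ready G (tabs s) \<Longrightarrow>
      (\<forall>h\<ge>6. tabs s h = (\<lambda>_. 0)) \<Longrightarrow>
    wp B P (c * budget G) (\<lambda>s'. loose G s' \<and> ready G (tabs s') \<and> (\<forall>h\<ge>N. tabs s' h = (\<lambda>_. 0)) \<and>
      (\<forall>i<K. \<forall>v<nV G. tabs s' 1 [int v, int i] = int (F i G v))) s"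
    using less_SucI by blast
  have "computable (\<lambda>G \<phi>. int (F K G (\<phi> 0)))" using Suc.prems unfolding computable_count_def by simp
  then obtain P' N' e c' k' where C: "computes N P' N' e c' k' (\<lambda>G \<phi>. int (F K G (\<phi> 0)))"
    using N unfolding computable_def by blast
  then have N': "N \<le> N'" by (simp add: computes_def)
  let ?w = "nest [(0, Rng 0)] (Store 1 [rvar 0, Const (int K)] e)"
  let ?c = "nest_cost [(0, Rng 0)] (3 + cost e)"
  \<comment> \<open>The summand \<open>K\<close> lets the column number fit into a machine word,
    since \<open>K\<close> is below the \<open>K\<close>-th power of 2.\<close>
  let ?k = "k + k' + K + 2"
  let ?Q = "\<lambda>G s'. loose G s' \<and> ready G (tabs s') \<and> (\<forall>h\<ge>N'. tabs s' h = (\<lambda>_. 0)) \<and>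
      (\<forall>i<Suc K. \<forall>v<nV G. tabs s' 1 [int v, int i] = int (F i G v))"
  have "wp B (Seq P (Seq P' ?w)) ((c + (c' + ?c)) * budget G) (?Q G) s"
    if a: "good G" "(int (nV G) + 2) ^ ?k \<le> B" "loose G s" "ready G (tabs s)" "\<forall>h\<ge>6. tabs s h = (\<lambda>_. 0)" for G B s
  proof -
    have pw: "(int (nV G) + 2) ^ j \<le> B" if "j \<le> ?k" for j
      using power_increasing[OF that, of "int (nV G) + 2"] a(2) by simp
    note B = B_ge[OF a(1), of "k + k' + K" B, OF a(2)]
    have "int K \<le> int (2 ^ K)" using less_exp[of K] by (simp only: of_nat_le_iff)
    also have "\<dots> \<le> (int (nV G) + 2) ^ K" by (simp add: power_mono)
    also have "\<dots> \<le> B" by (rule pw) simp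
    finally have KB: "int K \<le> B" .
    show ?thesis
    proof (rule wp_Seq[OF wp_mono[OF P[OF a(1) _ a(3-5)] order_refl]])
      show "(int (nV G) + 2) ^ k \<le> B" by (rule pw) simp
      fix s1 assume s1: "loose G s1 \<and> ready G (tabs s1) \<and> (\<forall>h\<ge>N. tabs s1 h = (\<lambda>_. 0)) \<and>
        (\<forall>i<K. \<forall>v<nV G. tabs s1 1 [int v, int i] = int (F i G v))"
      have C1: "wp B P' (c' * budget G) (\<lambda>s'. loose G s' \<and> (\<forall>h<N. tabs s' h = tabs s1 h) \<and>
         (\<forall>h\<ge>N'. tabs s' h = (\<lambda>_. 0)) \<and> evaluates G B (tabs s') N' e (\<lambda>G \<phi>. int (F K G (\<phi> 0)))) s1"
        by (rule computesD[OF C a(1) pw]) (use s1 in auto)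
      show "wp B (Seq P' ?w) ((c' + ?c) * budget G) (?Q G) s1"
      proof (rule wp_Seq[OF wp_mono[OF C1 order_refl]])
        fix s2 assume s2: "loose G s2 \<and> (\<forall>h<N. tabs s2 h = tabs s1 h) \<and>
         (\<forall>h\<ge>N'. tabs s2 h = (\<lambda>_. 0)) \<and> evaluates G B (tabs s2) N' e (\<lambda>G \<phi>. int (F K G (\<phi> 0)))"
        have w: "wp B ?w (?c * budget G) (\<lambda>s'. loose G s' \<and> (\<forall>h. h \<noteq> 1 \<longrightarrow> tabs s' h = tabs s2 h) \<and>
          (\<forall>v<nV G. tabs s' 1 [int v, int K] = int (F K G v)) \<and>
          (\<forall>key. (\<forall>v. key \<noteq> [v, int K]) \<longrightarrow> tabs s' 1 key = tabs s2 1 key)) s2"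
          by (rule wp_write_output[OF a(1) B(1,2) KB, of N']) (use s2 N N' in auto)
        show "wp B ?w (?c * budget G) (?Q G) s2"
        proof (rule wp_mono[OF w order_refl])
          fix s3 assume s3: "loose G s3 \<and> (\<forall>h. h \<noteq> 1 \<longrightarrow> tabs s3 h = tabs s2 h) \<and>
            (\<forall>v<nV G. tabs s3 1 [int v, int K] = int (F K G v)) \<and>
            (\<forall>key. (\<forall>v. key \<noteq> [v, int K]) \<longrightarrow> tabs s3 1 key = tabs s2 1 key)"
          have "ready G (tabs s3)"
            by (rule ready_cong[of G "tabs s1"]) (use s1 s2 s3 N in auto)
          moreover have "tabs s3 1 [int v, int i] = int (F i G v)" if "i < Suc K" "v < nV G" for i v
          proof (cases "i = K")
            case True
            then show ?thesis using s3 that by simp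
          next
            case False
            then have "tabs s3 1 [int v, int i] = tabs s2 1 [int v, int i]" using s3 by simp
            also have "tabs s2 1 = tabs s1 1" using s2 N by simp
            finally show ?thesis using s1 that False by simp
          qed
          ultimately show "?Q G s3" using s2 s3 N N' by auto
        qed
      qed (simp add: add_mult_distrib)
    qed (simp add: add_mult_distrib)
  qed
  moreover have "6 \<le> N'" using N N' by simp
  ultimately show ?case by blast
qed

section \<open>Building the tables\<close>

definition built :: "nat pair_pre_digraph \<Rightarrow> nat set \<Rightarrow> ram \<Rightarrow> bool" where
  "built G H s \<longleftrightarrow> loose G s \<and> (\<exists>L. stored (tabs s) (fam G) H L) \<and> (\<forall>h\<ge>2. h \<notin> H \<longrightarrow> tabs s h = (\<lambda>_. 0))"

lemma rep_empty: "rep (\<lambda>_. 0) (\<lambda>_. [])"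
  by (simp add: rep_def)

lemma wp_build:
  assumes G: "good G" and B: "int (Mx G) < B" "2 \<le> B" and s: "built G H s"
    and ls: "levels_in H ls" "wf_levels ls" and h: "h \<notin> H" "2 \<le> h"
    and ev: "\<And>s' \<phi> L. stored (tabs s) (fam G) H L \<Longrightarrow> \<forall>h'. h' \<noteq> h \<longrightarrow> tabs s' h' = tabs s h' \<Longrightarrow> pinned G \<phi> s' \<Longrightarrow>
      rel G ls \<phi> \<Longrightarrow>
      (\<forall>k\<in>set (x # c # ks). fits B s' k) \<and> map (val s') ks = map int (ks' \<phi>) \<and> val s' x = int (x' \<phi>) \<and>
      val s' c = of_bool (c' \<phi>) \<and> (c' \<phi> \<longrightarrow> x' \<phi> < nV G)"
    and fam: "\<And>key \<phi>0. fam G h key = {x' \<phi> |\<phi>. \<phi> \<in> asgs (rs G) (fam G) ls \<phi>0 \<and> c' \<phi> \<and> ks' \<phi> = key}"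
    and steps: "\<And>\<phi>. nsteps (rs G) (fam G) ls \<phi> \<le> b * budget G"
  shows "wp B (nest ls (ins h ks x c)) (nest_cost ls (ins_cost ks x c) * b * budget G) (built G (insert h H)) s"
proof -
  obtain L where L: "stored (tabs s) (fam G) H L" using s by (auto simp: built_def)
  define \<phi>0 where "\<phi>0 x = nat (regs s (var x))" for x
  have st: "st (rs G) (Mx G) \<phi>0 (vars ls) s" using s unfolding built_def st_def \<phi>0_def by auto
  have "wp B (nest ls (ins h ks x c)) (nest_cost ls (ins_cost ks x c) * nsteps (rs G) (fam G) ls \<phi>0)
    (\<lambda>s'. st (rs G) (Mx G) \<phi>0 UNIV s' \<and> (\<forall>h'. h' \<noteq> h \<longrightarrow> tabs s' h' = tabs s h') \<and>
      (\<exists>L1. rep (tabs s' h) L1 \<and> (\<forall>key. set (L1 key) = {} \<union> {x' \<phi> |\<phi>. \<phi> \<in> asgs (rs G) (fam G) ls \<phi>0 \<and> c' \<phi> \<and> ks' \<phi> = key}))) s"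
  proof (rule wp_ins[where ?L0.0 = "\<lambda>_. []" and ?S0.0 = "\<lambda>_. {}", OF B _ _ L ls(1) _ ls(2) st h(1)])
    show "rs G 0 \<le> Mx G" "rs G 1 \<le> Mx G" by (auto simp: rs_def Mx_def)
    show "fam G h ks \<subseteq> {..<rs G 0}" for h ks using fam_sub[OF G] by (simp add: rs_def)
    show "rep (tabs s h) (\<lambda>_. [])" using s h rep_empty by (simp add: built_def)
    fix s' \<phi> assume a: "\<phi> \<in> asgs (rs G) (fam G) ls \<phi>0" "\<forall>h'. h' \<noteq> h \<longrightarrow> tabs s' h' = tabs s h'" "pinned G \<phi> s'"
    have "rel G ls \<phi>" using a(1) by (simp add: asgs_def)
    from ev[OF L a(2,3) this]
    show "(\<forall>k\<in>set (x # c # ks). fits B s' k) \<and> map (val s') ks = map int (ks' \<phi>) \<and> val s' x = int (x' \<phi>) \<and>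
      val s' c = of_bool (c' \<phi>) \<and> (c' \<phi> \<longrightarrow> x' \<phi> < rs G 0)" by (simp add: rs_def)
  qed auto
  then show ?thesis
  proof (rule wp_mono)
    show "nest_cost ls (ins_cost ks x c) * nsteps (rs G) (fam G) ls \<phi>0 \<le> nest_cost ls (ins_cost ks x c) * b * budget G"
      unfolding mult.assoc by (rule mult_le_mono2[OF steps])
    fix s' assume a: "st (rs G) (Mx G) \<phi>0 UNIV s' \<and> (\<forall>h'. h' \<noteq> h \<longrightarrow> tabs s' h' = tabs s h') \<and>
      (\<exists>L1. rep (tabs s' h) L1 \<and> (\<forall>key. set (L1 key) = {} \<union> {x' \<phi> |\<phi>. \<phi> \<in> asgs (rs G) (fam G) ls \<phi>0 \<and> c' \<phi> \<and> ks' \<phi> = key}))"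
    then obtain L1 where L1: "rep (tabs s' h) L1" "\<And>key. set (L1 key) = fam G h key"
      unfolding fam[symmetric] by auto
    have "stored (tabs s') (fam G) (insert h H) (L(h := L1))"
      using L L1 a h(1) by (auto simp: stored_def)
    moreover have "loose G s'" using a by (simp add: st_def)
    moreover have "\<forall>h'\<ge>2. h' \<notin> insert h H \<longrightarrow> tabs s' h' = (\<lambda>_. 0)" using a s by (simp add: built_def)
    ultimately show "built G (insert h H) s'" unfolding built_def by blast
  qed
qed

lemma fam_iff:
  "v \<in> fam G 2 key \<longleftrightarrow> (\<exists>u. key = [u] \<and> nbr G u v)"
  "v \<in> fam G 3 key \<longleftrightarrow> (\<exists>u. key = [u] \<and> onbr G u v)"
  "v \<in> fam G 4 key \<longleftrightarrow> (\<exists>x y. key = [x, y] \<and> nbr G x y \<and> nbr G x v \<and> nbr G y v)"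
  "v \<in> fam G 5 key \<longleftrightarrow> (\<exists>a b c. key = [a, b, c] \<and> onbr G a b \<and> onbr G b c \<and> onbr G a c \<and>
     onbr G a v \<and> onbr G b v \<and> onbr G c v)"
proof -
  show "v \<in> fam G 2 key \<longleftrightarrow> (\<exists>u. key = [u] \<and> nbr G u v)"
    by (cases "(G, 2::nat, key)" rule: fam.cases) simp_all
  show "v \<in> fam G 3 key \<longleftrightarrow> (\<exists>u. key = [u] \<and> onbr G u v)"
    by (cases "(G, 3::nat, key)" rule: fam.cases) simp_all
  show "v \<in> fam G 4 key \<longleftrightarrow> (\<exists>x y. key = [x, y] \<and> nbr G x y \<and> nbr G x v \<and> nbr G y v)"
    by (cases "(G, 4::nat, key)" rule: fam.cases) simp_all
  show "v \<in> fam G 5 key \<longleftrightarrow> (\<exists>a b c. key = [a, b, c] \<and> onbr G a b \<and> onbr G b c \<and> onbr G a c \<and>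
     onbr G a v \<and> onbr G b v \<and> onbr G c v)"
    by (cases "(G, 5::nat, key)" rule: fam.cases) simp_all
qed

lemma out_degree_fam: "out_degree (with_proj G) u = card (fam G 2 [u])"
proof -
  have "out_arcs (with_proj G) u = Pair u ` fam G 2 [u]" by (auto simp: out_arcs_def)
  then show ?thesis by (simp add: out_degree_def card_image inj_on_def)
qed

lemma card_fam_le: "good G \<Longrightarrow> int (card (fam G h ks)) \<le> int (Mx G)"
  using card_mono[OF _ fam_sub[of G h ks]] by (simp add: Mx_def)

text \<open>Degrees are the stored cardinalities of the neighbour sets. The two cases of
  \<open>deg_less\<close> exclude each other, so adding their flags gives a flag again.\<close>

lemma wp_build_out:
  assumes G: "good G" and B: "int (Mx G) < B" "2 \<le> B" and s: "built G {2} s"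
  defines "ls \<equiv> [(0, Rng 0), (1, Fam 2 [0])]"
    and "c \<equiv> (let d = (\<lambda>x. Lookup 2 (Const 1 # map rvar [x])) in
      Op Plus (Op Less (d 0) (d 1)) (Op Times (Op Equal (d 0) (d 1)) (Op Less (rvar 0) (rvar 1))))"
  shows "wp B (nest ls (ins 3 [rvar 0] (rvar 1) c)) (nest_cost ls (ins_cost [rvar 0] (rvar 1) c) * big * budget G) (built G (insert 3 {2})) s"
proof (rule wp_build[OF G B s, where ks' = "\<lambda>\<phi>. [\<phi> 0]" and x' = "\<lambda>\<phi>. \<phi> 1" and c' = "\<lambda>\<phi>. deg_less G (\<phi> 0) (\<phi> 1)"])
  fix s' \<phi> L assume a: "stored (tabs s) (fam G) {2} L" "\<forall>h'. h' \<noteq> 3 \<longrightarrow> tabs s' h' = tabs s h'" "pinned G \<phi> s'" "rel G ls \<phi>"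
  have r: "regs s' (var x) = int (\<phi> x)" for x using a(3) unfolding st_def by blast
  have f: "fits B s' (rvar x)" for x by (rule fits_rvar[OF a(3) B(1)])
  have d: "val s' (Lookup 2 (Const 1 # map rvar [x])) = int (card (fam G 2 [\<phi> x]))" for x
    using stored_val(2)[OF a(1) _ _ a(3), of 2 "[x]"] a(2) by simp
  have fd: "fits B s' (Lookup 2 (Const 1 # map rvar [x]))" for x
    using d[of x] f[of x] card_fam_le[OF G, of 2 "[\<phi> x]"] B by simp
  have "fits B s' c" "val s' c = of_bool (deg_less G (\<phi> 0) (\<phi> 1))"
    using fd[of 0] fd[of 1] f[of 0] f[of 1] d[of 0] d[of 1] r[of 0] r[of 1] B
    by (auto simp: c_def deg_less_def out_degree_fam simp del: fam.simps)
  moreover have "\<phi> 1 < nV G" using a(4) good_arc(2)[OF G] by (auto simp: ls_def)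
  ultimately show "(\<forall>k\<in>set (rvar 1 # c # [rvar 0]). fits B s' k) \<and> map (val s') [rvar 0] = map int [\<phi> 0] \<and>
    val s' (rvar 1) = int (\<phi> 1) \<and> val s' c = of_bool (deg_less G (\<phi> 0) (\<phi> 1)) \<and> (deg_less G (\<phi> 0) (\<phi> 1) \<longrightarrow> \<phi> 1 < nV G)"
    using f[of 0] f[of 1] r[of 0] r[of 1] by (simp del: fits_simps(2))
next
  fix key and \<phi>0 :: "nat \<Rightarrow> nat"
  show "fam G 3 key = {\<phi> 1 |\<phi>. \<phi> \<in> asgs (rs G) (fam G) ls \<phi>0 \<and> deg_less G (\<phi> 0) (\<phi> 1) \<and> [\<phi> 0] = key}"
  proof (intro equalityI subsetI)
    fix v assume "v \<in> fam G 3 key"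
    then obtain u where u: "key = [u]" "onbr G u v" unfolding fam_iff by blast
    let ?\<phi> = "\<phi>0(0 := u, 1 := v)"
    have "?\<phi> \<in> asgs (rs G) (fam G) ls \<phi>0"
      using oarc_arc[OF u(2)] good_arc(1)[OF G oarc_arc[OF u(2)]] by (simp add: asgs_def ls_def vars_def rs_def)
    moreover have "deg_less G (?\<phi> 0) (?\<phi> 1)" using u by (simp add: orient_def)
    ultimately show "v \<in> {\<phi> 1 |\<phi>. \<phi> \<in> asgs (rs G) (fam G) ls \<phi>0 \<and> deg_less G (\<phi> 0) (\<phi> 1) \<and> [\<phi> 0] = key}"
      using u(1) by (intro CollectI exI[of _ ?\<phi>]) simp
  next
    fix v assume "v \<in> {\<phi> 1 |\<phi>. \<phi> \<in> asgs (rs G) (fam G) ls \<phi>0 \<and> deg_less G (\<phi> 0) (\<phi> 1) \<and> [\<phi> 0] = key}"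
    then obtain \<phi> where p: "v = \<phi> 1" "\<phi> \<in> asgs (rs G) (fam G) ls \<phi>0" "deg_less G (\<phi> 0) (\<phi> 1)" "[\<phi> 0] = key" by blast
    from p(2) have "nbr G (\<phi> 0) (\<phi> 1)" by (simp add: asgs_def ls_def)
    then show "v \<in> fam G 3 key" unfolding fam_iff using p by (intro exI[of _ "\<phi> 0"]) (simp add: orient_def)
  qed
next
  show "nsteps (rs G) (fam G) ls \<phi> \<le> big * budget G" for \<phi>
    using star_steps[OF G, of 0 "[1]" \<phi>] by (simp add: ls_def star_def del: fam.simps)
qed (auto simp: ls_def)

text \<open>All wedges are tested for a closing edge, which takes time proportional to their number
  plus \<open>n\<close>, \<open>m\<close> and a constant.\<close>

lemma wp_build_triangles:
  assumes G: "good G" and B: "int (Mx G) < B" "2 \<le> B" and s: "built G {3, 2} s"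
  defines "ls \<equiv> [(0, Rng 0), (1, Fam 2 [0]), (2, Fam 2 [0])]"
    and "c \<equiv> Lookup 2 (Const 0 # rvar 2 # map rvar [1])"
  shows "wp B (nest ls (ins 4 [rvar 0, rvar 1] (rvar 2) c)) (nest_cost ls (ins_cost [rvar 0, rvar 1] (rvar 2) c) * big * budget G)
    (built G (insert 4 {3, 2})) s"
proof (rule wp_build[OF G B s, where ks' = "\<lambda>\<phi>. [\<phi> 0, \<phi> 1]" and x' = "\<lambda>\<phi>. \<phi> 2" and c' = "\<lambda>\<phi>. nbr G (\<phi> 1) (\<phi> 2)"])
  fix s' \<phi> L assume a: "stored (tabs s) (fam G) {3, 2} L" "\<forall>h'. h' \<noteq> 4 \<longrightarrow> tabs s' h' = tabs s h'" "pinned G \<phi> s'" "rel G ls \<phi>"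
  have r: "regs s' (var x) = int (\<phi> x)" for x using a(3) unfolding st_def by blast
  have f: "fits B s' (rvar x)" for x by (rule fits_rvar[OF a(3) B(1)])
  have d: "val s' c = of_bool (\<phi> 2 \<in> fam G 2 (map \<phi> [1]))"
    unfolding c_def by (rule stored_val(1)[OF a(1) _ _ a(3)]) (use a(2) in auto)
  then have d': "val s' c = of_bool (nbr G (\<phi> 1) (\<phi> 2))" by simp
  have "fits B s' c" using d' f[of 1] f[of 2] B unfolding c_def by (simp del: fits_simps(2))
  moreover have "\<phi> 2 < nV G" using a(4) good_arc(2)[OF G] by (auto simp: ls_def)
  ultimately show "(\<forall>k\<in>set (rvar 2 # c # [rvar 0, rvar 1]). fits B s' k) \<and> map (val s') [rvar 0, rvar 1] = map int [\<phi> 0, \<phi> 1] \<and>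
    val s' (rvar 2) = int (\<phi> 2) \<and> val s' c = of_bool (nbr G (\<phi> 1) (\<phi> 2)) \<and> (nbr G (\<phi> 1) (\<phi> 2) \<longrightarrow> \<phi> 2 < nV G)"
    using f[of 0] f[of 1] f[of 2] r[of 0] r[of 1] r[of 2] d' by (simp del: fits_simps(2))
next
  fix key and \<phi>0 :: "nat \<Rightarrow> nat"
  show "fam G 4 key = {\<phi> 2 |\<phi>. \<phi> \<in> asgs (rs G) (fam G) ls \<phi>0 \<and> nbr G (\<phi> 1) (\<phi> 2) \<and> [\<phi> 0, \<phi> 1] = key}"
  proof (intro equalityI subsetI)
    fix v assume "v \<in> fam G 4 key"
    then obtain x y where u: "key = [x, y]" "nbr G x y" "nbr G x v" "nbr G y v" unfolding fam_iff by blast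
    let ?\<phi> = "\<phi>0(0 := x, 1 := y, 2 := v)"
    have "?\<phi> \<in> asgs (rs G) (fam G) ls \<phi>0"
      using u good_arc(1)[OF G u(2)] by (simp add: asgs_def ls_def vars_def rs_def)
    then show "v \<in> {\<phi> 2 |\<phi>. \<phi> \<in> asgs (rs G) (fam G) ls \<phi>0 \<and> nbr G (\<phi> 1) (\<phi> 2) \<and> [\<phi> 0, \<phi> 1] = key}"
      using u by (intro CollectI exI[of _ ?\<phi>]) simp
  next
    fix v assume "v \<in> {\<phi> 2 |\<phi>. \<phi> \<in> asgs (rs G) (fam G) ls \<phi>0 \<and> nbr G (\<phi> 1) (\<phi> 2) \<and> [\<phi> 0, \<phi> 1] = key}"
    then obtain \<phi> where p: "v = \<phi> 2" "\<phi> \<in> asgs (rs G) (fam G) ls \<phi>0" "nbr G (\<phi> 1) (\<phi> 2)" "[\<phi> 0, \<phi> 1] = key" by blast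
    from p(2) have "nbr G (\<phi> 0) (\<phi> 1)" "nbr G (\<phi> 0) (\<phi> 2)" by (simp_all add: asgs_def ls_def)
    then show "v \<in> fam G 4 key" unfolding fam_iff using p by (intro exI[of _ "\<phi> 0"] exI[of _ "\<phi> 1"]) simp
  qed
next
  show "nsteps (rs G) (fam G) ls \<phi> \<le> big * budget G" for \<phi>
    using star_steps[OF G, of 0 "[1, 2]" \<phi>] by (simp add: ls_def star_def del: fam.simps)
qed (auto simp: ls_def)

text \<open>Two triangles on an arc span a diamond, so testing all such pairs for the missing arc
  and for the right directions finds the directed 4-cliques within the diamond bound.\<close>

lemma wp_build_cliques:
  assumes G: "good G" and B: "int (Mx G) < B" "2 \<le> B" and s: "built G {4, 3, 2} s"
  defines "ls \<equiv> [(0, Rng 0), (1, Fam 3 [0]), (2, Fam 4 [0, 1]), (3, Fam 4 [0, 1])]"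
    and "c \<equiv> (let o' = (\<lambda>x y. Lookup 3 (Const 0 # rvar y # map rvar [x])) in
      Op Times (o' 0 2) (Op Times (o' 1 2) (Op Times (o' 0 3) (Op Times (o' 1 3) (o' 2 3)))))"
  shows "wp B (nest ls (ins 5 [rvar 0, rvar 1, rvar 2] (rvar 3) c))
    (nest_cost ls (ins_cost [rvar 0, rvar 1, rvar 2] (rvar 3) c) * big * budget G) (built G (insert 5 {4, 3, 2})) s"
proof (rule wp_build[OF G B s, where ks' = "\<lambda>\<phi>. [\<phi> 0, \<phi> 1, \<phi> 2]" and x' = "\<lambda>\<phi>. \<phi> 3" and
      c' = "\<lambda>\<phi>. onbr G (\<phi> 0) (\<phi> 2) \<and> onbr G (\<phi> 1) (\<phi> 2) \<and> onbr G (\<phi> 0) (\<phi> 3) \<and> onbr G (\<phi> 1) (\<phi> 3) \<and> onbr G (\<phi> 2) (\<phi> 3)"])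
  let ?c' = "\<lambda>\<phi>. onbr G (\<phi> 0) (\<phi> 2) \<and> onbr G (\<phi> 1) (\<phi> 2) \<and> onbr G (\<phi> 0) (\<phi> 3) \<and> onbr G (\<phi> 1) (\<phi> 3) \<and> onbr G (\<phi> 2) (\<phi> 3)"
  {
  fix s' \<phi> L assume a: "stored (tabs s) (fam G) {4, 3, 2} L" "\<forall>h'. h' \<noteq> 5 \<longrightarrow> tabs s' h' = tabs s h'" "pinned G \<phi> s'" "rel G ls \<phi>"
  have r: "regs s' (var x) = int (\<phi> x)" for x using a(3) unfolding st_def by blast
  have f: "fits B s' (rvar x)" for x by (rule fits_rvar[OF a(3) B(1)])
  let ?o = "\<lambda>x y. Lookup 3 (Const 0 # rvar y # map rvar [x])"
  have "val s' (?o x y) = of_bool (\<phi> y \<in> fam G 3 (map \<phi> [x]))" for x y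
    by (rule stored_val(1)[OF a(1) _ _ a(3)]) (use a(2) in auto)
  then have d: "val s' (?o x y) = of_bool (onbr G (\<phi> x) (\<phi> y))" for x y by simp
  have fd: "fits B s' (?o x y)" for x y using d[of y x] f[of x] f[of y] B by (simp del: fits_simps(2))
  have c: "c = Op Times (?o 0 2) (Op Times (?o 1 2) (Op Times (?o 0 3) (Op Times (?o 1 3) (?o 2 3))))"
    unfolding c_def Let_def by (rule refl)
  have "val s' c = of_bool (?c' \<phi>)"
    unfolding c val.simps(4) d op_val.simps of_bool_conj by (rule refl)
  moreover have "fits B s' c"
    unfolding c fits_simps(4) val.simps(4) d op_val.simps using B(2) by (intro conjI fd) auto
  moreover have "\<phi> 3 < nV G" using a(4) good_arc(2)[OF G] by (auto simp: ls_def)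
  ultimately show "(\<forall>k\<in>set (rvar 3 # c # [rvar 0, rvar 1, rvar 2]). fits B s' k) \<and>
    map (val s') [rvar 0, rvar 1, rvar 2] = map int [\<phi> 0, \<phi> 1, \<phi> 2] \<and>
    val s' (rvar 3) = int (\<phi> 3) \<and> val s' c = of_bool (?c' \<phi>) \<and> (?c' \<phi> \<longrightarrow> \<phi> 3 < nV G)"
    using f[of 0] f[of 1] f[of 2] f[of 3] r[of 0] r[of 1] r[of 2] r[of 3] by (simp del: fits_simps(2))
  }
  fix key and \<phi>0 :: "nat \<Rightarrow> nat"
  show "fam G 5 key = {\<phi> 3 |\<phi>. \<phi> \<in> asgs (rs G) (fam G) ls \<phi>0 \<and> ?c' \<phi> \<and> [\<phi> 0, \<phi> 1, \<phi> 2] = key}"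
  proof (intro equalityI subsetI)
    fix v assume "v \<in> fam G 5 key"
    then obtain x y z where u: "key = [x, y, z]" "onbr G x y" "onbr G y z" "onbr G x z" "onbr G x v" "onbr G y v" "onbr G z v"
      unfolding fam_iff by blast
    let ?\<phi> = "\<phi>0(0 := x, 1 := y, 2 := z, 3 := v)"
    have "?\<phi> \<in> asgs (rs G) (fam G) ls \<phi>0"
      using u u(2-6)[THEN oarc_arc] good_arc(1)[OF G oarc_arc[OF u(2)]] by (simp add: asgs_def ls_def vars_def rs_def)
    then show "v \<in> {\<phi> 3 |\<phi>. \<phi> \<in> asgs (rs G) (fam G) ls \<phi>0 \<and> ?c' \<phi> \<and> [\<phi> 0, \<phi> 1, \<phi> 2] = key}"
      using u by (intro CollectI exI[of _ ?\<phi>]) simp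
  next
    fix v assume "v \<in> {\<phi> 3 |\<phi>. \<phi> \<in> asgs (rs G) (fam G) ls \<phi>0 \<and> ?c' \<phi> \<and> [\<phi> 0, \<phi> 1, \<phi> 2] = key}"
    then obtain \<phi> where p: "v = \<phi> 3" "\<phi> \<in> asgs (rs G) (fam G) ls \<phi>0" "?c' \<phi>" "[\<phi> 0, \<phi> 1, \<phi> 2] = key" by blast
    from p(2) have "onbr G (\<phi> 0) (\<phi> 1)" by (simp add: asgs_def ls_def)
    then show "v \<in> fam G 5 key" unfolding fam_iff using p by (intro exI[of _ "\<phi> 0"] exI[of _ "\<phi> 1"] exI[of _ "\<phi> 2"]) simp
  qed
next
  show "nsteps (rs G) (fam G) ls \<phi> \<le> big * budget G" for \<phi>
    using triangle_pair_steps[OF G, of 0 1 2 3 \<phi>] by (simp add: ls_def del: fam.simps)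
qed (auto simp: ls_def)

section \<open>Reading the input\<close>

lemma listing_good:
  assumes "pair_graph G" "pverts G = {..<n}" "edge_listing G es"
  shows "good G" "nV G = n" "mE G = length es"
proof -
  show n: "nV G = n" using assms(2) by (simp add: nV_def)
  show "good G" using assms n by (simp add: good_def)
  have E: "edge_set G = (\<lambda>(u, v). {u, v}) ` set es"
    using assms(3) unfolding edge_set_def edge_listing_def by (auto simp: insert_commute image_iff set_eq_iff) blast+
  have "inj_on (\<lambda>(u, v). {u, v}) (set es)"
  proof (rule inj_onI)
    fix e e' assume e: "e \<in> set es" "e' \<in> set es" "(\<lambda>(u, v). {u, v}) e = (\<lambda>(u, v). {u, v}) e'"
    obtain u v u' v' where uv: "e = (u, v)" "e' = (u', v')" by (metis surj_pair)
    have "(v, u) \<notin> set es" using e(1) uv assms(3) unfolding edge_listing_def by blast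
    then show "e = e'" using e uv by (auto simp: doubleton_eq_iff)
  qed
  then show "mE G = length es" using E assms(3) by (simp add: mE_def card_image edge_listing_def distinct_card)
qed

definition end_point :: "nat \<Rightarrow> nat \<times> nat \<Rightarrow> nat" where
  "end_point d e = (if d = 0 then fst e else snd e)"

definition insert_ends :: "nat \<Rightarrow> nat \<Rightarrow> prog" where
  "insert_ends d d' = ins 2 [Lookup 0 [rvar 0, Const (int d)]] (Lookup 0 [rvar 0, Const (int d')]) (Const 1)"

definition insert_ends_cost :: "nat \<Rightarrow> nat \<Rightarrow> nat" where
  "insert_ends_cost d d' = nest_cost [(0, Rng 1)] (ins_cost [Lookup 0 [rvar 0, Const (int d)]] (Lookup 0 [rvar 0, Const (int d')]) (Const 1))"

lemma wp_insert_ends: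
  assumes G: "good G" and B: "int (Mx G) < B" "2 \<le> B" and s: "loose G s" and m: "mE G = length es"
    and es: "\<And>e. e \<in> set es \<Longrightarrow> fst e < nV G \<and> snd e < nV G"
    and T0: "\<And>i d. i < length es \<Longrightarrow> d < 2 \<Longrightarrow> tabs s 0 [int i, int d] = int (end_point d (es ! i))"
    and d: "d < 2" "d' < 2" and L0: "rep (tabs s 2) L0" "\<And>key. set (L0 key) = S key" "\<And>key. S key \<subseteq> {..<nV G}"
  shows "wp B (nest [(0, Rng 1)] (insert_ends d d')) (insert_ends_cost d d' * budget G)
    (\<lambda>s'. loose G s' \<and> (\<forall>h. h \<noteq> 2 \<longrightarrow> tabs s' h = tabs s h) \<and>
      (\<exists>L. rep (tabs s' 2) L \<and> (\<forall>key. set (L key) = S key \<union> {end_point d' e |e. e \<in> set es \<and> [end_point d e] = key}))) s"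
proof -
  let ?ls = "[(0, Rng 1)]"
  define \<phi>0 where "\<phi>0 x = nat (regs s (var x))" for x
  have st: "st (rs G) (Mx G) \<phi>0 (vars ?ls) s" using s unfolding st_def \<phi>0_def by auto
  let ?A = "asgs (rs G) (fam G) ?ls \<phi>0"
  have A: "\<phi> 0 < length es" if "\<phi> \<in> ?A" for \<phi> using that m by (simp add: asgs_def rs_def)
  have lt: "end_point d e < nV G" if "e \<in> set es" for d e using es[OF that] by (simp add: end_point_def)
  have str: "stored (tabs s) (fam G) {} (\<lambda>_ _. [])" by (simp add: stored_def)
  have "wp B (nest ?ls (insert_ends d d')) (insert_ends_cost d d' * nsteps (rs G) (fam G) ?ls \<phi>0)
    (\<lambda>s'. st (rs G) (Mx G) \<phi>0 UNIV s' \<and> (\<forall>h'. h' \<noteq> 2 \<longrightarrow> tabs s' h' = tabs s h') \<and>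
      (\<exists>L1. rep (tabs s' 2) L1 \<and> (\<forall>key. set (L1 key) = S key \<union>
        {end_point d' (es ! \<phi> 0) |\<phi>. \<phi> \<in> ?A \<and> True \<and> [end_point d (es ! \<phi> 0)] = key}))) s"
    unfolding insert_ends_def insert_ends_cost_def
  proof (rule wp_ins[OF B _ _ str _ _ _ st _ L0(1,2) _ _ refl])
    show "rs G 0 \<le> Mx G" "rs G 1 \<le> Mx G" by (auto simp: rs_def Mx_def)
    show "S key \<subseteq> {..<rs G 0}" for key using L0(3) by (simp add: rs_def)
    fix s' \<phi> assume a: "\<phi> \<in> ?A" "\<forall>h'. h' \<noteq> 2 \<longrightarrow> tabs s' h' = tabs s h'" "pinned G \<phi> s'"
    note i = A[OF a(1)]
    have r: "regs s' (var 0) = int (\<phi> 0)" using a(3) unfolding st_def by blast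
    have f: "fits B s' (rvar 0)" by (rule fits_rvar[OF a(3) B(1)])
    have v: "val s' (Lookup 0 [rvar 0, Const (int d)]) = int (end_point d (es ! \<phi> 0))" if "d < 2" for d
      using T0[OF i that] a(2) r by simp
    have e: "es ! \<phi> 0 \<in> set es" using i by simp
    have lt': "int (end_point d (es ! \<phi> 0)) \<le> B" for d using lt[OF e, of d] B(1) by (simp add: Mx_def)
    have "fits B s' (Lookup 0 [rvar 0, Const (int d)])" if "d < 2" for d
      using v[OF that] lt'[of d] f B(2) that by (simp del: fits_simps(2))
    then show "(\<forall>k\<in>set (Lookup 0 [rvar 0, Const (int d')] # Const 1 # [Lookup 0 [rvar 0, Const (int d)]]). fits B s' k) \<and>
      map (val s') [Lookup 0 [rvar 0, Const (int d)]] = map int [end_point d (es ! \<phi> 0)] \<and>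
      val s' (Lookup 0 [rvar 0, Const (int d')]) = int (end_point d' (es ! \<phi> 0)) \<and>
      val s' (Const 1) = of_bool True \<and> (True \<longrightarrow> end_point d' (es ! \<phi> 0) < rs G 0)"
      using v d B(2) lt[OF e] by (simp add: rs_def del: val.simps(3) fits_simps(3))
  qed auto
  then show ?thesis
  proof (rule wp_mono)
    have "nsteps (rs G) (fam G) ?ls \<phi>0 \<le> budget G" by (simp add: rs_def budget_def mE_def)
    then show "insert_ends_cost d d' * nsteps (rs G) (fam G) ?ls \<phi>0 \<le> insert_ends_cost d d' * budget G"
      by (rule mult_le_mono2)
    have "{end_point d' (es ! \<phi> 0) |\<phi>. \<phi> \<in> ?A \<and> True \<and> [end_point d (es ! \<phi> 0)] = key} =
      {end_point d' e |e. e \<in> set es \<and> [end_point d e] = key}" for key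
    proof (intro equalityI subsetI)
      fix v assume "v \<in> {end_point d' e |e. e \<in> set es \<and> [end_point d e] = key}"
      then obtain e where e: "e \<in> set es" "v = end_point d' e" "[end_point d e] = key" by blast
      then obtain i where i: "i < length es" "es ! i = e" by (metis in_set_conv_nth)
      then have "\<phi>0(0 := i) \<in> ?A" using m by (simp add: asgs_def rs_def)
      then show "v \<in> {end_point d' (es ! \<phi> 0) |\<phi>. \<phi> \<in> ?A \<and> True \<and> [end_point d (es ! \<phi> 0)] = key}"
        using e i by (intro CollectI exI[of _ "\<phi>0(0 := i)"]) simp
    next
      fix v assume "v \<in> {end_point d' (es ! \<phi> 0) |\<phi>. \<phi> \<in> ?A \<and> True \<and> [end_point d (es ! \<phi> 0)] = key}"
      then obtain \<phi> where "\<phi> \<in> ?A" "v = end_point d' (es ! \<phi> 0)" "[end_point d (es ! \<phi> 0)] = key" by blast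
      then show "v \<in> {end_point d' e |e. e \<in> set es \<and> [end_point d e] = key}" using A nth_mem by blast
    qed
    note eq = this
    fix s' assume "st (rs G) (Mx G) \<phi>0 UNIV s' \<and> (\<forall>h'. h' \<noteq> 2 \<longrightarrow> tabs s' h' = tabs s h') \<and>
      (\<exists>L1. rep (tabs s' 2) L1 \<and> (\<forall>key. set (L1 key) = S key \<union>
        {end_point d' (es ! \<phi> 0) |\<phi>. \<phi> \<in> ?A \<and> True \<and> [end_point d (es ! \<phi> 0)] = key}))"
    then show "loose G s' \<and> (\<forall>h. h \<noteq> 2 \<longrightarrow> tabs s' h = tabs s h) \<and>
      (\<exists>L. rep (tabs s' 2) L \<and> (\<forall>key. set (L key) = S key \<union> {end_point d' e |e. e \<in> set es \<and> [end_point d e] = key}))"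
      unfolding eq by (simp add: st_def)
  qed
qed

text \<open>Each undirected edge is listed in one direction only; the second pass with exchanged
  ends inserts the other direction.\<close>

lemma wp_read_input:
  assumes g: "pair_graph G" "pverts G = {..<n}" "edge_listing G es" and B: "int (Mx G) < B" "2 \<le> B"
  shows "wp B (Seq (nest [(0, Rng 1)] (insert_ends 0 1)) (nest [(0, Rng 1)] (insert_ends 1 0)))
    ((insert_ends_cost 0 1 + insert_ends_cost 1 0) * budget G) (built G {2}) (input_state n es)"
proof -
  note G = listing_good[OF g]
  let ?s = "input_state n es"
  have P: "parcs G = set es \<union> (set es)\<inverse>" using g(3) by (simp add: edge_listing_def)
  have es: "fst e < nV G \<and> snd e < nV G" if "e \<in> set es" for e
    using that P good_arc(1,2)[OF G(1), of "fst e" "snd e"] by simp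
  have s: "loose G ?s"
    using G(2,3) by (auto simp: st_def input_state_def rs_def Mx_def less_2_cases_iff)
  have T0: "tabs ?s 0 [int i, int d] = int (end_point d (es ! i))" if "i < length es" "d < 2" for i d
    using that by (auto simp: input_state_def end_point_def less_2_cases_iff)
  have z: "tabs ?s h = (\<lambda>_. 0)" if "h \<noteq> 0" for h using that by (simp add: input_state_def)
  let ?S = "\<lambda>key. {end_point 1 e |e. e \<in> set es \<and> [end_point 0 e] = key}"
  have S: "?S key \<subseteq> {..<nV G}" for key using es by (auto simp: end_point_def)
  have r0: "rep (tabs ?s 2) (\<lambda>_. [])" using z[of 2] rep_empty by simp
  have w1: "wp B (nest [(0, Rng 1)] (insert_ends 0 1)) (insert_ends_cost 0 1 * budget G)
    (\<lambda>s'. loose G s' \<and> (\<forall>h. h \<noteq> 2 \<longrightarrow> tabs s' h = tabs ?s h) \<and>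
      (\<exists>L. rep (tabs s' 2) L \<and> (\<forall>key. set (L key) = {} \<union> ?S key))) ?s"
    by (rule wp_insert_ends[OF G(1) B s G(3) es T0 _ _ r0]) auto
  show ?thesis
  proof (rule wp_Seq[OF wp_mono[OF w1 order_refl]])
    fix s1 assume a: "loose G s1 \<and> (\<forall>h. h \<noteq> 2 \<longrightarrow> tabs s1 h = tabs ?s h) \<and>
      (\<exists>L. rep (tabs s1 2) L \<and> (\<forall>key. set (L key) = {} \<union> ?S key))"
    then obtain L where L: "rep (tabs s1 2) L" "\<And>key. set (L key) = ?S key" by auto
    have T1: "tabs s1 0 [int i, int d] = int (end_point d (es ! i))" if "i < length es" "d < 2" for i d
      using T0[OF that] a by simp
    have s1: "loose G s1" using a by blast
    have "wp B (nest [(0, Rng 1)] (insert_ends 1 0)) (insert_ends_cost 1 0 * budget G)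
      (\<lambda>s'. loose G s' \<and> (\<forall>h. h \<noteq> 2 \<longrightarrow> tabs s' h = tabs s1 h) \<and>
        (\<exists>L. rep (tabs s' 2) L \<and> (\<forall>key. set (L key) = ?S key \<union> {end_point 0 e |e. e \<in> set es \<and> [end_point 1 e] = key}))) s1"
      by (rule wp_insert_ends[OF G(1) B s1 G(3) es T1 _ _ L S]) auto
    then show "wp B (nest [(0, Rng 1)] (insert_ends 1 0)) (insert_ends_cost 1 0 * budget G) (built G {2}) s1"
    proof (rule wp_mono[OF _ order_refl])
      fix s2 assume b: "loose G s2 \<and> (\<forall>h. h \<noteq> 2 \<longrightarrow> tabs s2 h = tabs s1 h) \<and>
        (\<exists>L. rep (tabs s2 2) L \<and> (\<forall>key. set (L key) = ?S key \<union> {end_point 0 e |e. e \<in> set es \<and> [end_point 1 e] = key}))"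
      then obtain L' where L': "rep (tabs s2 2) L'"
        "\<And>key. set (L' key) = ?S key \<union> {end_point 0 e |e. e \<in> set es \<and> [end_point 1 e] = key}" by blast
      have "set (L' key) = fam G 2 key" for key
      proof (intro equalityI subsetI)
        fix v assume "v \<in> set (L' key)"
        then show "v \<in> fam G 2 key" unfolding L'(2) fam_iff P by (auto simp: end_point_def)
      next
        fix v assume "v \<in> fam G 2 key"
        then obtain u where u: "key = [u]" "(u, v) \<in> set es \<or> (v, u) \<in> set es" unfolding fam_iff P by auto
        then show "v \<in> set (L' key)" unfolding L'(2) end_point_def by force
      qed
      then have "stored (tabs s2) (fam G) {2} (\<lambda>_. L')" using L'(1) by (simp add: stored_def)
      moreover have "\<forall>h\<ge>2. h \<notin> {2} \<longrightarrow> tabs s2 h = (\<lambda>_. 0)" using a b z by simp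
      ultimately show "built G {2} s2" using b unfolding built_def by blast
    qed
  qed (simp add: add_mult_distrib)
qed

lemma preprocessing:
  "\<exists>P c. \<forall>G n es B. pair_graph G \<and> pverts G = {..<n} \<and> edge_listing G es \<and> int (Mx G) < B \<and> 2 \<le> B \<longrightarrow>
    wp B P (c * budget G) (\<lambda>s. loose G s \<and> ready G (tabs s) \<and> (\<forall>h\<ge>6. tabs s h = (\<lambda>_. 0))) (input_state n es)"
proof -
  obtain P3 c3 where p3: "\<And>G B s. good G \<Longrightarrow> int (Mx G) < B \<Longrightarrow> 2 \<le> B \<Longrightarrow> built G {2} s \<Longrightarrow>
    wp B P3 (c3 * budget G) (built G {3, 2}) s" by (rule that) (rule wp_build_out)
  obtain P4 c4 where p4: "\<And>G B s. good G \<Longrightarrow> int (Mx G) < B \<Longrightarrow> 2 \<le> B \<Longrightarrow> built G {3, 2} s \<Longrightarrow>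
    wp B P4 (c4 * budget G) (built G {4, 3, 2}) s" by (rule that) (rule wp_build_triangles)
  obtain P5 c5 where p5: "\<And>G B s. good G \<Longrightarrow> int (Mx G) < B \<Longrightarrow> 2 \<le> B \<Longrightarrow> built G {4, 3, 2} s \<Longrightarrow>
    wp B P5 (c5 * budget G) (built G {5, 4, 3, 2}) s" by (rule that) (rule wp_build_cliques)
  let ?P2 = "Seq (nest [(0, Rng 1)] (insert_ends 0 1)) (nest [(0, Rng 1)] (insert_ends 1 0))"
  let ?c2 = "insert_ends_cost 0 1 + insert_ends_cost 1 0"
  have H: "{5, 4, 3, 2} = {2..5::nat}" by auto
  have fin: "loose G s \<and> ready G (tabs s) \<and> (\<forall>h\<ge>6. tabs s h = (\<lambda>_. 0))" if "built G {5, 4, 3, 2} s" for G s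
    using that unfolding built_def ready_def H by auto
  have "wp B (Seq (Seq (Seq ?P2 P3) P4) P5) ((?c2 + c3 + c4 + c5) * budget G)
    (\<lambda>s. loose G s \<and> ready G (tabs s) \<and> (\<forall>h\<ge>6. tabs s h = (\<lambda>_. 0))) (input_state n es)"
    if g: "pair_graph G" "pverts G = {..<n}" "edge_listing G es" and B: "int (Mx G) < B" "2 \<le> B" for G n es B
  proof -
    note G = listing_good(1)[OF g]
    have 2: "wp B (Seq ?P2 P3) ((?c2 + c3) * budget G) (built G {3, 2}) (input_state n es)"
      by (rule wp_Seq[OF wp_mono[OF wp_read_input[OF g B] order_refl p3[OF G B]]]) (simp_all add: add_mult_distrib)
    have 3: "wp B (Seq (Seq ?P2 P3) P4) ((?c2 + c3 + c4) * budget G) (built G {4, 3, 2}) (input_state n es)"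
      by (rule wp_Seq[OF wp_mono[OF 2 order_refl p4[OF G B]]]) (simp_all add: add_mult_distrib)
    have "wp B (Seq (Seq (Seq ?P2 P3) P4) P5) ((?c2 + c3 + c4 + c5) * budget G) (built G {5, 4, 3, 2}) (input_state n es)"
      by (rule wp_Seq[OF wp_mono[OF 3 order_refl p5[OF G B]]]) (simp_all add: add_mult_distrib)
    then show ?thesis by (rule wp_mono[OF _ order_refl]) (rule fin)
  qed
  then show ?thesis by blast
qed

theorem theorem4:
  shows "(\<exists>\<theta>. orbit_numbering \<theta>) \<and>
    (\<forall>\<theta>. orbit_numbering \<theta> \<longrightarrow>
      (\<exists>(P :: prog) (c :: nat) (k :: nat).
        \<forall>(G :: nat pair_pre_digraph) (n :: nat) (es :: (nat \<times> nat) list).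
          pair_graph G \<and> pverts G = {..<n} \<and> edge_listing G es \<longrightarrow>
          (\<exists>t s. exec ((int n + 2) ^ k) P (input_state n es) t s \<and>
            (\<forall>v<n. \<forall>i<73. tabs s 1 [int v, int i] = int (DM G v (\<theta> i))) \<and>
            t \<le> c * (num_copies wedge G + num_copies diamond G
                   + num_copies directed_3path (orient G)
                   + num_copies directed_bipyramid (orient G)
                   + card (edge_set G) + n + 1))))"
proof (intro conjI allI impI)
  show "\<exists>\<theta>. orbit_numbering \<theta>" by (rule ex_orbit_numbering[OF length_patterns])
  fix \<theta> assume "orbit_numbering \<theta>"
  then have "\<forall>i<73. computable_count (\<lambda>G v. DM G v (\<theta> i))"
    unfolding orbit_numbering_def using computable_DM by blast
  from wp_outputs[OF this] obtain P N c k where out: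
    "\<And>G B s. good G \<Longrightarrow> (int (nV G) + 2) ^ k \<le> B \<Longrightarrow> loose G s \<Longrightarrow> ready G (tabs s) \<Longrightarrow> \<forall>h\<ge>6. tabs s h = (\<lambda>_. 0) \<Longrightarrow>
      wp B P (c * budget G) (\<lambda>s'. loose G s' \<and> ready G (tabs s') \<and> (\<forall>h\<ge>N. tabs s' h = (\<lambda>_. 0)) \<and>
      (\<forall>i<73. \<forall>v<nV G. tabs s' 1 [int v, int i] = int (DM G v (\<theta> i)))) s"
    by blast
  obtain P0 c0 where "\<forall>G n es B. pair_graph G \<and> pverts G = {..<n} \<and> edge_listing G es \<and> int (Mx G) < B \<and> 2 \<le> B \<longrightarrow>
    wp B P0 (c0 * budget G) (\<lambda>s. loose G s \<and> ready G (tabs s) \<and> (\<forall>h\<ge>6. tabs s h = (\<lambda>_. 0))) (input_state n es)"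
    using preprocessing by (elim exE)
  then have pre: "\<And>G n es B. pair_graph G \<Longrightarrow> pverts G = {..<n} \<Longrightarrow> edge_listing G es \<Longrightarrow> int (Mx G) < B \<Longrightarrow> 2 \<le> B \<Longrightarrow>
    wp B P0 (c0 * budget G) (\<lambda>s. loose G s \<and> ready G (tabs s) \<and> (\<forall>h\<ge>6. tabs s h = (\<lambda>_. 0))) (input_state n es)"
    by blast
  show "\<exists>(P :: prog) (c :: nat) (k :: nat).
        \<forall>(G :: nat pair_pre_digraph) (n :: nat) (es :: (nat \<times> nat) list).
          pair_graph G \<and> pverts G = {..<n} \<and> edge_listing G es \<longrightarrow>
          (\<exists>t s. exec ((int n + 2) ^ k) P (input_state n es) t s \<and>
            (\<forall>v<n. \<forall>i<73. tabs s 1 [int v, int i] = int (DM G v (\<theta> i))) \<and>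
            t \<le> c * (num_copies wedge G + num_copies diamond G
                   + num_copies directed_3path (orient G)
                   + num_copies directed_bipyramid (orient G)
                   + card (edge_set G) + n + 1))"
  \<comment> \<open>The exponent \<open>k\<close> serves the output phase; the additional 2 lets
    \<open>n + m\<close> fit below the word bound during preprocessing.\<close>
  proof (rule exI[of _ "Seq P0 P"], rule exI[of _ "c0 + c"], rule exI[of _ "k + 2"], intro allI impI, elim conjE)
    fix G :: "nat pair_pre_digraph" and n :: nat and es :: "(nat \<times> nat) list"
    assume g: "pair_graph G" "pverts G = {..<n}" "edge_listing G es"
    note G = listing_good[OF g]
    let ?B = "(int n + 2) ^ (k + 2)"
    note B = B_ge[OF G(1), of k ?B, unfolded G(2), OF order_refl]
    have "wp ?B (Seq P0 P) ((c0 + c) * budget G)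
      (\<lambda>s'. \<forall>i<73. \<forall>v<nV G. tabs s' 1 [int v, int i] = int (DM G v (\<theta> i))) (input_state n es)"
    proof (rule wp_Seq[OF wp_mono[OF pre[OF g B(1,2)] order_refl]])
      fix s assume "loose G s \<and> ready G (tabs s) \<and> (\<forall>h\<ge>6. tabs s h = (\<lambda>_. 0))"
      then have "wp ?B P (c * budget G) (\<lambda>s'. loose G s' \<and> ready G (tabs s') \<and> (\<forall>h\<ge>N. tabs s' h = (\<lambda>_. 0)) \<and>
        (\<forall>i<73. \<forall>v<nV G. tabs s' 1 [int v, int i] = int (DM G v (\<theta> i)))) s"
        using B(5) G(2) by (intro out G(1)) auto
      then show "wp ?B P (c * budget G) (\<lambda>s'. \<forall>i<73. \<forall>v<nV G. tabs s' 1 [int v, int i] = int (DM G v (\<theta> i))) s"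
        by (rule wp_mono[OF _ order_refl]) blast
    qed (simp add: add_mult_distrib)
    then show "\<exists>t s. exec ?B (Seq P0 P) (input_state n es) t s \<and>
            (\<forall>v<n. \<forall>i<73. tabs s 1 [int v, int i] = int (DM G v (\<theta> i))) \<and>
            t \<le> (c0 + c) * (num_copies wedge G + num_copies diamond G
                   + num_copies directed_3path (orient G)
                   + num_copies directed_bipyramid (orient G)
                   + card (edge_set G) + n + 1)"
      unfolding wp_def budget_def G(2) by blast
  qed
qed

end
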